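(* Let $M$ be a smooth manifold, let $a>0$ and let $\{g_\varepsilon\}_{\varepsilon\in(-a,a)}$ be a $C^2$ family of pseudo-Riemannian metrics on $M$. For every point $p_0\in M$ and every $\varepsilon_0\in(0,a)$ there exists a neighborhood of $p_0$ in $M$ which is simultaneously convex for all the metrics $g_\varepsilon$, $\varepsilon\in[-\varepsilon_0,\varepsilon_0]$.
   Context: The family $\{g_\varepsilon\}_{\varepsilon\in(-a,a)}$ is viewed as a section of the pull-back bundle $\pi_2^*T^*M\otimes\pi_2^*T^*M$ over $(-a,a)\times M$, where $\pi_2:(-a,a)\times M\to M$, $\pi_2(\varepsilon,p)=p$; the family is $C^2$ if this section is $C^2$ (i.e. the metric coefficients are jointly $C^2$ in $(\varepsilon,p)$). An open set $U\subset M$ is convex for a pseudo-Riemannian metric $g$ if it is a normal neighborhood of each of its points: for every $q\in U$ there is an open star-shaped neighborhood $\tilde U_q$ of $0\in T_qM$ such that the exponential map $\exp_q$ of $g$ maps $\tilde U_q$ ($C^1$-)diffeomorphically onto $U$. In particular any two points $q_0,q_1\in U$ are joined by a unique geodesic segment $[0,1]\to M$ of $g$ contained in $U$. *)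

theory Defs
  imports "HOL-Analysis.Analysis"
begin

section \<open>Functions of class C^k and smooth manifolds\<close>

text \<open>Meant for open \<open>S\<close> only, where the derivatives taken in the full space make sense.\<close>

fun Ck_on :: "nat \<Rightarrow> ('a::euclidean_space \<Rightarrow> 'b::real_normed_vector) \<Rightarrow> 'a set \<Rightarrow> bool" where
  "Ck_on 0 f S \<longleftrightarrow> continuous_on S f"
| "Ck_on (Suc k) f S \<longleftrightarrow>
     (\<forall>x\<in>S. f differentiable (at x)) \<and> (\<forall>u. Ck_on k (\<lambda>x. frechet_derivative f (at x) u) S)"

definition smooth_on :: "('a::euclidean_space \<Rightarrow> 'b::real_normed_vector) \<Rightarrow> 'a set \<Rightarrow> bool" where
  "smooth_on f S \<longleftrightarrow> (\<forall>k. Ck_on k f S)"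

text \<open>A chart is its domain together with a coordinate map, whose values off the domain are
  irrelevant. The manifold is the whole type \<open>'m\<close>, of dimension \<open>CARD('n)\<close>, with the smooth
  structure generated by a (not necessarily maximal) atlas.\<close>

type_synonym ('m, 'n) chart = "'m set \<times> ('m \<Rightarrow> real^'n)"

definition chart_inv :: "('m, 'n) chart \<Rightarrow> real^'n \<Rightarrow> 'm" where
  "chart_inv c = inv_into (fst c) (snd c)"

definition smooth_atlas ::
    "('m::{t2_space,second_countable_topology}, 'n::finite) chart set \<Rightarrow> bool" where
  "smooth_atlas A \<longleftrightarrow>
     (\<Union>c\<in>A. fst c) = UNIV \<and>
     (\<forall>c\<in>A. open (fst c) \<and> open (snd c ` fst c) \<and>
             homeomorphism (fst c) (snd c ` fst c) (snd c) (chart_inv c)) \<and>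
     (\<forall>c\<in>A. \<forall>d\<in>A. smooth_on (snd d \<circ> chart_inv c) (snd c ` (fst c \<inter> fst d)))"

definition charts_at :: "('m, 'n) chart set \<Rightarrow> 'm \<Rightarrow> ('m, 'n) chart set" where
  "charts_at A p = {c\<in>A. p \<in> fst c}"


section \<open>Tangent vectors\<close>

text \<open>A tangent vector at \<open>p\<close> is the family of its coordinate vectors in all charts around \<open>p\<close>,
  related by the derivatives of the transition maps; entries for other charts are set to \<open>0\<close>.\<close>

type_synonym ('m, 'n) tangent = "('m, 'n) chart \<Rightarrow> real^'n"

definition tangent_space ::
    "('m, 'n::finite) chart set \<Rightarrow> 'm \<Rightarrow> ('m, 'n) tangent set" where
  "tangent_space A p =
     {v. (\<forall>c\<in>charts_at A p. \<forall>d\<in>charts_at A p.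
            v d = frechet_derivative (snd d \<circ> chart_inv c) (at (snd c p)) (v c)) \<and>
         (\<forall>c. c \<notin> charts_at A p \<longrightarrow> v c = 0)}"

text \<open>The tangent vector at \<open>p\<close> whose coordinate vector in the chart \<open>c\<close> is \<open>u\<close>.\<close>

definition coord_vec ::
    "('m, 'n::finite) chart set \<Rightarrow> ('m, 'n) chart \<Rightarrow> 'm \<Rightarrow> real^'n \<Rightarrow> ('m, 'n) tangent" where
  "coord_vec A c p u =
     (\<lambda>d. if d \<in> charts_at A p
          then frechet_derivative (snd d \<circ> chart_inv c) (at (snd c p)) u else 0)"

definition open_in_tangent_space ::
    "('m, 'n::finite) chart set \<Rightarrow> 'm \<Rightarrow> ('m, 'n) tangent set \<Rightarrow> bool" where
  "open_in_tangent_space A p S \<longleftrightarrow>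
     S \<subseteq> tangent_space A p \<and> (\<forall>c\<in>charts_at A p. open {u. coord_vec A c p u \<in> S})"

definition star_shaped :: "('m, 'n::finite) tangent set \<Rightarrow> bool" where
  "star_shaped S \<longleftrightarrow> (\<forall>v\<in>S. \<forall>t\<in>{0..1}. (\<lambda>c. t *\<^sub>R v c) \<in> S)"


section \<open>Pseudo-Riemannian metrics\<close>

type_synonym ('m, 'n) metric = "'m \<Rightarrow> ('m, 'n) tangent \<Rightarrow> ('m, 'n) tangent \<Rightarrow> real"

text \<open>Pointwise conditions only; regularity is part of the definition of a family below.\<close>

definition pseudo_Riemannian ::
    "('m, 'n::finite) chart set \<Rightarrow> ('m, 'n) metric \<Rightarrow> bool" where
  "pseudo_Riemannian A h \<longleftrightarrow>
     (\<forall>p. let T = tangent_space A p in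
        (\<forall>v\<in>T. \<forall>w\<in>T. \<forall>z\<in>T. \<forall>r s.
           h p (\<lambda>c. r *\<^sub>R v c + s *\<^sub>R w c) z = r * h p v z + s * h p w z) \<and>
        (\<forall>v\<in>T. \<forall>w\<in>T. h p v w = h p w v) \<and>
        (\<forall>v\<in>T. (\<forall>w\<in>T. h p v w = 0) \<longrightarrow> v = (\<lambda>c. 0)))"

definition metric_matrix ::
    "('m, 'n::finite) chart set \<Rightarrow> ('m, 'n) metric \<Rightarrow> ('m, 'n) chart \<Rightarrow> real^'n \<Rightarrow> real^'n^'n" where
  "metric_matrix A h c x =
     (let p = chart_inv c x in
      \<chi> i j. h p (coord_vec A c p (axis i 1)) (coord_vec A c p (axis j 1)))"

definition C2_metric_family ::
    "('m, 'n::finite) chart set \<Rightarrow> real \<Rightarrow> (real \<Rightarrow> ('m, 'n) metric) \<Rightarrow> bool" where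
  "C2_metric_family A a g \<longleftrightarrow>
     (\<forall>\<epsilon>\<in>{-a<..<a}. pseudo_Riemannian A (g \<epsilon>)) \<and>
     (\<forall>c\<in>A. \<forall>i j. Ck_on 2 (\<lambda>(\<epsilon>, x). metric_matrix A (g \<epsilon>) c x $ i $ j)
                       ({-a<..<a} \<times> snd c ` fst c))"


section \<open>Geodesics and the exponential map\<close>

definition partial :: "'n::finite \<Rightarrow> (real^'n \<Rightarrow> real) \<Rightarrow> real^'n \<Rightarrow> real" where
  "partial i f x = frechet_derivative f (at x) (axis i 1)"

text \<open>The upper index of the Christoffel symbol is \<open>k\<close>.\<close>

definition christoffel ::
    "('m, 'n::finite) chart set \<Rightarrow> ('m, 'n) metric \<Rightarrow> ('m, 'n) chart \<Rightarrow> real^'n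
       \<Rightarrow> 'n \<Rightarrow> 'n \<Rightarrow> 'n \<Rightarrow> real" where
  "christoffel A h c x k i j =
     (let G = metric_matrix A h c in
      1/2 * (\<Sum>l\<in>UNIV. matrix_inv (G x) $ k $ l *
        (partial i (\<lambda>y. G y $ j $ l) x + partial j (\<lambda>y. G y $ i $ l) x
          - partial l (\<lambda>y. G y $ i $ j) x)))"

text \<open>Derivatives are one-sided at the end points of \<open>I\<close>. Since \<open>\<gamma>\<close> is continuous, derivatives at
  a time \<open>t\<close> with \<open>\<gamma> t\<close> in a chart domain only depend on times at which \<open>\<gamma>\<close> is in that domain.\<close>

definition geodesic ::
    "('m::topological_space, 'n::finite) chart set \<Rightarrow> ('m, 'n) metric \<Rightarrow> real set
       \<Rightarrow> (real \<Rightarrow> 'm) \<Rightarrow> bool" where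
  "geodesic A h I \<gamma> \<longleftrightarrow>
     continuous_on I \<gamma> \<and>
     (\<forall>c\<in>A. \<exists>w. \<forall>t\<in>I. \<gamma> t \<in> fst c \<longrightarrow>
        ((snd c \<circ> \<gamma>) has_vector_derivative w t) (at t within I) \<and>
        (w has_vector_derivative
          (\<chi> k. - (\<Sum>i\<in>UNIV. \<Sum>j\<in>UNIV. christoffel A h c (snd c (\<gamma> t)) k i j * w t $ i * w t $ j)))
          (at t within I))"

definition velocity ::
    "('m, 'n::finite) chart set \<Rightarrow> real set \<Rightarrow> (real \<Rightarrow> 'm) \<Rightarrow> real \<Rightarrow> ('m, 'n) tangent" where
  "velocity A I \<gamma> t =
     (\<lambda>c. if c \<in> charts_at A (\<gamma> t) then vector_derivative (snd c \<circ> \<gamma>) (at t within I) else 0)"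

definition geodesic_from ::
    "('m::topological_space, 'n::finite) chart set \<Rightarrow> ('m, 'n) metric \<Rightarrow> 'm \<Rightarrow> ('m, 'n) tangent
       \<Rightarrow> (real \<Rightarrow> 'm) \<Rightarrow> bool" where
  "geodesic_from A h q v \<gamma> \<longleftrightarrow>
     geodesic A h {0..1} \<gamma> \<and> \<gamma> 0 = q \<and> velocity A {0..1} \<gamma> 0 = v"

definition exp_domain ::
    "('m::topological_space, 'n::finite) chart set \<Rightarrow> ('m, 'n) metric \<Rightarrow> 'm
       \<Rightarrow> ('m, 'n) tangent set" where
  "exp_domain A h q = {v \<in> tangent_space A q. \<exists>\<gamma>. geodesic_from A h q v \<gamma>}"

definition exp_map ::
    "('m::topological_space, 'n::finite) chart set \<Rightarrow> ('m, 'n) metric \<Rightarrow> 'm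
       \<Rightarrow> ('m, 'n) tangent \<Rightarrow> 'm" where
  "exp_map A h q v = (THE y. \<exists>\<gamma>. geodesic_from A h q v \<gamma> \<and> \<gamma> 1 = y)"


section \<open>Convex sets\<close>

text \<open>\<open>f\<close> is a \<open>C\<^sup>1\<close> diffeomorphism from the open subset \<open>S\<close> of the tangent space at \<open>q\<close> onto the
  open set \<open>U\<close>, expressed in charts.\<close>

definition C1_diffeo_from_tangent ::
    "('m::topological_space, 'n::finite) chart set \<Rightarrow> 'm
       \<Rightarrow> ('m, 'n) tangent set \<Rightarrow> 'm set \<Rightarrow> (('m, 'n) tangent \<Rightarrow> 'm) \<Rightarrow> bool" where
  "C1_diffeo_from_tangent A q S U f \<longleftrightarrow>
     bij_betw f S U \<and>
     (\<forall>c\<in>charts_at A q. let e = coord_vec A c q in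
        continuous_on {u. e u \<in> S} (f \<circ> e) \<and>
        (\<forall>d\<in>A. Ck_on 1 (snd d \<circ> f \<circ> e) {u. e u \<in> S \<and> f (e u) \<in> fst d} \<and>
                Ck_on 1 (\<lambda>y. inv_into S f (chart_inv d y) c) (snd d ` (U \<inter> fst d))))"

definition normal_neighborhood ::
    "('m::topological_space, 'n::finite) chart set \<Rightarrow> ('m, 'n) metric \<Rightarrow> 'm \<Rightarrow> 'm set \<Rightarrow> bool" where
  "normal_neighborhood A h q U \<longleftrightarrow>
     (\<exists>S. open_in_tangent_space A q S \<and> (\<lambda>c. 0) \<in> S \<and> star_shaped S \<and>
          S \<subseteq> exp_domain A h q \<and> C1_diffeo_from_tangent A q S U (exp_map A h q))"

definition metric_convex ::
    "('m::topological_space, 'n::finite) chart set \<Rightarrow> ('m, 'n) metric \<Rightarrow> 'm set \<Rightarrow> bool" where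
  "metric_convex A h U \<longleftrightarrow> open U \<and> (\<forall>q\<in>U. normal_neighborhood A h q U)"

end

theory Submission
  imports Defs
begin

text \<open>In a chart around \<open>p\<^sub>0\<close> the geodesic equation is \<open>x' = w\<close>, \<open>w' = f(\<epsilon>, x, w)\<close> with \<open>f\<close> of
  class \<open>C\<^sup>1\<close> and quadratic in \<open>w\<close>. By compactness there is one radius \<open>\<rho>\<close> such that, for all \<open>\<epsilon>\<close> in
  the compact interval, the derivative of \<open>f\<close> is small for velocities below \<open>\<rho>\<close>. For an initial
  point \<open>q\<close> and an initial velocity \<open>u\<close> the velocity path \<open>w\<close> solves \<open>w - \<Phi>(w) = u\<close>, where \<open>\<Phi>\<close> is a
  \<open>C\<^sup>1\<close> contraction on a ball of the Banach space of continuous paths. Inverting \<open>id - \<Phi>\<close> gives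
  \<open>exp\<^sub>q\<close> together with its \<open>C\<^sup>1\<close> dependence on \<open>u\<close>, and exhibits \<open>exp\<^sub>q - q\<close> as a contractive
  perturbation of the identity in its turn, so that \<open>exp\<^sub>q\<close> is a \<open>C\<^sup>1\<close> diffeomorphism onto a set
  containing the coordinate ball \<open>U\<close> of radius \<open>\<rho>/4\<close> around \<open>p\<^sub>0\<close>. Along geodesics close to \<open>p\<^sub>0\<close> the
  squared coordinate distance to \<open>p\<^sub>0\<close> is a convex function of time, hence a geodesic with both end
  points in \<open>U\<close> stays in \<open>U\<close>; this makes the preimage of \<open>U\<close> under \<open>exp\<^sub>q\<close> star-shaped.\<close>

section \<open>Calculus of functions of class C1\<close>

text \<open>One neighbourhood has to serve every parameter and every base point, whereas the inverse
  function theorem and the flow of a vector field provide neighbourhoods without a size. Hence each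
  step is quantitative: all radii are fixed fractions of \<open>\<rho>\<close>, and the contraction
  constants are numbers. The parameter and the base point enter only through these bounds, since
  smoothness is asserted for a fixed metric and base point. The velocity path is the unknown, not
  the position path, because over unit time a bound on the velocity also bounds the displacement;
  one norm then controls both arguments of \<open>f\<close>. Two further obstacles come from the
  definitions. \<open>geodesic\<close> speaks of all charts, while the solution is built in one: the
  transition law of the spray is required, and with it the symmetry of second derivatives of
  transition maps. \<open>exp_map\<close> is a definite description, so uniqueness of geodesics on
  the whole unit interval, across charts, has to precede any computation with it.\<close>

text \<open>Otherwise \<open>Ck_on 1\<close> is rewritten to \<open>Ck_on (Suc 0)\<close> and unfolded by the simplifier.\<close>

declare One_nat_def [simp del] Ck_on.simps [simp del]

lemma Ck_on_1_iff:
  "Ck_on 1 f S \<longleftrightarrow> (\<forall>x\<in>S. f differentiable (at x)) \<and>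
     (\<forall>u. continuous_on S (\<lambda>x. frechet_derivative f (at x) u))"
  unfolding One_nat_def by (simp add: Ck_on.simps)

lemma Ck_on_1I:
  assumes "\<And>x. x \<in> S \<Longrightarrow> (f has_derivative f' x) (at x)"
    and "\<And>u. continuous_on S (\<lambda>x. f' x u)"
  shows "Ck_on 1 f S"
proof -
  have "frechet_derivative f (at x) = f' x" if "x \<in> S" for x
    using assms(1)[OF that] by (rule frechet_derivative_at[symmetric])
  then show ?thesis
    using assms by (auto simp: Ck_on_1_iff differentiable_def cong: continuous_on_cong_simp)
qed

lemma Ck_on_1_has_derivative:
  assumes "Ck_on 1 f S" "x \<in> S"
  shows "(f has_derivative frechet_derivative f (at x)) (at x)"
  using assms by (auto simp: Ck_on_1_iff frechet_derivative_works)

lemma Ck_on_1_linear_derivative: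
  assumes "Ck_on 1 f S" "x \<in> S"
  shows "linear (frechet_derivative f (at x))"
  using assms by (auto simp: Ck_on_1_iff linear_frechet_derivative)

lemma Ck_on_mono: "Ck_on k f S \<Longrightarrow> T \<subseteq> S \<Longrightarrow> Ck_on k f T"
  by (induction k arbitrary: f) (auto simp: Ck_on.simps intro: continuous_on_subset)

lemma Ck_on_1_imp_continuous_on: "Ck_on 1 f S \<Longrightarrow> continuous_on S f"
  by (meson Ck_on_1_iff continuous_at_imp_continuous_on differentiable_imp_continuous_within)

lemma Ck_on_2_iff:
  "Ck_on 2 f S \<longleftrightarrow> (\<forall>x\<in>S. f differentiable (at x)) \<and>
     (\<forall>u. Ck_on 1 (\<lambda>x. frechet_derivative f (at x) u) S)"
  unfolding numeral_2_eq_2 One_nat_def by (rule Ck_on.simps(2)[of "Suc 0"])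

lemma Ck_on_2_derivative: "Ck_on 2 f S \<Longrightarrow> Ck_on 1 (\<lambda>x. frechet_derivative f (at x) u) S"
  by (simp only: Ck_on_2_iff)

lemma Ck_on_2_imp_1: "Ck_on 2 f S \<Longrightarrow> Ck_on 1 f S"
  unfolding Ck_on_1_iff[of f] Ck_on_2_iff[of f] by (simp add: Ck_on_1_imp_continuous_on)

lemma Ck_on_1_cong:
  assumes "open S" "\<And>x. x \<in> S \<Longrightarrow> f x = g x" "Ck_on 1 f S"
  shows "Ck_on 1 g S"
proof (rule Ck_on_1I)
  show "(g has_derivative frechet_derivative f (at x)) (at x)" if "x \<in> S" for x
    using Ck_on_1_has_derivative[OF assms(3) that] assms(1) that assms(2)
    by (rule has_derivative_transform_within_open)
  show "continuous_on S (\<lambda>x. frechet_derivative f (at x) u)" for u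
    using assms(3) by (auto simp: Ck_on_1_iff)
qed

text \<open>\<open>Ck_on 1\<close> controls the derivative in one fixed direction at a time.
  Expanding the direction in the finite basis upgrades this to joint continuity in point and
  direction, for use when both vary, as in compositions and along paths.\<close>

lemma continuous_on_frechet_derivative:
  fixes f :: "'a::euclidean_space \<Rightarrow> 'b::real_normed_vector"
  assumes f: "Ck_on 1 f S" and g: "continuous_on T g" "g ` T \<subseteq> S" and h: "continuous_on T h"
  shows "continuous_on T (\<lambda>t. frechet_derivative f (at (g t)) (h t))"
proof -
  have "continuous_on T (\<lambda>t. \<Sum>b\<in>Basis. (h t \<bullet> b) *\<^sub>R frechet_derivative f (at (g t)) b)"
    using f g h
    by (intro continuous_intros continuous_on_compose2[of S
        "\<lambda>y. frechet_derivative f (at y) _" T g])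
      (simp_all add: Ck_on_1_iff)
  moreover have "(\<Sum>b\<in>Basis. (h t \<bullet> b) *\<^sub>R frechet_derivative f (at (g t)) b)
      = frechet_derivative f (at (g t)) (h t)" if "t \<in> T" for t
  proof -
    interpret linear "frechet_derivative f (at (g t))"
      using Ck_on_1_linear_derivative[OF f] that g by auto
    show ?thesis
      by (simp flip: scale sum add: euclidean_representation)
  qed
  ultimately show ?thesis
    by (simp cong: continuous_on_cong)
qed

lemma Ck_on_1_compose:
  fixes f :: "'b::euclidean_space \<Rightarrow> 'c::real_normed_vector" and g :: "'a::euclidean_space \<Rightarrow> 'b"
  assumes f: "Ck_on 1 f S" and g: "Ck_on 1 g T" and gT: "g ` T \<subseteq> S"
  shows "Ck_on 1 (\<lambda>x. f (g x)) T"
proof (rule Ck_on_1I)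
  show "((\<lambda>x. f (g x)) has_derivative
      (\<lambda>u. frechet_derivative f (at (g x)) (frechet_derivative g (at x) u))) (at x)"
    if "x \<in> T" for x
    by (rule has_derivative_compose[OF Ck_on_1_has_derivative[OF g that]
        Ck_on_1_has_derivative[OF f]]) (use that gT in auto)
  show "continuous_on T (\<lambda>x. frechet_derivative f (at (g x)) (frechet_derivative g (at x) u))" for u
    using g gT Ck_on_1_imp_continuous_on[OF g]
    by (intro continuous_on_frechet_derivative[OF f]) (auto simp: Ck_on_1_iff)
qed

lemma Ck_on_1_bounded_linear: "bounded_linear L \<Longrightarrow> Ck_on 1 L S"
  by (rule Ck_on_1I[where f' = "\<lambda>x. L"]) (auto intro: bounded_linear_imp_has_derivative)

lemma Ck_on_1_const: "Ck_on 1 (\<lambda>x. c) S"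
  by (rule Ck_on_1I[where f' = "\<lambda>x u. 0"]) auto

lemma Ck_on_1_add:
  assumes "Ck_on 1 f S" "Ck_on 1 g S"
  shows "Ck_on 1 (\<lambda>x. f x + g x) S"
  by (rule Ck_on_1I[where f' = "\<lambda>x u. frechet_derivative f (at x) u
      + frechet_derivative g (at x) u"])
    (use assms in \<open>auto intro!: has_derivative_add continuous_on_add
      simp: Ck_on_1_iff simp flip: frechet_derivative_works\<close>)

lemma Ck_on_1_minus:
  assumes "Ck_on 1 f S"
  shows "Ck_on 1 (\<lambda>x. - f x) S"
  by (rule Ck_on_1I[where f' = "\<lambda>x u. - frechet_derivative f (at x) u"])
    (use assms in \<open>auto intro!: has_derivative_minus continuous_on_minus
      simp: Ck_on_1_iff simp flip: frechet_derivative_works\<close>)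

lemma Ck_on_1_diff:
  assumes "Ck_on 1 f S" "Ck_on 1 g S"
  shows "Ck_on 1 (\<lambda>x. f x - g x) S"
  using Ck_on_1_add[OF assms(1) Ck_on_1_minus[OF assms(2)]] by simp

lemma Ck_on_1_scaleR:
  assumes "Ck_on 1 f S" "Ck_on 1 g S"
  shows "Ck_on 1 (\<lambda>x. f x *\<^sub>R g x) S"
proof (rule Ck_on_1I)
  show "((\<lambda>x. f x *\<^sub>R g x) has_derivative
    (\<lambda>u. f x *\<^sub>R frechet_derivative g (at x) u + frechet_derivative f (at x) u *\<^sub>R g x)) (at x)"
    if "x \<in> S" for x
    using assms that
    by (intro has_derivative_scaleR Ck_on_1_has_derivative[of f S] Ck_on_1_has_derivative[of g S])
  show "continuous_on S (\<lambda>x. f x *\<^sub>R frechet_derivative g (at x) u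
      + frechet_derivative f (at x) u *\<^sub>R g x)" for u
    using assms Ck_on_1_imp_continuous_on[OF assms(1)] Ck_on_1_imp_continuous_on[OF assms(2)]
    by (intro continuous_intros) (auto simp: Ck_on_1_iff)
qed

lemma Ck_on_1_mult:
  fixes f g :: "'a::euclidean_space \<Rightarrow> real"
  assumes "Ck_on 1 f S" "Ck_on 1 g S"
  shows "Ck_on 1 (\<lambda>x. f x * g x) S"
  using Ck_on_1_scaleR[OF assms] by simp

lemma Ck_on_1_inverse:
  fixes f :: "'a::euclidean_space \<Rightarrow> real"
  assumes "Ck_on 1 f S" "\<And>x. x \<in> S \<Longrightarrow> f x \<noteq> 0"
  shows "Ck_on 1 (\<lambda>x. inverse (f x)) S"
proof (rule Ck_on_1I)
  show "((\<lambda>x. inverse (f x)) has_derivative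
    (\<lambda>u. - (inverse (f x) * frechet_derivative f (at x) u * inverse (f x)))) (at x)" if
        "x \<in> S" for x
    using assms that by (intro Deriv.has_derivative_inverse Ck_on_1_has_derivative[of f S]) auto
  show "continuous_on S (\<lambda>x. - (inverse (f x) * frechet_derivative f (at x) u * inverse (f x)))"
      for u
    using assms Ck_on_1_imp_continuous_on[OF assms(1)]
    by (intro continuous_intros) (auto simp: Ck_on_1_iff)
qed

lemma Ck_on_1_sum:
  assumes "\<And>i. i \<in> I \<Longrightarrow> Ck_on 1 (f i) S"
  shows "Ck_on 1 (\<lambda>x. \<Sum>i\<in>I. f i x) S"
  using assms by (induction I rule: infinite_finite_induct) (auto intro: Ck_on_1_const Ck_on_1_add)

lemma Ck_on_1_prod:
  fixes f :: "'i \<Rightarrow> 'a::euclidean_space \<Rightarrow> real"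
  assumes "\<And>i. i \<in> I \<Longrightarrow> Ck_on 1 (f i) S"
  shows "Ck_on 1 (\<lambda>x. \<Prod>i\<in>I. f i x) S"
  using assms by (induction I rule: infinite_finite_induct) (auto intro: Ck_on_1_const Ck_on_1_mult)

lemma Ck_on_1_vec:
  fixes f :: "'n::finite \<Rightarrow> 'a::euclidean_space \<Rightarrow> real"
  assumes "\<And>i. Ck_on 1 (f i) S"
  shows "Ck_on 1 (\<lambda>x. \<chi> i. f i x) S"
proof -
  have "(\<lambda>x. \<chi> i. f i x) = (\<lambda>x. \<Sum>i\<in>UNIV. f i x *\<^sub>R axis i 1)"
    by (auto simp: fun_eq_iff vec_eq_iff axis_def if_distrib cong: if_cong)
  moreover have "Ck_on 1 (\<lambda>x. \<Sum>i\<in>UNIV. f i x *\<^sub>R (axis i 1 :: real^'n)) S"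
    using assms by (intro Ck_on_1_sum Ck_on_1_scaleR Ck_on_1_const)
  ultimately show ?thesis by simp
qed

lemma Ck_on_1_Pair:
  fixes f :: "'a::euclidean_space \<Rightarrow> 'b::real_normed_vector" and g :: "'a \<Rightarrow> 'c::real_normed_vector"
  assumes "Ck_on 1 f S" "Ck_on 1 g S"
  shows "Ck_on 1 (\<lambda>x. (f x, g x)) S"
proof (rule Ck_on_1I)
  show "((\<lambda>x. (f x, g x)) has_derivative (\<lambda>u. (frechet_derivative f (at x) u, frechet_derivative g
      (at x) u))) (at x)"
    if "x \<in> S" for x
    using assms that
    by (intro has_derivative_Pair Ck_on_1_has_derivative[of f S] Ck_on_1_has_derivative[of g S])
  show "continuous_on S (\<lambda>x. (frechet_derivative f (at x) u, frechet_derivative g (at x) u))" for u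
    using assms by (intro continuous_on_Pair) (auto simp: Ck_on_1_iff)
qed

lemma Ck_on_1_ident: "Ck_on 1 (\<lambda>x. x) S"
  by (rule Ck_on_1_bounded_linear) (rule bounded_linear_ident)

lemma Ck_on_1_fst: "Ck_on 1 f S \<Longrightarrow> Ck_on 1 (\<lambda>x. fst (f x)) S"
  for f :: "'a::euclidean_space \<Rightarrow> 'b::euclidean_space \<times> 'c::euclidean_space"
  by (rule Ck_on_1_compose[OF Ck_on_1_bounded_linear[OF bounded_linear_fst] _ subset_UNIV])

lemma Ck_on_1_snd: "Ck_on 1 f S \<Longrightarrow> Ck_on 1 (\<lambda>x. snd (f x)) S"
  for f :: "'a::euclidean_space \<Rightarrow> 'b::euclidean_space \<times> 'c::euclidean_space"
  by (rule Ck_on_1_compose[OF Ck_on_1_bounded_linear[OF bounded_linear_snd] _ subset_UNIV])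

lemma Ck_on_1_vec_nth: "Ck_on 1 f S \<Longrightarrow> Ck_on 1 (\<lambda>x. f x $ i) S"
  for f :: "'a::euclidean_space \<Rightarrow> real^'n"
  by (rule Ck_on_1_compose[OF Ck_on_1_bounded_linear[OF bounded_linear_vec_nth] _ subset_UNIV])

text \<open>Lets bounds on a family, jointly in parameter and state, be read as bounds on a single
  member: freezing the parameter means putting 0 into its slot of the derivative.\<close>

lemma Ck_on_1_slice:
  fixes f :: "'c::euclidean_space \<times> 'a::euclidean_space \<Rightarrow> 'b::real_normed_vector"
  assumes f: "Ck_on 1 f (I \<times> S)" and e: "e \<in> I"
  shows "Ck_on 1 (\<lambda>z. f (e, z)) S"
    "z \<in> S \<Longrightarrow> frechet_derivative (\<lambda>z. f (e, z)) (at z) u = frechet_derivative f (at (e, z)) (0, u)"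
proof -
  show "Ck_on 1 (\<lambda>z. f (e, z)) S"
    by (rule Ck_on_1_compose[OF f]) (use e in \<open>auto intro!: Ck_on_1_Pair Ck_on_1_const
        Ck_on_1_ident\<close>)
  assume z: "z \<in> S"
  have "((\<lambda>z. (e, z)) has_derivative (\<lambda>v. (0, v))) (at z)"
    by (auto intro!: derivative_eq_intros)
  from has_derivative_compose[OF this Ck_on_1_has_derivative[OF f]]
  have "((\<lambda>z. f (e, z)) has_derivative (\<lambda>v. frechet_derivative f (at (e, z)) (0, v))) (at z)"
    using e z by simp
  from frechet_derivative_at[OF this]
  show "frechet_derivative (\<lambda>z. f (e, z)) (at z) u = frechet_derivative f (at (e, z)) (0, u)"
      by metis
qed

text \<open>The norms of the derivative on the basis vectors add up to a continuous function that
  dominates the operator norm; it is bounded near \<open>x\<close>, and the mean value inequality on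
  a ball does the rest. The result feeds the uniqueness of solutions of differential
  equations.\<close>

lemma Ck_on_1_locally_lipschitz:
  fixes f :: "'a::euclidean_space \<Rightarrow> 'b::real_normed_vector"
  assumes f: "Ck_on 1 f S" and S: "open S" "x \<in> S"
  obtains d L where "d > 0" "ball x d \<subseteq> S" "L-lipschitz_on (ball x d) f"
proof -
  define N where "N y = (\<Sum>b\<in>Basis. norm (frechet_derivative f (at y) b))" for y
  have "continuous_on S N"
    using f unfolding N_def by (intro continuous_intros) (auto simp: Ck_on_1_iff)
  then have "isCont N x"
    using S by (simp add: continuous_on_eq_continuous_at)
  then obtain d1 where "d1 > 0" "\<And>y. dist y x < d1 \<Longrightarrow> dist (N y) (N x) < 1"
    unfolding continuous_at_eps_delta by (meson zero_less_one)
  then have d1: "d1 > 0" "\<And>y. dist y x < d1 \<Longrightarrow> N y < N x + 1"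
    by (auto simp: dist_real_def) (smt (verit))
  obtain d2 where d2: "d2 > 0" "ball x d2 \<subseteq> S"
    using S open_contains_ball by blast
  define d where "d = min d1 d2"
  have d: "d > 0" "ball x d \<subseteq> S"
    using d1 d2 by (auto simp: d_def)
  have on: "onorm (frechet_derivative f (at y)) \<le> N x + 1" if "y \<in> ball x d" for y
  proof (rule onorm_le)
    fix u
    interpret linear "frechet_derivative f (at y)"
      using Ck_on_1_linear_derivative[OF f] that d by blast
    have "frechet_derivative f (at y) u = (\<Sum>b\<in>Basis. (u \<bullet> b) *\<^sub>R frechet_derivative f (at y) b)"
      by (simp flip: scale sum add: euclidean_representation)
    also have "norm \<dots> \<le> (\<Sum>b\<in>Basis. norm u * norm (frechet_derivative f (at y) b))"
      by (intro sum_norm_le) (auto intro!: mult_right_mono Basis_le_norm)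
    also have "\<dots> = N y * norm u"
      by (simp add: N_def sum_distrib_left sum_distrib_right mult.commute)
    also have "\<dots> \<le> (N x + 1) * norm u"
      using d1(2)[of y] that by (intro mult_right_mono) (auto simp: d_def dist_commute)
    finally show "norm (frechet_derivative f (at y) u) \<le> (N x + 1) * norm u" .
  qed
  have "(N x + 1)-lipschitz_on (ball x d) f"
  proof (rule lipschitz_onI)
    show "dist (f y) (f z) \<le> (N x + 1) * dist y z" if "y \<in> ball x d" "z \<in> ball x d" for y z
      unfolding dist_norm
    proof (rule differentiable_bound[OF convex_ball _ on that])
      show "(f has_derivative frechet_derivative f (at y)) (at y within ball x d)" if
          "y \<in> ball x d" for y
        using Ck_on_1_has_derivative[OF f] that d(2) by (blast intro: has_derivative_at_withinI)
    qed
    show "0 \<le> N x + 1"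
      by (auto simp: N_def intro!: sum_nonneg add_nonneg_nonneg)
  qed
  with d that show thesis by blast
qed

section \<open>Symmetry of second derivatives\<close>

lemma mvt_line:
  fixes f :: "'a::real_normed_vector \<Rightarrow> real"
  assumes "s > 0" "\<And>t. t \<in> {0..s} \<Longrightarrow> (f has_derivative f' (y + t *\<^sub>R u)) (at (y + t *\<^sub>R u))"
  obtains t where "t \<in> {0<..<s}" "f (y + s *\<^sub>R u) - f y = s * f' (y + t *\<^sub>R u) u"
proof -
  have "\<exists>t\<in>{0<..<s}. f (y + s *\<^sub>R u) - f (y + 0 *\<^sub>R u)
      = (\<lambda>h. f' (y + t *\<^sub>R u) (h *\<^sub>R u)) (s - 0)"
  proof (rule mvt_simple)
    fix t :: real assume "0 \<le> t" "t \<le> s"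
    then have "(f has_derivative f' (y + t *\<^sub>R u)) (at (y + t *\<^sub>R u))"
      using assms by auto
    moreover have "((\<lambda>t. y + t *\<^sub>R u) has_derivative (\<lambda>h. h *\<^sub>R u)) (at t within {0..s})"
      by (auto intro!: derivative_eq_intros)
    ultimately show "((\<lambda>t. f (y + t *\<^sub>R u)) has_derivative (\<lambda>h. f' (y + t *\<^sub>R u) (h *\<^sub>R u)))
        (at t within {0..s})"
      by (rule has_derivative_compose[rotated])
  qed (use assms in auto)
  then obtain t where t: "t \<in> {0<..<s}"
    "f (y + s *\<^sub>R u) - f y = f' (y + t *\<^sub>R u) (s *\<^sub>R u)" by auto
  have "linear (f' (y + t *\<^sub>R u))"
    using assms(2)[of t] t(1) has_derivative_linear by fastforce
  with t that show thesis
    by (simp add: linear_scale)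
qed

text \<open>Two applications of the mean value theorem: along \<open>u\<close> to the increment of
  \<open>f\<close> by \<open>s *\<^sub>R v\<close>, then along \<open>v\<close> to the directional
  derivative of \<open>f\<close> in direction \<open>u\<close>.\<close>

lemma second_difference_mvt:
  fixes f :: "'a::euclidean_space \<Rightarrow> real"
  assumes f: "Ck_on 2 f S" and s: "s > 0"
    and S: "\<And>t r. t \<in> {0..s} \<Longrightarrow> r \<in> {0..s} \<Longrightarrow> x + t *\<^sub>R u + r *\<^sub>R v \<in> S"
  obtains t r where "t \<in> {0<..<s}" "r \<in> {0<..<s}"
    "f (x + s *\<^sub>R u + s *\<^sub>R v) - f (x + s *\<^sub>R u) - f (x + s *\<^sub>R v) + f x
      = s * (s * frechet_derivative (\<lambda>y. frechet_derivative f (at y) u) (at (x + t *\<^sub>R u + r *\<^sub>R v))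
          v)"
proof -
  let ?D = "\<lambda>y. frechet_derivative f (at y)"
  have D: "(f has_derivative ?D y) (at y)" if "y \<in> S" for y
    using Ck_on_1_has_derivative[OF Ck_on_2_imp_1[OF f] that] .
  have E: "((\<lambda>y. ?D y u) has_derivative frechet_derivative (\<lambda>y. ?D y u) (at y)) (at y)"
    if "y \<in> S" for y
    using Ck_on_1_has_derivative[OF Ck_on_2_derivative[OF f] that] .
  have der: "((\<lambda>y. f (y + s *\<^sub>R v) - f y) has_derivative
      (\<lambda>h. ?D (x + t *\<^sub>R u + s *\<^sub>R v) h - ?D (x + t *\<^sub>R u) h)) (at (x + t *\<^sub>R u))"
    if "t \<in> {0..s}" for t
  proof -
    have "((\<lambda>y. y + s *\<^sub>R v) has_derivative (\<lambda>h. h)) (at (x + t *\<^sub>R u))"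
      by (auto intro!: derivative_eq_intros)
    from has_derivative_compose[OF this D[OF S[OF that]]]
    have "((\<lambda>y. f (y + s *\<^sub>R v)) has_derivative ?D (x + t *\<^sub>R u + s *\<^sub>R v)) (at (x + t *\<^sub>R u))"
      using s by simp
    moreover have "x + t *\<^sub>R u \<in> S"
      using S[OF that, of 0] s by simp
    ultimately show ?thesis
      using D by (auto intro!: has_derivative_diff)
  qed
  obtain t where t: "t \<in> {0<..<s}" "(f (x + s *\<^sub>R u + s *\<^sub>R v) - f (x + s *\<^sub>R u)) -
      (f (x + s *\<^sub>R v) - f x)
     = s * (?D (x + t *\<^sub>R u + s *\<^sub>R v) u - ?D (x + t *\<^sub>R u) u)"
    using mvt_line[where f = "\<lambda>y. f (y + s *\<^sub>R v) - f y" and f' =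
        "\<lambda>y h. ?D (y + s *\<^sub>R v) h - ?D y h", OF s der]
    by blast
  have der': "((\<lambda>y. ?D y u) has_derivative frechet_derivative (\<lambda>y. ?D y u)
      (at (x + t *\<^sub>R u + r *\<^sub>R v)))
     (at (x + t *\<^sub>R u + r *\<^sub>R v))" if "r \<in> {0..s}" for r
    using S[OF _ that, of t] t(1) by (intro E) auto
  obtain r where "r \<in> {0<..<s}" "?D (x + t *\<^sub>R u + s *\<^sub>R v) u - ?D (x + t *\<^sub>R u) u
     = s * frechet_derivative (\<lambda>y. ?D y u) (at (x + t *\<^sub>R u + r *\<^sub>R v)) v"
    using mvt_line[where f = "\<lambda>y. ?D y u" and f' =
        "\<lambda>y. frechet_derivative (\<lambda>y. ?D y u) (at y)", OF s der']
    by blast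
  with t that[OF t(1)] show thesis by (simp add: algebra_simps)
qed

text \<open>The second difference over a parallelogram does not see the order of \<open>u\<close>
  and \<open>v\<close>, so the two mixed derivatives share a value at points arbitrarily close to
  \<open>x\<close>, and continuity moves this equality to \<open>x\<close>.\<close>

lemma symmetric_second_derivative_real:
  fixes f :: "'a::euclidean_space \<Rightarrow> real"
  assumes f: "Ck_on 2 f S" and S: "open S" "x \<in> S"
  shows "frechet_derivative (\<lambda>y. frechet_derivative f (at y) u) (at x) v
       = frechet_derivative (\<lambda>y. frechet_derivative f (at y) v) (at x) u"
proof -
  let ?H = "\<lambda>u v y. frechet_derivative (\<lambda>y. frechet_derivative f (at y) u) (at y) v"
  have cont: "isCont (?H u v) x" for u v
    using Ck_on_2_derivative[OF f, of u] S
    by (auto simp: Ck_on_1_iff continuous_on_eq_continuous_at)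
  obtain d where d: "d > 0" "ball x d \<subseteq> S"
    using S open_contains_ball by blast
  \<comment> \<open>With side parameters at most \<open>m / C\<close> the parallelogram stays in the
    ball of radius \<open>m\<close>. The summand 1 makes this strict and keeps \<open>C\<close>
    positive even for \<open>u = v = 0\<close>.\<close>
  define C where "C = norm u + norm v + 1"
  have C: "C > 0"
    unfolding C_def by (smt (verit) norm_ge_zero)
  have near: "norm (t *\<^sub>R u + r *\<^sub>R v) \<le> s * (norm u + norm v)" if "t \<in> {0..s}"
      "r \<in> {0..s}" for t r s
  proof -
    have "norm (t *\<^sub>R u + r *\<^sub>R v) \<le> t * norm u + r * norm v"
      using that by (intro order_trans[OF norm_triangle_ineq]) auto
    also have "\<dots> \<le> s * norm u + s * norm v"
      using that by (intro add_mono mult_right_mono) auto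
    finally show ?thesis by (simp add: algebra_simps)
  qed
  have ball: "x + t *\<^sub>R u + r *\<^sub>R v \<in> ball x e" if "t \<in> {0..e / C}" "r \<in> {0..e / C}"
      "e > 0" for t r e
  proof -
    have "norm (t *\<^sub>R u + r *\<^sub>R v) \<le> e / C * (norm u + norm v)"
      using near that by blast
    also have "\<dots> < e / C * C"
      using that C by (intro mult_strict_left_mono) (auto simp: C_def)
    finally show ?thesis
      using C by (simp add: dist_norm norm_minus_commute algebra_simps)
  qed
  have "dist (?H u v x) (?H v u x) < e" if "e > 0" for e
  proof -
    obtain d1 where d1: "d1 > 0" "\<And>y. y \<in> ball x d1 \<Longrightarrow> dist (?H u v y) (?H u v x) < e / 2"
      using cont[of u v] \<open>e > 0\<close> unfolding continuous_at_eps_delta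
      by (metis half_gt_zero mem_ball dist_commute)
    obtain d2 where d2: "d2 > 0" "\<And>y. y \<in> ball x d2 \<Longrightarrow> dist (?H v u y) (?H v u x) < e / 2"
      using cont[of v u] \<open>e > 0\<close> unfolding continuous_at_eps_delta
      by (metis half_gt_zero mem_ball dist_commute)
    define m where "m = min d (min d1 d2)"
    have m: "m > 0" "ball x m \<subseteq> S" "ball x m \<subseteq> ball x d1" "ball x m \<subseteq> ball x d2"
      using d d1 d2 by (auto simp: m_def)
    define s where "s = m / C"
    have s: "s > 0" using m C by (simp add: s_def)
    have inb: "x + t *\<^sub>R u + r *\<^sub>R v \<in> ball x m" if "t \<in> {0..s}" "r \<in> {0..s}" for t r
      using ball[of t m r] that m by (auto simp: s_def)
    have inb': "x + t *\<^sub>R v + r *\<^sub>R u \<in> ball x m" if "t \<in> {0..s}" "r \<in> {0..s}" for t r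
      using inb[OF that(2,1)] by (simp add: ac_simps)
    have "x + t *\<^sub>R u + r *\<^sub>R v \<in> S" if "t \<in> {0..s}" "r \<in> {0..s}" for t r
      using inb[OF that] m by blast
    then obtain t r where tr: "t \<in> {0<..<s}" "r \<in> {0<..<s}"
      "f (x + s *\<^sub>R u + s *\<^sub>R v) - f (x + s *\<^sub>R u) - f (x + s *\<^sub>R v) + f x
      = s * (s * ?H u v (x + t *\<^sub>R u + r *\<^sub>R v))"
      using second_difference_mvt[OF f s, of x u v] by metis
    have "x + t *\<^sub>R v + r *\<^sub>R u \<in> S" if "t \<in> {0..s}" "r \<in> {0..s}" for t r
      using inb'[OF that] m by blast
    then obtain t' r' where tr': "t' \<in> {0<..<s}" "r' \<in> {0<..<s}"
      "f (x + s *\<^sub>R v + s *\<^sub>R u) - f (x + s *\<^sub>R v) - f (x + s *\<^sub>R u) + f x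
      = s * (s * ?H v u (x + t' *\<^sub>R v + r' *\<^sub>R u))"
      using second_difference_mvt[OF f s, of x v u] by metis
    have "s * (s * ?H u v (x + t *\<^sub>R u + r *\<^sub>R v)) = s * (s * ?H v u (x + t' *\<^sub>R v + r' *\<^sub>R u))"
      unfolding tr(3)[symmetric] tr'(3)[symmetric] by (simp add: algebra_simps)
    then have "?H u v (x + t *\<^sub>R u + r *\<^sub>R v) = ?H v u (x + t' *\<^sub>R v + r' *\<^sub>R u)"
      using s by simp
    moreover have "dist (?H u v (x + t *\<^sub>R u + r *\<^sub>R v)) (?H u v x) < e / 2"
      using inb[of t r] tr m by (intro d1) auto
    moreover have "dist (?H v u (x + t' *\<^sub>R v + r' *\<^sub>R u)) (?H v u x) < e / 2"
      using inb'[of t' r'] tr' m by (intro d2) auto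
    ultimately show ?thesis
      by (metis dist_triangle_half_r)
  qed
  then show ?thesis
    by (meson dist_eq_0_iff less_irrefl zero_less_dist_iff)
qed

lemma frechet_derivative_inner_left:
  "f differentiable (at x) \<Longrightarrow>
     frechet_derivative (\<lambda>y. f y \<bullet> b) (at x) u = frechet_derivative f (at x) u \<bullet> b"
  using frechet_derivative_at[OF has_derivative_inner_left, of f "frechet_derivative f (at x)" x b]
  by (simp add: frechet_derivative_works fun_eq_iff)

text \<open>Differentiation commutes with the inner product against a basis vector, which reduces
  the claim to real functions. It is applied to transition maps between charts.\<close>

lemma symmetric_second_derivative:
  fixes f :: "'a::euclidean_space \<Rightarrow> 'b::euclidean_space"
  assumes f: "Ck_on 2 f S" and S: "open S" "x \<in> S"
  shows "frechet_derivative (\<lambda>y. frechet_derivative f (at y) u) (at x) v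
       = frechet_derivative (\<lambda>y. frechet_derivative f (at y) v) (at x) u"
proof (rule euclidean_eqI)
  fix b :: 'b
  let ?g = "\<lambda>y. f y \<bullet> b"
  have D1: "frechet_derivative ?g (at y) u = frechet_derivative f (at y) u \<bullet> b" if "y \<in> S" for y u
    using Ck_on_2_imp_1[OF f] that by (intro frechet_derivative_inner_left) (auto simp: Ck_on_1_iff)
  have inner: "Ck_on 1 (\<lambda>y. h y \<bullet> b) S" if "Ck_on 1 h S" for h :: "'a \<Rightarrow> 'b"
    using Ck_on_1_compose[OF Ck_on_1_bounded_linear[OF bounded_linear_inner_left] that subset_UNIV]
        .
  have C1: "Ck_on 1 (\<lambda>y. frechet_derivative ?g (at y) u) S" for u
    using D1 by (intro Ck_on_1_cong[OF \<open>open S\<close> _ inner[OF Ck_on_2_derivative[OF f, of u]]]) auto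
  have "Ck_on 2 ?g S"
    using C1 inner[OF Ck_on_2_imp_1[OF f]] unfolding Ck_on_2_iff by (meson Ck_on_1_iff)
  from symmetric_second_derivative_real[OF this S]
  have sym: "frechet_derivative (\<lambda>y. frechet_derivative ?g (at y) u) (at x) v
       = frechet_derivative (\<lambda>y. frechet_derivative ?g (at y) v) (at x) u" .
  have "frechet_derivative (\<lambda>y. frechet_derivative ?g (at y) u) (at x) v
      = frechet_derivative (\<lambda>y. frechet_derivative f (at y) u) (at x) v \<bullet> b" for u v
  proof -
    have "((\<lambda>y. frechet_derivative f (at y) u \<bullet> b) has_derivative
      (\<lambda>v. frechet_derivative (\<lambda>y. frechet_derivative f (at y) u) (at x) v \<bullet> b)) (at x)"
      by (intro has_derivative_inner_left Ck_on_1_has_derivative[OF Ck_on_2_derivative[OF f] S(2)])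
    then have "((\<lambda>y. frechet_derivative ?g (at y) u) has_derivative
      (\<lambda>v. frechet_derivative (\<lambda>y. frechet_derivative f (at y) u) (at x) v \<bullet> b)) (at x)"
      by (rule has_derivative_transform_within_open) (use S D1 in auto)
    then show ?thesis
      by (metis frechet_derivative_at)
  qed
  with sym show "frechet_derivative (\<lambda>y. frechet_derivative f (at y) u) (at x) v \<bullet> b
       = frechet_derivative (\<lambda>y. frechet_derivative f (at y) v) (at x) u \<bullet> b" by simp
qed

section \<open>Inverting the identity minus a contraction\<close>

text \<open>\<open>M v\<close> is the fixed point of the contraction
  \<open>z \<mapsto> v + L z\<close>. Uniqueness of fixed points yields the additivity and
  homogeneity of \<open>M\<close> as well as the left inverse property.\<close>

lemma contraction_perturbation_bijective:
  fixes L :: "'x::{real_normed_vector,complete_space} \<Rightarrow> 'x"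
  assumes L: "bounded_linear L" and bound: "\<And>v. norm (L v) \<le> \<kappa> * norm v" and \<kappa>: "0 \<le> \<kappa>" "\<kappa> < 1"
  obtains M where "bounded_linear M" "\<And>v. M v - L (M v) = v" "\<And>v. M (v - L v) = v"
    "\<And>v. norm (M v) \<le> norm v / (1 - \<kappa>)"
proof -
  interpret L: bounded_linear L by fact
  have "\<exists>!z. v + L z = z" for v
  proof (rule banach_fix_type[OF \<kappa>, rule_format])
    show "dist (v + L x) (v + L y) \<le> \<kappa> * dist x y" for x y
      using bound[of "x - y"] by (simp add: dist_norm L.diff)
  qed
  then obtain M where M: "\<And>v. v + L (M v) = M v" and uniq: "\<And>v z. v + L z = z \<Longrightarrow> z = M v"
    by metis
  have nM: "norm (M v) \<le> norm v / (1 - \<kappa>)" for v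
  proof -
    have "norm (M v) \<le> norm v + \<kappa> * norm (M v)"
      using M[of v] bound[of "M v"] norm_triangle_ineq[of v "L (M v)"] by simp
    then show ?thesis using \<kappa> by (simp add: field_simps)
  qed
  show thesis
  proof (rule that)
    show "M v - L (M v) = v" for v
      using M[of v] by (simp add: algebra_simps)
    show "M (v - L v) = v" for v
      by (rule uniq[symmetric]) simp
    show "norm (M v) \<le> norm v / (1 - \<kappa>)" for v by (rule nM)
    show "bounded_linear M"
    proof (rule bounded_linear_intro)
      show "M (x + y) = M x + M y" for x y
      proof (rule uniq[symmetric])
        show "x + y + L (M x + M y) = M x + M y"
          using arg_cong2[OF M[of x] M[of y], of "(+)"] by (simp add: L.add algebra_simps)
      qed
      show "M (r *\<^sub>R x) = r *\<^sub>R M x" for r x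
      proof (rule uniq[symmetric])
        show "r *\<^sub>R x + L (r *\<^sub>R M x) = r *\<^sub>R M x"
          using arg_cong[OF M[of x], of "\<lambda>z. r *\<^sub>R z"] by (simp add: L.scaleR scaleR_add_right)
      qed
      show "norm (M x) \<le> norm x * (1 / (1 - \<kappa>))" for x
        using nM[of x] by simp
    qed
  qed
qed

lemma differentiable_contraction_ball:
  fixes \<Phi> :: "'x::real_normed_vector \<Rightarrow> 'y::real_normed_vector"
  assumes der: "\<And>w. w \<in> ball c \<rho> \<Longrightarrow> (\<Phi> has_derivative \<Phi>' w) (at w)"
    and bound: "\<And>w v. w \<in> ball c \<rho> \<Longrightarrow> norm (\<Phi>' w v) \<le> \<kappa> * norm v"
    and \<kappa>: "0 \<le> \<kappa>" and w: "w1 \<in> ball c \<rho>" "w2 \<in> ball c \<rho>"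
  shows "norm (\<Phi> w1 - \<Phi> w2) \<le> \<kappa> * norm (w1 - w2)"
proof (rule differentiable_bound[OF convex_ball _ _ w])
  show "(\<Phi> has_derivative \<Phi>' w) (at w within ball c \<rho>)" if "w \<in> ball c \<rho>" for w
    using der[OF that] by (rule has_derivative_at_withinI)
  show "onorm (\<Phi>' w) \<le> \<kappa>" if "w \<in> ball c \<rho>" for w
    using \<kappa> bound[OF that] by (rule onorm_bound)
qed

text \<open>Strong continuity of the derivative suffices here, and for \<open>Ck_on 1\<close>; so no operator norm on
  the infinite-dimensional path space is needed.\<close>

lemma inverse_of_identity_minus_contraction:
  fixes \<Phi> :: "'x::{real_normed_vector,complete_space} \<Rightarrow> 'x"
  assumes \<kappa>: "0 \<le> \<kappa>" "\<kappa> < 1" and \<rho>: "\<rho> > 0" and \<Phi>0: "\<Phi> 0 = 0"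
    and der: "\<And>w. w \<in> ball 0 \<rho> \<Longrightarrow> (\<Phi> has_derivative \<Phi>' w) (at w)"
    and bound: "\<And>w v. w \<in> ball 0 \<rho> \<Longrightarrow> norm (\<Phi>' w v) \<le> \<kappa> * norm v"
    and cont: "\<And>v. continuous_on (ball 0 \<rho>) (\<lambda>w. \<Phi>' w v)"
  obtains g G where
    "\<And>y. y \<in> ball 0 ((1 - \<kappa>) * \<rho>) \<Longrightarrow> g y \<in> ball 0 \<rho>"
    "\<And>y. y \<in> ball 0 ((1 - \<kappa>) * \<rho>) \<Longrightarrow> g y - \<Phi> (g y) = y"
    "\<And>w. w \<in> ball 0 \<rho> \<Longrightarrow> w - \<Phi> w \<in> ball 0 ((1 - \<kappa>) * \<rho>) \<Longrightarrow> g (w - \<Phi> w) = w"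
    "\<And>y. y \<in> ball 0 ((1 - \<kappa>) * \<rho>) \<Longrightarrow> (g has_derivative G y) (at y)"
    "\<And>v. continuous_on (ball 0 ((1 - \<kappa>) * \<rho>)) (\<lambda>y. G y v)"
    "\<And>y v. y \<in> ball 0 ((1 - \<kappa>) * \<rho>) \<Longrightarrow> norm (G y v) \<le> norm v / (1 - \<kappa>)"
    "\<And>y v. y \<in> ball 0 ((1 - \<kappa>) * \<rho>) \<Longrightarrow> G y v - \<Phi>' (g y) (G y v) = v"
proof -
  let ?B = "ball (0::'x) ((1 - \<kappa>) * \<rho>)"
  have lip: "norm (\<Phi> w1 - \<Phi> w2) \<le> \<kappa> * norm (w1 - w2)" if "w1 \<in> ball 0 \<rho>" "w2 \<in> ball 0 \<rho>" for w1 w2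
    using differentiable_contraction_ball[OF der bound \<kappa>(1) that] .
  \<comment> \<open>\<open>id - \<Phi>\<close> shrinks distances at most by the factor
    \<open>1 - \<kappa>\<close>. This one estimate yields both injectivity and the Lipschitz
    continuity of the inverse.\<close>
  have expand: "norm (w1 - w2) \<le> norm ((w1 - \<Phi> w1) - (w2 - \<Phi> w2)) / (1 - \<kappa>)"
    if "w1 \<in> ball 0 \<rho>" "w2 \<in> ball 0 \<rho>" for w1 w2
  proof -
    have "norm (w1 - w2) \<le> norm ((w1 - \<Phi> w1) - (w2 - \<Phi> w2)) + norm (\<Phi> w1 - \<Phi> w2)"
      by (rule order_trans[OF _ norm_triangle_ineq]) simp
    with lip[OF that] have "(1 - \<kappa>) * norm (w1 - w2) \<le> norm ((w1 - \<Phi> w1) - (w2 - \<Phi> w2))"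
      by (simp add: algebra_simps)
    then show ?thesis using \<kappa> by (simp add: field_simps)
  qed
  have "\<exists>w\<in>ball 0 \<rho>. w - \<Phi> w = y" if y: "y \<in> ?B" for y
  proof -
    \<comment> \<open>\<open>s\<close> solves \<open>norm y + \<kappa> * s = s\<close>, so
      \<open>w \<mapsto> y + \<Phi> w\<close> maps the closed ball of radius \<open>s\<close> into
      itself; \<open>s < \<rho>\<close> says exactly that \<open>y\<close> lies in
      \<open>?B\<close>.\<close>
    define s where "s = norm y / (1 - \<kappa>)"
    have s: "0 \<le> s" "s < \<rho>" "norm y + \<kappa> * s = s"
      using y \<kappa> by (auto simp: s_def field_simps)
    have sub: "cball 0 s \<subseteq> ball (0::'x) \<rho>"
      using s by auto
    have "\<exists>!w. w \<in> cball 0 s \<and> y + \<Phi> w = w"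
    proof (rule Banach_fix[OF _ _ \<kappa>])
      show "complete (cball (0::'x) s)" by (simp add: complete_eq_closed)
      show "cball (0::'x) s \<noteq> {}" using s by auto
      show "(\<lambda>w. y + \<Phi> w) ` cball 0 s \<subseteq> cball 0 s"
      proof safe
        fix w :: 'x assume w: "w \<in> cball 0 s"
        then have "norm (\<Phi> w) \<le> \<kappa> * norm w"
          using lip[of w 0] sub \<rho> \<Phi>0 by auto
        also have "\<dots> \<le> \<kappa> * s"
          using w \<kappa> by (intro mult_left_mono) auto
        finally have "norm (y + \<Phi> w) \<le> s"
          using norm_triangle_ineq[of y "\<Phi> w"] s by linarith
        then show "y + \<Phi> w \<in> cball 0 s" by simp
      qed
      show "dist (y + \<Phi> w1) (y + \<Phi> w2) \<le> \<kappa> * dist w1 w2" if "w1 \<in> cball 0 s"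
          "w2 \<in> cball 0 s" for w1 w2
        using lip[of w1 w2] that s by (auto simp: dist_norm)
    qed
    then obtain w where "w \<in> cball 0 s" "y + \<Phi> w = w" by blast
    then have "w \<in> ball 0 \<rho>" "w - \<Phi> w = y"
      using sub by (auto simp: algebra_simps)
    then show ?thesis by blast
  qed
  then obtain g where g: "\<And>y. y \<in> ?B \<Longrightarrow> g y \<in> ball 0 \<rho>" "\<And>y. y \<in> ?B \<Longrightarrow> g y - \<Phi> (g y) = y"
    by metis
  have gid: "g (w - \<Phi> w) = w" if "w \<in> ball 0 \<rho>" "w - \<Phi> w \<in> ?B" for w
    using expand[of "g (w - \<Phi> w)" w] g[OF that(2)] that(1) by simp
  have "\<exists>M. bounded_linear M \<and> (\<forall>v. M v - \<Phi>' (g y) (M v) = v) \<and>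
      (\<forall>v. M (v - \<Phi>' (g y) v) = v) \<and> (\<forall>v. norm (M v) \<le> norm v / (1 - \<kappa>))" if "y \<in> ?B" for y
    using contraction_perturbation_bijective[OF has_derivative_bounded_linear[OF
        der[OF g(1)[OF that]]]
      bound[OF g(1)[OF that]] \<kappa>] by metis
  then obtain G where G: "\<And>y. y \<in> ?B \<Longrightarrow> bounded_linear (G y)"
      "\<And>y v. y \<in> ?B \<Longrightarrow> G y v - \<Phi>' (g y) (G y v) = v"
      "\<And>y v. y \<in> ?B \<Longrightarrow> G y (v - \<Phi>' (g y) v) = v"
      "\<And>y v. y \<in> ?B \<Longrightarrow> norm (G y v) \<le> norm v / (1 - \<kappa>)"
    by metis
  have "(1 / (1 - \<kappa>))-lipschitz_on ?B g"
    using expand[OF g(1) g(1)] g(2) \<kappa> by (intro lipschitz_onI) (auto simp: dist_norm)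
  then have contg: "continuous_on ?B g"
    by (rule lipschitz_on_continuous_on)
  show thesis
  proof (rule that)
    show "(g has_derivative G y) (at y)" if y: "y \<in> ?B" for y
    proof (rule has_derivative_inverse_basic[where f = "\<lambda>w. w - \<Phi> w" and T = ?B])
      show "((\<lambda>w. w - \<Phi> w) has_derivative (\<lambda>v. v - \<Phi>' (g y) v)) (at (g y))"
        using der[OF g(1)[OF y]] by (auto intro!: derivative_eq_intros)
      show "G y \<circ> (\<lambda>v. v - \<Phi>' (g y) v) = id"
        using G(3)[OF y] by auto
      show "continuous (at y) g"
        using contg y by (simp add: continuous_on_eq_continuous_at)
    qed (use G(1)[OF y] y g(2) in auto)
    show "continuous_on ?B (\<lambda>y. G y v)" for v
    proof (unfold continuous_on, rule ballI)
      fix y0 assume y0: "y0 \<in> ?B"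
      have "continuous_on ?B (\<lambda>y. \<Phi>' (g y) (G y0 v))"
        by (rule continuous_on_compose2[OF cont contg]) (use g(1) in auto)
      then have "((\<lambda>y. \<Phi>' (g y) (G y0 v)) \<longlongrightarrow> \<Phi>' (g y0) (G y0 v)) (at y0 within ?B)"
        using y0 by (simp add: continuous_on)
      then have lim: "((\<lambda>y. norm (\<Phi>' (g y) (G y0 v) - \<Phi>' (g y0) (G y0 v)) / (1 - \<kappa>)) \<longlongrightarrow> 0)
          (at y0 within ?B)"
        using \<kappa> by (auto intro!: tendsto_eq_intros)
      have "norm (G y v - G y0 v) \<le> norm (\<Phi>' (g y) (G y0 v) - \<Phi>' (g y0) (G y0 v)) / (1 - \<kappa>)"
        if y: "y \<in> ?B" for y
      proof -
        interpret bounded_linear "\<Phi>' (g y)"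
          using has_derivative_bounded_linear[OF der[OF g(1)[OF y]]] .
        \<comment> \<open>Subtract the equations that characterise \<open>G y v\<close> and
          \<open>G y0 v\<close>. The part containing \<open>G y v - G y0 v\<close> is absorbed with
          factor \<open>\<kappa> < 1\<close>; what remains is the variation of
          \<open>\<Phi>'\<close> on the fixed vector \<open>G y0 v\<close>, which strong continuity
          controls.\<close>
        have "(G y v - \<Phi>' (g y) (G y v)) - (G y0 v - \<Phi>' (g y0) (G y0 v)) = 0"
          by (simp only: G(2)[OF y] G(2)[OF y0] diff_self)
        then have "G y v - G y0 v = \<Phi>' (g y) (G y v) - \<Phi>' (g y0) (G y0 v)"
          by (simp add: algebra_simps)
        also have "\<dots> = \<Phi>' (g y) (G y v - G y0 v) + (\<Phi>' (g y) (G y0 v) - \<Phi>' (g y0) (G y0 v))"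
          by (simp add: diff)
        finally have eq: "\<Phi>' (g y) (G y v - G y0 v) + (\<Phi>' (g y) (G y0 v) - \<Phi>' (g y0) (G y0 v))
            = G y v - G y0 v" ..
        have "norm (G y v - G y0 v) \<le> \<kappa> * norm (G y v - G y0 v)
            + norm (\<Phi>' (g y) (G y0 v) - \<Phi>' (g y0) (G y0 v))"
          using norm_triangle_ineq[of "\<Phi>' (g y) (G y v - G y0 v)"
              "\<Phi>' (g y) (G y0 v) - \<Phi>' (g y0) (G y0 v)"]
            bound[OF g(1)[OF y], of "G y v - G y0 v"]
          unfolding eq by linarith
        then show ?thesis using \<kappa> by (simp add: field_simps)
      qed
      then have "\<forall>\<^sub>F y in at y0 within ?B. norm (G y v - G y0 v)
          \<le> norm (\<Phi>' (g y) (G y0 v) - \<Phi>' (g y0) (G y0 v)) / (1 - \<kappa>)"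
        unfolding eventually_at_filter by (intro always_eventually) blast
      then show "((\<lambda>y. G y v) \<longlongrightarrow> G y0 v) (at y0 within ?B)"
        using lim by (rule LIM_zero_cancel[OF Lim_null_comparison])
    qed
  qed (fact g gid G)+
qed

section \<open>Superposition operators on paths\<close>

text \<open>The points \<open>y\<close> may lie outside \<open>K\<close>, so the argument runs on
  the compact thickening \<open>K'\<close>. There the distance \<open>h\<close> of two derivatives,
  summed over the basis, is uniformly continuous, and it vanishes on the diagonal.\<close>

lemma Ck_on_1_uniform_derivative:
  fixes f :: "'a::euclidean_space \<Rightarrow> 'b::real_normed_vector"
  assumes f: "Ck_on 1 f S" and S: "open S" and K: "compact K" "K \<subseteq> S" and e: "e > 0"
  obtains d where "d > 0" "\<And>k. k \<in> K \<Longrightarrow> ball k d \<subseteq> S"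
    "\<And>k y u. k \<in> K \<Longrightarrow> y \<in> ball k d \<Longrightarrow>
       norm (frechet_derivative f (at y) u - frechet_derivative f (at k) u) \<le> e * norm u"
proof -
  let ?D = "\<lambda>y. frechet_derivative f (at y)"
  obtain r where r: "r > 0" "(\<Union>x\<in>K. cball x r) \<subseteq> S"
    using compact_subset_open_imp_cball_epsilon_subset[OF K(1) S K(2)] .
  define K' where "K' = (\<Union>x\<in>K. cball x r)"
  have "K' = (\<Union>x\<in>K. \<Union>y\<in>cball 0 r. {x + y})"
    unfolding K'_def by (auto simp: dist_norm) (metis add_diff_cancel_left' diff_add_cancel
        norm_minus_commute mem_cball_0 add.commute)
  then have K': "compact K'" "K' \<subseteq> S" "K \<subseteq> K'"
    using compact_sums'[OF K(1) compact_cball, of 0 r] r by (auto simp: K'_def less_imp_le)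
  define h where "h p = (\<Sum>b\<in>Basis. norm (?D (fst p) b - ?D (snd p) b))" for p
  have "continuous_on (K' \<times> K') h"
    unfolding h_def
    by (intro continuous_intros continuous_on_frechet_derivative[OF f]) (use K' in auto)
  then have "uniformly_continuous_on (K' \<times> K') h"
    using K' by (intro compact_uniformly_continuous compact_Times)
  then obtain d where d: "d > 0"
    "\<And>p p'. p \<in> K' \<times> K' \<Longrightarrow> p' \<in> K' \<times> K' \<Longrightarrow> dist p' p < d \<Longrightarrow> dist (h p') (h p) < e"
    unfolding uniformly_continuous_on_def using e by meson
  show thesis
  proof (rule that)
    show "min d r > 0" using d r by simp
    show "ball k (min d r) \<subseteq> S" if "k \<in> K" for k
      using r that by fastforce
    fix k y u assume k: "k \<in> K" and y: "y \<in> ball k (min d r)"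
    have y': "y \<in> K'" using y k by (auto simp: K'_def intro!: bexI[of _ k])
    have "dist (y, k) (k, k) < d"
      using y by (simp add: dist_Pair_Pair dist_commute)
    then have "dist (h (y, k)) (h (k, k)) < e"
      using y' k K' by (intro d) auto
    then have he: "h (y, k) < e"
      by (simp add: h_def dist_real_def)
    interpret Y: linear "?D y"
      using Ck_on_1_linear_derivative[OF f] y' K' by blast
    interpret L: linear "?D k"
      using Ck_on_1_linear_derivative[OF f] k K by blast
    have "?D y u - ?D k u = (\<Sum>b\<in>Basis. (u \<bullet> b) *\<^sub>R (?D y b - ?D k b))"
      by (simp add: scaleR_diff_right sum_subtractf flip: Y.scale L.scale Y.sum L.sum)
        (simp add: euclidean_representation)
    also have "norm \<dots> \<le> (\<Sum>b\<in>Basis. norm u * norm (?D y b - ?D k b))"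
      by (intro sum_norm_le) (auto intro!: mult_right_mono Basis_le_norm)
    also have "\<dots> = h (y, k) * norm u"
      by (simp add: h_def sum_distrib_left sum_distrib_right mult.commute)
    also have "\<dots> \<le> e * norm u"
      using he by (intro mult_right_mono) auto
    finally show "norm (?D y u - ?D k u) \<le> e * norm u" .
  qed
qed

section \<open>The Banach space of paths on the unit interval\<close>

definition unit_clamp :: "real \<Rightarrow> real" where
  "unit_clamp t = max 0 (min 1 t)"

lemma unit_clamp_mem: "unit_clamp t \<in> {0..1}"
  by (auto simp: unit_clamp_def)

lemma unit_clamp_id: "t \<in> {0..1} \<Longrightarrow> unit_clamp t = t"
  by (auto simp: unit_clamp_def)

text \<open>Paths on the unit interval, extended by constants to \<open>\<real>\<close> so that they form a complete
  normed space.\<close>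

definition path_of :: "(real \<Rightarrow> 'a) \<Rightarrow> (real \<Rightarrow>\<^sub>C 'a::real_normed_vector)" where
  "path_of f = Bcontfun (\<lambda>t. f (unit_clamp t))"

lemma apply_path_of:
  assumes "continuous_on {0..1} f"
  shows "apply_bcontfun (path_of f) t = f (unit_clamp t)"
proof -
  have "continuous_on UNIV unit_clamp"
    unfolding unit_clamp_def by (intro continuous_intros)
  then have "continuous_on UNIV (\<lambda>t. f (unit_clamp t))"
    using unit_clamp_mem by (intro continuous_on_compose2[OF assms]) auto
  moreover have "bounded (range (\<lambda>t. f (unit_clamp t)))"
    by (rule bounded_subset[OF compact_imp_bounded[OF
        compact_continuous_image[OF assms compact_Icc]]])
      (use unit_clamp_mem in auto)
  ultimately have "(\<lambda>t. f (unit_clamp t)) \<in> bcontfun"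
    by (simp add: bcontfun_def)
  then show ?thesis
    by (simp add: path_of_def Bcontfun_inverse)
qed

lemma norm_path_of_le:
  assumes "continuous_on {0..1} f" "\<And>t. t \<in> {0..1} \<Longrightarrow> norm (f t) \<le> B"
  shows "norm (path_of f) \<le> B"
  by (rule norm_bound) (simp only: apply_path_of[OF assms(1)] assms(2)[OF unit_clamp_mem])

lemma path_of_diff:
  assumes "continuous_on {0..1} f" "continuous_on {0..1} g"
  shows "path_of (\<lambda>t. f t - g t) = path_of f - path_of g"
  by (rule bcontfun_eqI) (simp add: apply_path_of assms continuous_on_diff)

text \<open>Conditions on the unit interval suffice, because outside it \<open>path_of\<close>
  repeats the end values.\<close>

lemma bounded_linear_path_of:
  fixes L :: "(real \<Rightarrow>\<^sub>C 'a::real_normed_vector) \<Rightarrow> real \<Rightarrow> 'b::real_normed_vector"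
  assumes "\<And>\<zeta>. continuous_on {0..1} (L \<zeta>)"
    and "\<And>\<zeta> \<eta> t. t \<in> {0..1} \<Longrightarrow> L (\<zeta> + \<eta>) t = L \<zeta> t + L \<eta> t"
    and "\<And>r \<zeta> t. t \<in> {0..1} \<Longrightarrow> L (r *\<^sub>R \<zeta>) t = r *\<^sub>R L \<zeta> t"
    and "\<And>\<zeta> t. t \<in> {0..1} \<Longrightarrow> norm (L \<zeta> t) \<le> norm \<zeta> * B"
  shows "bounded_linear (\<lambda>\<zeta>. path_of (L \<zeta>))"
proof (rule bounded_linear_intro)
  show "path_of (L (\<zeta> + \<eta>)) = path_of (L \<zeta>) + path_of (L \<eta>)" for \<zeta> \<eta>
    using assms(2)[OF unit_clamp_mem, of \<zeta> \<eta>]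
    by (intro bcontfun_eqI) (simp add: apply_path_of assms(1))
  show "path_of (L (r *\<^sub>R \<zeta>)) = r *\<^sub>R path_of (L \<zeta>)" for r \<zeta>
    using assms(3)[OF unit_clamp_mem, of r \<zeta>]
    by (intro bcontfun_eqI) (simp add: apply_path_of assms(1))
  show "norm (path_of (L \<zeta>)) \<le> norm \<zeta> * B" for \<zeta>
    using assms by (intro norm_path_of_le) auto
qed

text \<open>The Nemytskii operator of \<open>f\<close>. It is meaningful for paths that stay where
  \<open>f\<close> is continuous; otherwise \<open>path_of\<close> may be applied to a function that
  is not continuous.\<close>

definition superposition :: "('a::real_normed_vector \<Rightarrow> 'b::real_normed_vector) \<Rightarrow> (real \<Rightarrow>\<^sub>C 'a) \<Rightarrow>
    (real \<Rightarrow>\<^sub>C 'b)" where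
  "superposition f z = path_of (\<lambda>t. f (z t))"

definition superposition_deriv ::
    "('a::real_normed_vector \<Rightarrow> 'b::real_normed_vector) \<Rightarrow> (real \<Rightarrow>\<^sub>C 'a) \<Rightarrow> (real \<Rightarrow>\<^sub>C 'a) \<Rightarrow>
        (real \<Rightarrow>\<^sub>C 'b)" where
  "superposition_deriv f z \<zeta> = path_of (\<lambda>t. frechet_derivative f (at (z t)) (\<zeta> t))"

context
  fixes f :: "'a::euclidean_space \<Rightarrow> 'b::real_normed_vector" and S :: "'a set"
  assumes f: "Ck_on 1 f S" and S: "open S"
begin

lemma continuous_on_superposition:
  fixes z :: "real \<Rightarrow>\<^sub>C 'a"
  assumes "\<And>t. t \<in> {0..1} \<Longrightarrow> apply_bcontfun z t \<in> S"
  shows "continuous_on {0..1} (\<lambda>t. f (apply_bcontfun z t))"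
  by (rule continuous_on_compose2[OF Ck_on_1_imp_continuous_on[OF f]]) (use assms in auto)

lemma continuous_on_superposition_deriv:
  fixes z :: "real \<Rightarrow>\<^sub>C 'a"
  assumes "\<And>t. t \<in> {0..1} \<Longrightarrow> apply_bcontfun z t \<in> S"
  shows "continuous_on {0..1} (\<lambda>t. frechet_derivative f (at (apply_bcontfun z t))
      (apply_bcontfun \<zeta> t))"
  by (rule continuous_on_frechet_derivative[OF f]) (use assms in auto)

lemma superposition_uniform:
  fixes z :: "real \<Rightarrow>\<^sub>C 'a"
  assumes z: "\<And>t. t \<in> {0..1} \<Longrightarrow> apply_bcontfun z t \<in> S" and e: "e > 0"
  obtains d where "d > 0" "\<And>t. t \<in> {0..1} \<Longrightarrow> ball (apply_bcontfun z t) d \<subseteq> S"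
    "\<And>t y u. t \<in> {0..1} \<Longrightarrow> y \<in> ball (apply_bcontfun z t) d \<Longrightarrow>
       norm (frechet_derivative f (at y) u - frechet_derivative f (at (apply_bcontfun z t)) u)
           \<le> e * norm u"
proof -
  have "compact (apply_bcontfun z ` {0..1})" "apply_bcontfun z ` {0..1} \<subseteq> S"
    using z by (auto intro!: compact_continuous_image compact_Icc)
  from Ck_on_1_uniform_derivative[OF f S this e]
  obtain d where "d > 0" "\<And>k. k \<in> apply_bcontfun z ` {0..1} \<Longrightarrow> ball k d \<subseteq> S"
    "\<And>k y u. k \<in> apply_bcontfun z ` {0..1} \<Longrightarrow> y \<in> ball k d \<Longrightarrow>
       norm (frechet_derivative f (at y) u - frechet_derivative f (at k) u) \<le> e * norm u" by blast
  then show thesis by (intro that[of d]) auto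
qed

text \<open>The remainder estimate has to be uniform in \<open>t\<close>. The image of the path is
  compact, so the derivative of \<open>f\<close> varies by at most \<open>e\<close> in a tube of
  fixed radius around it, and linearising along segments inside the tube gives the same bound at all
  times.\<close>

lemma has_derivative_superposition:
  assumes z: "\<And>t. t \<in> {0..1} \<Longrightarrow> apply_bcontfun z t \<in> S"
  shows "(superposition f has_derivative superposition_deriv f z) (at z)"
proof -
  let ?D = "\<lambda>y. frechet_derivative f (at y)"
  \<comment> \<open>A bound on the derivatives along the path, uniform in time, makes the candidate
    derivative a bounded operator on paths.\<close>
  have "\<exists>B. \<forall>t\<in>{0..1}. \<forall>u. norm (?D (z t) u) \<le> norm u * B"
  proof -
    have "continuous_on {0..1} (\<lambda>t. \<Sum>b\<in>Basis. norm (?D (z t) b))"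
      by (intro continuous_intros continuous_on_frechet_derivative[OF f]) (use z in auto)
    then have "bounded ((\<lambda>t. \<Sum>b\<in>Basis. norm (?D (z t) b)) ` {0..1})"
      by (intro compact_imp_bounded compact_continuous_image compact_Icc)
    then obtain B where B': "\<forall>x\<in>(\<lambda>t. \<Sum>b\<in>Basis. norm (?D (z t) b)) ` {0..1}. norm x \<le> B"
      unfolding bounded_iff by blast
    have B: "(\<Sum>b\<in>Basis. norm (?D (z t) b)) \<le> B" if "t \<in> {0..1}" for t
      using bspec[OF B' imageI[OF that]] unfolding real_norm_def by (rule abs_le_D1)
    have "norm (?D (z t) u) \<le> norm u * B" if t: "t \<in> {0..1}" for t u
    proof -
      interpret linear "?D (z t)"
        using Ck_on_1_linear_derivative[OF f z[OF t]] .
      have "?D (z t) u = (\<Sum>b\<in>Basis. (u \<bullet> b) *\<^sub>R ?D (z t) b)"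
        by (simp flip: scale sum add: euclidean_representation)
      also have "norm \<dots> \<le> (\<Sum>b\<in>Basis. norm u * norm (?D (z t) b))"
        by (intro sum_norm_le) (auto intro!: mult_right_mono Basis_le_norm)
      also have "\<dots> \<le> norm u * B"
        using B[OF t] by (auto simp flip: sum_distrib_left intro!: mult_left_mono)
      finally show ?thesis .
    qed
    then show ?thesis by blast
  qed
  then obtain B where B: "\<And>t u. t \<in> {0..1} \<Longrightarrow> norm (?D (z t) u) \<le> norm u * B" by blast
  have "bounded_linear (superposition_deriv f z)"
    unfolding superposition_deriv_def
  proof (rule bounded_linear_path_of)
    fix \<zeta> \<eta> :: "real \<Rightarrow>\<^sub>C 'a" and r t :: real assume t: "t \<in> {0..1}"
    interpret linear "?D (z t)"
      using Ck_on_1_linear_derivative[OF f z[OF t]] .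
    show "?D (z t) ((\<zeta> + \<eta>) t) = ?D (z t) (\<zeta> t) + ?D (z t) (\<eta> t)"
      by (simp add: add)
    show "?D (z t) ((r *\<^sub>R \<zeta>) t) = r *\<^sub>R ?D (z t) (\<zeta> t)"
      by (simp add: scale)
    have "norm (?D (z t) (\<zeta> t)) \<le> norm (\<zeta> t) * \<bar>B\<bar>"
      by (rule order_trans[OF B[OF t]]) (auto intro!: mult_left_mono)
    also have "\<dots> \<le> norm \<zeta> * \<bar>B\<bar>"
      by (intro mult_right_mono norm_bounded) auto
    finally show "norm (?D (z t) (\<zeta> t)) \<le> norm \<zeta> * \<bar>B\<bar>" .
  qed (use continuous_on_superposition_deriv[OF z] in auto)
  moreover have "\<exists>d>0. \<forall>y. norm (y - z) < d \<longrightarrow>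
      norm (superposition f y - superposition f z - superposition_deriv f z (y - z))
          \<le> e * norm (y - z)"
    if "e > 0" for e
  proof -
    obtain d where d: "d > 0" "\<And>t. t \<in> {0..1} \<Longrightarrow> ball (z t) d \<subseteq> S"
      "\<And>t y u. t \<in> {0..1} \<Longrightarrow> y \<in> ball (z t) d \<Longrightarrow> norm (?D y u - ?D (z t) u) \<le> e * norm u"
      using superposition_uniform[OF z \<open>e > 0\<close>] by blast
    have "norm (superposition f y - superposition f z - superposition_deriv f z (y - z))
        \<le> e * norm (y - z)"
      if y: "norm (y - z) < d" for y
    proof -
      have yd: "norm (y t - z t) < d" for t
        using norm_bounded[of "y - z" t] y by simp
      have yS: "y t \<in> S" if "t \<in> {0..1}" for t
        using d(2)[OF that] yd[of t] by (auto simp: dist_norm norm_minus_commute)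
      have c: "continuous_on {0..1} (\<lambda>t. f (y t))" "continuous_on {0..1} (\<lambda>t. f (z t))"
        "continuous_on {0..1} (\<lambda>t. ?D (z t) ((y - z) t))"
        using continuous_on_superposition yS z continuous_on_superposition_deriv[OF z] by blast+
      have "superposition f y - superposition f z - superposition_deriv f z (y - z)
          = path_of (\<lambda>t. f (y t) - f (z t) - ?D (z t) ((y - z) t))"
        unfolding superposition_def superposition_deriv_def
        using c by (simp add: path_of_diff continuous_on_diff)
      also have "norm \<dots> \<le> e * norm (y - z)"
      proof (rule norm_path_of_le)
        show "continuous_on {0..1} (\<lambda>t. f (y t) - f (z t) - ?D (z t) ((y - z) t))"
          using c by (intro continuous_on_diff)
        fix t :: real assume t: "t \<in> {0..1}"
        have "norm (f (y t) - f (z t) - ?D (z t) (y t - z t)) \<le> norm (y t - z t) * e"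
        proof (rule differentiable_bound_linearization[where S = "ball (z t) d"])
          show "z t + s *\<^sub>R (y t - z t) \<in> ball (z t) d" if "s \<in> {0..1}" for s
          proof -
            have "\<bar>s\<bar> * norm (y t - z t) \<le> norm (y t - z t)"
              using that by (auto intro!: mult_left_le_one_le)
            then show ?thesis using yd[of t] by (simp add: dist_norm)
          qed
          show "(f has_derivative ?D x) (at x within ball (z t) d)" if "x \<in> ball (z t) d" for x
            using Ck_on_1_has_derivative[OF f] d(2)[OF t] that
                by (blast intro: has_derivative_at_withinI)
          show "onorm (?D x - ?D (z t)) \<le> e" if "x \<in> ball (z t) d" for x
            using d(3)[OF t that] \<open>e > 0\<close> by (intro onorm_bound) auto
        qed (use d in auto)
        also have "\<dots> \<le> norm (y - z) * e"
          using norm_bounded[of "y - z" t] \<open>e > 0\<close> by (intro mult_right_mono) auto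
        finally show "norm (f (y t) - f (z t) - ?D (z t) ((y - z) t)) \<le> e * norm (y - z)"
          by (simp add: mult.commute)
      qed
      finally show ?thesis .
    qed
    with d(1) show ?thesis by blast
  qed
  ultimately show ?thesis
    unfolding has_derivative_at_alt by blast
qed

text \<open>Strong continuity of the derivative, in the form required for inverting
  \<open>id - \<Phi>\<close>. The tube around the compact image of \<open>z\<close> again makes the
  estimate uniform in time.\<close>

lemma continuous_on_superposition_deriv_path:
  "continuous_on {z. \<forall>t\<in>{0..1}. apply_bcontfun z t \<in> S} (\<lambda>z. superposition_deriv f z \<zeta>)"
  unfolding continuous_on_iff
proof (intro ballI allI impI)
  fix z :: "real \<Rightarrow>\<^sub>C 'a" and e :: real assume "z \<in> {z. \<forall>t\<in>{0..1}. apply_bcontfun z t \<in> S}" and e: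
      "e > 0"
  then have z: "apply_bcontfun z t \<in> S" if "t \<in> {0..1}" for t
    using that by auto
  \<comment> \<open>The summand 1 avoids division by 0 for \<open>\<zeta> = 0\<close>, and
    \<open>e' * norm \<zeta> < e\<close> holds strictly.\<close>
  define e' where "e' = e / (2 * (norm \<zeta> + 1))"
  have pos: "norm \<zeta> + 1 > 0"
    by (smt (verit) norm_ge_zero)
  then have e': "e' > 0" "e' * norm \<zeta> < e"
  proof -
    show "e' > 0" using e pos by (simp add: e'_def)
    have "e * norm \<zeta> < e * (2 * (norm \<zeta> + 1))"
      using e by (intro mult_strict_left_mono) (auto intro: add_nonneg_pos)
    then show "e' * norm \<zeta> < e" using pos by (simp add: e'_def field_simps)
  qed
  obtain d where d: "d > 0" "\<And>t. t \<in> {0..1} \<Longrightarrow> ball (z t) d \<subseteq> S"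
      "\<And>t y u. t \<in> {0..1} \<Longrightarrow> y \<in> ball (z t) d \<Longrightarrow>
         norm (frechet_derivative f (at y) u - frechet_derivative f (at (z t)) u) \<le> e' * norm u"
    using superposition_uniform[OF z e'(1)] by blast
  have "dist (superposition_deriv f y \<zeta>) (superposition_deriv f z \<zeta>) < e"
    if y: "\<And>t. t \<in> {0..1} \<Longrightarrow> y t \<in> S" "dist y z < d" for y :: "real \<Rightarrow>\<^sub>C 'a"
  proof -
    have c: "continuous_on {0..1} (\<lambda>t. frechet_derivative f (at (y t)) (\<zeta> t))"
        "continuous_on {0..1} (\<lambda>t. frechet_derivative f (at (z t)) (\<zeta> t))"
      using y(1) z by (intro continuous_on_superposition_deriv; blast)+
    have "superposition_deriv f y \<zeta> - superposition_deriv f z \<zeta> = path_of (\<lambda>t.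
        frechet_derivative f (at (y t)) (\<zeta> t) - frechet_derivative f (at (z t)) (\<zeta> t))"
      unfolding superposition_deriv_def by (simp add: path_of_diff c)
    also have "norm \<dots> \<le> e' * norm \<zeta>"
    proof (rule norm_path_of_le)
      fix t :: real assume t: "t \<in> {0..1}"
      have "y t \<in> ball (z t) d"
        using dist_bounded[of y t z] y(2) by (auto simp: dist_commute)
      from d(3)[OF t this, of "\<zeta> t"]
      show "norm (frechet_derivative f (at (y t)) (\<zeta> t) - frechet_derivative f (at (z t)) (\<zeta> t))
          \<le> e' * norm \<zeta>"
        by (rule order_trans) (use e' norm_bounded[of \<zeta> t] in \<open>auto intro!: mult_left_mono\<close>)
    qed (intro continuous_on_diff c)
    finally have "norm (superposition_deriv f y \<zeta> - superposition_deriv f z \<zeta>) \<le> e' * norm \<zeta>" .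
    then show ?thesis using e' by (simp add: dist_norm)
  qed
  with d(1) show "\<exists>d>0. \<forall>y\<in>{z. \<forall>t\<in>{0..1}. apply_bcontfun z t \<in> S}. dist y z < d \<longrightarrow>
      dist (superposition_deriv f y \<zeta>) (superposition_deriv f z \<zeta>) < e"
    by (intro exI[of _ d]) auto
qed

end

section \<open>The exponential map of a spray\<close>

text \<open>The time elapsed is at most 1, so a bound on the velocity is a bound on the
  displacement.\<close>

lemma norm_path_integral_le:
  fixes w :: "real \<Rightarrow>\<^sub>C 'a::euclidean_space"
  assumes "t \<in> {0..1}"
  shows "norm (integral {0..t} (apply_bcontfun w)) \<le> norm w"
proof -
  have "norm (integral {0..t} (apply_bcontfun w)) \<le> norm w * (t - 0)"
    using assms by (intro integral_bound) (auto intro: norm_bounded)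
  also have "\<dots> \<le> norm w"
    using assms by (simp add: mult_left_le)
  finally show ?thesis .
qed

lemma continuous_on_path_integral:
  fixes w :: "real \<Rightarrow>\<^sub>C 'a::euclidean_space"
  shows "continuous_on {0..1} (\<lambda>t. integral {0..t} (apply_bcontfun w))"
  by (intro indefinite_integral_continuous_1 integrable_continuous_real
      continuous_on_apply_bcontfun)

lemma path_integrable:
  fixes w :: "real \<Rightarrow>\<^sub>C 'a::euclidean_space"
  shows "(apply_bcontfun w) integrable_on {a..b}"
  by (intro integrable_continuous_real continuous_on_apply_bcontfun)

definition path_primitive :: "(real \<Rightarrow>\<^sub>C 'a) \<Rightarrow> (real \<Rightarrow>\<^sub>C 'a::euclidean_space)" where
  "path_primitive w = path_of (\<lambda>t. integral {0..t} (apply_bcontfun w))"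

text \<open>Displacement together with velocity. The base point is added elsewhere, as a constant
  path, so that this map is linear in \<open>w\<close>.\<close>

definition phase_path :: "(real \<Rightarrow>\<^sub>C 'a) \<Rightarrow> (real \<Rightarrow>\<^sub>C ('a \<times> 'a::euclidean_space))" where
  "phase_path w = path_of (\<lambda>t. (integral {0..t} (apply_bcontfun w), apply_bcontfun w t))"

lemma apply_path_primitive:
  "apply_bcontfun (path_primitive w) t = integral {0..unit_clamp t} (apply_bcontfun w)"
  unfolding path_primitive_def by (intro apply_path_of continuous_on_path_integral)

lemma apply_phase_path:
  "t \<in> {0..1} \<Longrightarrow> apply_bcontfun (phase_path w) t = (integral {0..t} (apply_bcontfun w),
      apply_bcontfun w t)"
  unfolding phase_path_def
  by (subst apply_path_of) (auto simp: unit_clamp_id intro!: continuous_intros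
      continuous_on_path_integral)

lemma norm_path_primitive_le: "norm (path_primitive w) \<le> norm w"
  unfolding path_primitive_def
  by (intro norm_path_of_le continuous_on_path_integral norm_path_integral_le)

lemma bounded_linear_path_primitive: "bounded_linear path_primitive"
  unfolding path_primitive_def
  by (rule bounded_linear_path_of[where B = 1])
    (auto simp: integral_add path_integrable intro!: continuous_on_path_integral
        norm_path_integral_le)

lemma bounded_linear_phase_path: "bounded_linear phase_path"
  unfolding phase_path_def
proof (rule bounded_linear_path_of[where B = 2])
  show "norm (integral {0..t} (apply_bcontfun \<zeta>), apply_bcontfun \<zeta> t) \<le> norm \<zeta> * 2"
    if "t \<in> {0..1}" for t and \<zeta> :: "real \<Rightarrow>\<^sub>C 'a"
    using norm_Pair_le[of "integral {0..t} (apply_bcontfun \<zeta>)" "apply_bcontfun \<zeta> t"]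
      norm_path_integral_le[OF that, of \<zeta>] norm_bounded[of \<zeta> t] by simp
qed (auto simp: integral_add path_integrable intro!: continuous_intros continuous_on_path_integral)

lemma bounded_linear_const_bcontfun: "bounded_linear
    (const_bcontfun :: 'a::real_normed_vector \<Rightarrow> real \<Rightarrow>\<^sub>C 'a)"
  by (rule bounded_linear_intro[where K = 1]) (auto intro!: bcontfun_eqI norm_bound)

lemma norm_const_bcontfun_le: "norm (const_bcontfun u :: real \<Rightarrow>\<^sub>C 'a::real_normed_vector) \<le> norm u"
  by (rule norm_bound) simp

lemma bounded_linear_path_integral:
  "bounded_linear (\<lambda>w :: real \<Rightarrow>\<^sub>C 'a::euclidean_space. integral {0..1} (apply_bcontfun w))"
  by (rule bounded_linear_intro[where K = 1])
    (auto simp: integral_add path_integrable intro!: norm_path_integral_le)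

text \<open>\<open>\<Phi>\<close> is the Picard integral operator for the velocity. It is composed
  of an affine map, a superposition and a primitive, so the chain rule differentiates it.
  Displacement and velocity of \<open>v\<close> are both at most \<open>norm v\<close> on the unit
  interval, hence the bound 1/8 on each slot adds up to the contraction constant 1/4.\<close>

lemma spray_path_operator:
  fixes f :: "'a::euclidean_space \<times> 'a \<Rightarrow> 'a"
  assumes \<rho>: "\<rho> > 0" and f: "Ck_on 1 f (ball q \<rho> \<times> ball 0 \<rho>)"
    and zero: "f (q, 0) = 0"
    and small: "\<And>x w \<xi> \<eta>. x \<in> ball q \<rho> \<Longrightarrow> w \<in> ball 0 \<rho> \<Longrightarrow>
      norm (frechet_derivative f (at (x, w)) (\<xi>, \<eta>)) \<le> 1/8 * (norm \<xi> + norm \<eta>)"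
  defines "\<Phi> \<equiv> \<lambda>w. path_primitive (superposition f (const_bcontfun (q, 0) + phase_path w))"
  obtains \<Phi>' where "\<Phi> 0 = 0"
    "\<And>w. w \<in> ball 0 \<rho> \<Longrightarrow> (\<Phi> has_derivative \<Phi>' w) (at w)"
    "\<And>w v. w \<in> ball 0 \<rho> \<Longrightarrow> norm (\<Phi>' w v) \<le> 1/4 * norm v"
    "\<And>v. continuous_on (ball 0 \<rho>) (\<lambda>w. \<Phi>' w v)"
    "\<And>w t. w \<in> ball 0 \<rho> \<Longrightarrow> t \<in> {0..1} \<Longrightarrow>
       apply_bcontfun (\<Phi> w) t = integral {0..t} (\<lambda>s. f (q
           + integral {0..s} (apply_bcontfun w), apply_bcontfun w s))"
    "\<And>(w::real \<Rightarrow>\<^sub>C 'a) t. w \<in> ball 0 \<rho> \<Longrightarrow> t \<in> {0..1} \<Longrightarrow>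
        q + integral {0..t} (apply_bcontfun w) \<in> ball q \<rho>"
    "\<And>(w::real \<Rightarrow>\<^sub>C 'a). w \<in> ball 0 \<rho> \<Longrightarrow>
       continuous_on {0..1} (\<lambda>s. f (q + integral {0..s} (apply_bcontfun w), apply_bcontfun w s))"
proof -
  let ?S = "ball q \<rho> \<times> ball (0::'a) \<rho>"
  define P where "P w = const_bcontfun (q, 0) + phase_path w" for w :: "real \<Rightarrow>\<^sub>C 'a"
  define \<Phi>' where "\<Phi>' w v = path_primitive (superposition_deriv f (P w) (phase_path v))" for w v
  have openS: "open ?S" by (intro open_Times open_ball)
  have P: "P w t = (q + integral {0..t} (apply_bcontfun w), w t)" if "t \<in> {0..1}" for w t
    using apply_phase_path[OF that, of w] by (simp add: P_def)
  have pos: "q + integral {0..t} (apply_bcontfun w) \<in> ball q \<rho>" if "w \<in> ball 0 \<rho>"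
      "t \<in> {0..1}" for w :: "real \<Rightarrow>\<^sub>C 'a" and t
    using norm_path_integral_le[OF that(2), of w] that(1) by (simp add: dist_norm)
  have PS: "P w t \<in> ?S" if "w \<in> ball 0 \<rho>" "t \<in> {0..1}" for w t
    using pos[OF that] norm_bounded[of w t] that(1) unfolding P[OF that(2)] by simp
  have derP: "(P has_derivative phase_path) (at w)" for w
    unfolding P_def
    by (rule has_derivative_eq_rhs[OF has_derivative_add[OF has_derivative_const
        bounded_linear_imp_has_derivative[OF bounded_linear_phase_path]]]) simp
  have contP: "continuous_on UNIV P"
    using derP by (meson has_derivative_continuous continuous_at_imp_continuous_on)
  have contf: "continuous_on {0..1} (\<lambda>t. f (P w t))" if "w \<in> ball 0 \<rho>" for w
    using continuous_on_superposition[OF f openS] PS[OF that] by blast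
  have sup: "superposition f (P w) t = f (P w t)" if "w \<in> ball 0 \<rho>" "t \<in> {0..1}" for w t
    unfolding superposition_def using apply_path_of[OF contf[OF that(1)], of t]
        unit_clamp_id[OF that(2)] by simp
  have \<Phi>: "\<Phi> w = path_primitive (superposition f (P w))" for w
    by (simp add: \<Phi>_def P_def)
  have val: "\<Phi> w t = integral {0..t} (\<lambda>s. f (q + integral {0..s} (apply_bcontfun w), w s))"
    if w: "w \<in> ball 0 \<rho>" and t: "t \<in> {0..1}" for w t
    unfolding \<Phi> apply_path_primitive unit_clamp_id[OF t]
  proof (rule integral_cong)
    fix s assume "s \<in> {0..t}"
    then have "s \<in> {0..1}" using t by auto
    then show "superposition f (P w) s = f (q + integral {0..s} (apply_bcontfun w), w s)"
      using sup[OF w] P by simp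
  qed
  show thesis
  proof (rule that)
    show "\<Phi> 0 = 0"
    proof -
      have "superposition f (P 0) = 0"
        unfolding superposition_def
      proof (rule bcontfun_eqI)
        fix t
        have "(0::real \<Rightarrow>\<^sub>C 'a) \<in> ball 0 \<rho>" using \<rho> by simp
        then have "apply_bcontfun (path_of (\<lambda>t. f (P 0 t))) t = f (P 0 (unit_clamp t))"
          by (intro apply_path_of contf)
        also have "\<dots> = 0"
          by (simp add: P[OF unit_clamp_mem] zero zero_bcontfun.rep_eq)
        finally show "apply_bcontfun (path_of (\<lambda>t. f (P 0 t))) t = apply_bcontfun 0 t" by simp
      qed
      then show ?thesis
        using linear_0[OF bounded_linear.linear[OF bounded_linear_path_primitive]] by (simp add: \<Phi>)
    qed
    show "(\<Phi> has_derivative \<Phi>' w) (at w)" if "w \<in> ball 0 \<rho>" for w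
      unfolding \<Phi> \<Phi>'_def
      by (rule bounded_linear.has_derivative[OF bounded_linear_path_primitive
          has_derivative_compose[OF derP has_derivative_superposition[OF f openS PS[OF that]]]])
    show "norm (\<Phi>' w v) \<le> 1/4 * norm v" if w: "w \<in> ball 0 \<rho>" for w v
    proof -
      have "norm (\<Phi>' w v) \<le> norm (superposition_deriv f (P w) (phase_path v))"
        unfolding \<Phi>'_def by (rule norm_path_primitive_le)
      also have "\<dots> \<le> 1/4 * norm v"
        unfolding superposition_deriv_def
      proof (rule norm_path_of_le)
        show "continuous_on {0..1} (\<lambda>t. frechet_derivative f (at (P w t)) (phase_path v t))"
          using continuous_on_superposition_deriv[OF f openS] PS[OF w] by blast
        fix t :: real assume t: "t \<in> {0..1}"
        have "norm (frechet_derivative f (at (P w t)) (phase_path v t))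
            \<le> 1/8 * (norm (integral {0..t} (apply_bcontfun v)) + norm (v t))"
          unfolding P[OF t] apply_phase_path[OF t]
          by (rule small) (use PS[OF w t] P[OF t] in auto)
        also have "\<dots> \<le> 1/4 * norm v"
          using norm_path_integral_le[OF t, of v] norm_bounded[of v t] by simp
        finally show "norm (frechet_derivative f (at (P w t)) (phase_path v t)) \<le> 1/4 * norm v" .
      qed
      finally show ?thesis .
    qed
    show "continuous_on (ball 0 \<rho>) (\<lambda>w. \<Phi>' w v)" for v
      unfolding \<Phi>'_def
    proof (rule bounded_linear.continuous_on[OF bounded_linear_path_primitive])
      show "continuous_on (ball 0 \<rho>) (\<lambda>w. superposition_deriv f (P w) (phase_path v))"
        by (rule continuous_on_compose2[OF continuous_on_superposition_deriv_path[OF f openS]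
              continuous_on_subset[OF contP subset_UNIV]]) (use PS in blast)
    qed
    show "continuous_on {0..1} (\<lambda>s. f (q + integral {0..s} (apply_bcontfun w), w s))"
      if "w \<in> ball 0 \<rho>" for w :: "real \<Rightarrow>\<^sub>C 'a"
      by (rule continuous_on_eq[OF contf[OF that]]) (simp only: P)
  qed (fact val pos)+
qed

theorem spray_exponential:
  fixes f :: "'a::euclidean_space \<times> 'a \<Rightarrow> 'a"
  assumes \<rho>: "\<rho> > 0" and f: "Ck_on 1 f (ball q \<rho> \<times> ball 0 \<rho>)"
    and zero: "f (q, 0) = 0"
    and small: "\<And>x w \<xi> \<eta>. x \<in> ball q \<rho> \<Longrightarrow> w \<in> ball 0 \<rho> \<Longrightarrow>
      norm (frechet_derivative f (at (x, w)) (\<xi>, \<eta>)) \<le> 1/8 * (norm \<xi> + norm \<eta>)"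
  obtains X W F where
    "\<And>u t. u \<in> ball 0 (3/4 * \<rho>) \<Longrightarrow> t \<in> {0..1} \<Longrightarrow> X u t \<in> ball q \<rho>"
    "\<And>u. u \<in> ball 0 (3/4 * \<rho>) \<Longrightarrow> X u 0 = q"
    "\<And>u. u \<in> ball 0 (3/4 * \<rho>) \<Longrightarrow> W u 0 = u"
    "\<And>u t. u \<in> ball 0 (3/4 * \<rho>) \<Longrightarrow> t \<in> {0..1} \<Longrightarrow>
       (X u has_vector_derivative W u t) (at t within {0..1})"
    "\<And>u t. u \<in> ball 0 (3/4 * \<rho>) \<Longrightarrow> t \<in> {0..1} \<Longrightarrow>
       (W u has_vector_derivative f (X u t, W u t)) (at t within {0..1})"
    "Ck_on 1 (\<lambda>u. X u 1) (ball 0 (3/4 * \<rho>))"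
    "X 0 1 = q"
    "\<And>y. y \<in> ball q (\<rho>/2) \<Longrightarrow> F y \<in> ball 0 (3/4 * \<rho>)"
    "\<And>y. y \<in> ball q (\<rho>/2) \<Longrightarrow> X (F y) 1 = y"
    "\<And>u. u \<in> ball 0 (3/4 * \<rho>) \<Longrightarrow> X u 1 \<in> ball q (\<rho>/2) \<Longrightarrow> F (X u 1) = u"
    "Ck_on 1 F (ball q (\<rho>/2))"
proof -
  define \<Phi> where "\<Phi> = (\<lambda>w. path_primitive (superposition f (const_bcontfun (q, 0) + phase_path w)))"
  obtain \<Phi>' where \<Phi>0: "\<Phi> 0 = 0"
    and der\<Phi>: "\<And>w. w \<in> ball 0 \<rho> \<Longrightarrow> (\<Phi> has_derivative \<Phi>' w) (at w)"
    and bd\<Phi>: "\<And>w v. w \<in> ball 0 \<rho> \<Longrightarrow> norm (\<Phi>' w v) \<le> 1/4 * norm v"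
    and ct\<Phi>: "\<And>v. continuous_on (ball 0 \<rho>) (\<lambda>w. \<Phi>' w v)"
    and val: "\<And>w t. w \<in> ball 0 \<rho> \<Longrightarrow> t \<in> {0..1} \<Longrightarrow>
       \<Phi> w t = integral {0..t} (\<lambda>s. f (q + integral {0..s} (apply_bcontfun w), w s))"
    and pos: "\<And>(w::real \<Rightarrow>\<^sub>C 'a) t. w \<in> ball 0 \<rho> \<Longrightarrow> t \<in> {0..1} \<Longrightarrow>
        q + integral {0..t} (apply_bcontfun w) \<in> ball q \<rho>"
    and ctf: "\<And>(w::real \<Rightarrow>\<^sub>C 'a). w \<in> ball 0 \<rho> \<Longrightarrow>
       continuous_on {0..1} (\<lambda>s. f (q + integral {0..s} (apply_bcontfun w), w s))"
    using spray_path_operator[OF \<rho> f zero small] unfolding \<Phi>_def by blast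
  let ?B = "ball (0::real \<Rightarrow>\<^sub>C 'a) (3/4 * \<rho>)"
  obtain g G where g: "\<And>y. y \<in> ?B \<Longrightarrow> g y \<in> ball 0 \<rho>"
    "\<And>y. y \<in> ?B \<Longrightarrow> g y - \<Phi> (g y) = y"
    "\<And>w. w \<in> ball 0 \<rho> \<Longrightarrow> w - \<Phi> w \<in> ?B \<Longrightarrow> g (w - \<Phi> w) = w"
    and G: "\<And>y. y \<in> ?B \<Longrightarrow> (g has_derivative G y) (at y)"
    "\<And>v. continuous_on ?B (\<lambda>y. G y v)"
    "\<And>y v. y \<in> ?B \<Longrightarrow> norm (G y v) \<le> norm v / (3/4)"
    "\<And>y v. y \<in> ?B \<Longrightarrow> G y v - \<Phi>' (g y) (G y v) = v"
    using inverse_of_identity_minus_contraction[of "1/4", OF _ _ \<rho> \<Phi>0 der\<Phi> bd\<Phi> ct\<Phi>] by auto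
  let ?c = "const_bcontfun :: 'a \<Rightarrow> real \<Rightarrow>\<^sub>C 'a"
  let ?I = "\<lambda>w :: real \<Rightarrow>\<^sub>C 'a. integral {0..1} (apply_bcontfun w)"
  have cB: "?c u \<in> ?B" if "u \<in> ball 0 (3/4 * \<rho>)" for u
    using norm_const_bcontfun_le[of u] that by simp
  \<comment> \<open>The initial velocity enters as a constant path:
    \<open>W u - \<Phi> (W u) = ?c u\<close> is the equation for the velocity in integrated
    form.\<close>
  define W where "W u = g (?c u)" for u
  define X where "X u t = q + integral {0..t} (apply_bcontfun (W u))" for u t
  have WB: "W u \<in> ball 0 \<rho>" if "u \<in> ball 0 (3/4 * \<rho>)" for u
    using g(1)[OF cB[OF that]] by (simp add: W_def)
  have WI: "W u t = u + integral {0..t} (\<lambda>s. f (X u s, W u s))"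
    if u: "u \<in> ball 0 (3/4 * \<rho>)" and t: "t \<in> {0..1}" for u t
  proof -
    have "W u = ?c u + \<Phi> (W u)"
      using g(2)[OF cB[OF u]] by (simp add: W_def algebra_simps)
    then have "W u t = (?c u + \<Phi> (W u)) t" by simp
    then show ?thesis
      using val[OF WB[OF u] t] by (simp add: X_def)
  qed
  have derX: "(X u has_vector_derivative W u t) (at t within {0..1})"
    if "t \<in> {0..1}" for u t
  proof -
    have "((\<lambda>t. q + integral {0..t} (apply_bcontfun (W u))) has_vector_derivative 0
        + W u t) (at t within {0..1})"
      using that by (intro has_vector_derivative_add has_vector_derivative_const
          integral_has_vector_derivative continuous_on_apply_bcontfun)
    then show ?thesis by (simp add: X_def[abs_def])
  qed
  have derW: "(W u has_vector_derivative f (X u t, W u t)) (at t within {0..1})"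
    if u: "u \<in> ball 0 (3/4 * \<rho>)" and t: "t \<in> {0..1}" for u t
  proof -
    have "((\<lambda>t. u + integral {0..t} (\<lambda>s. f (X u s, W u s))) has_vector_derivative 0
        + f (X u t, W u t))
        (at t within {0..1})"
      using ctf[OF WB[OF u]] t by (intro has_vector_derivative_add has_vector_derivative_const
          integral_has_vector_derivative) (auto simp: X_def)
    then have "((\<lambda>t. u + integral {0..t} (\<lambda>s. f (X u s, W u s)))
        has_vector_derivative f (X u t, W u t))
        (at t within {0..1})" by simp
    with t WI[OF u] show ?thesis
      by (rule has_vector_derivative_transform)
  qed
  define D where "D u v = ?I (G (?c u) (?c v))" for u v
  have derE: "((\<lambda>u. ?I (W u)) has_derivative D u) (at u)" if "u \<in> ball 0 (3/4 * \<rho>)" for u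
    unfolding D_def W_def
    by (rule bounded_linear.has_derivative[OF bounded_linear_path_integral
      has_derivative_compose[OF bounded_linear_imp_has_derivative[OF bounded_linear_const_bcontfun]
        G(1)[OF cB[OF that]]]])
  have ctD: "continuous_on (ball 0 (3/4 * \<rho>)) (\<lambda>u. D u v)" for v
    unfolding D_def
    by (rule bounded_linear.continuous_on[OF bounded_linear_path_integral
      continuous_on_compose2[OF G(2) linear_continuous_on[OF bounded_linear_const_bcontfun]]])
      (use cB in auto)
  \<comment> \<open>A constant path integrates to its value, so \<open>v - D u v\<close> is the
    integral of \<open>?c v - G (?c u) (?c v)\<close>, which the equation for \<open>G\<close> turns
    into a value of \<open>- \<Phi>'\<close>. The constants multiply to 1/4 * 4/3 = 1/3.\<close>
  have bdD: "norm (v - D u v) \<le> 1/3 * norm v" if u: "u \<in> ball 0 (3/4 * \<rho>)" for u v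
  proof -
    interpret I: bounded_linear ?I by (rule bounded_linear_path_integral)
    have "?I (?c v) = v" by simp
    then have "v - D u v = ?I (?c v - G (?c u) (?c v))"
      by (simp only: D_def I.diff)
    also have "?c v - G (?c u) (?c v)
        = (G (?c u) (?c v) - \<Phi>' (g (?c u)) (G (?c u) (?c v))) - G (?c u) (?c v)"
      by (simp only: G(4)[OF cB[OF u]])
    also have "\<dots> = - \<Phi>' (g (?c u)) (G (?c u) (?c v))"
      by simp
    also have "norm (?I (- \<Phi>' (g (?c u)) (G (?c u) (?c v))))
        \<le> norm (- \<Phi>' (g (?c u)) (G (?c u) (?c v)))"
      by (rule norm_path_integral_le) simp
    also have "\<dots> \<le> 1/4 * norm (G (?c u) (?c v))"
      using bd\<Phi>[OF g(1)[OF cB[OF u]]] by simp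
    also have "\<dots> \<le> 1/4 * (norm (?c v) / (3/4))"
      by (intro mult_left_mono G(3)[OF cB[OF u]]) auto
    also have "\<dots> \<le> 1/3 * norm v"
      using norm_const_bcontfun_le[of v] by simp
    finally show ?thesis .
  qed
  have W0: "W 0 = 0"
    using g(3)[of 0] \<Phi>0 \<rho> by (simp add: W_def)
  \<comment> \<open>Chosen so that \<open>u - \<Psi> u\<close> is the displacement
    \<open>X u 1 - q\<close>; the inversion result is applied once more, now in finite
    dimension.\<close>
  define \<Psi> where "\<Psi> u = u - ?I (W u)" for u
  have \<Psi>0: "\<Psi> 0 = 0" by (simp add: \<Psi>_def W0)
  have der\<Psi>: "(\<Psi> has_derivative (\<lambda>v. v - D u v)) (at u)" if "u \<in> ball 0 (3/4 * \<rho>)" for u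
    unfolding \<Psi>_def by (intro has_derivative_diff has_derivative_ident derE that)
  have ct\<Psi>: "continuous_on (ball 0 (3/4 * \<rho>)) (\<lambda>u. v - D u v)" for v
    by (intro continuous_intros ctD)
  have \<rho>34: "3/4 * \<rho> > 0" using \<rho> by simp
  let ?C = "ball (0::'a) (\<rho>/2)"
  obtain k K where k: "\<And>y. y \<in> ?C \<Longrightarrow> k y \<in> ball 0 (3/4 * \<rho>)"
    "\<And>y. y \<in> ?C \<Longrightarrow> k y - \<Psi> (k y) = y"
    "\<And>w. w \<in> ball 0 (3/4 * \<rho>) \<Longrightarrow> w - \<Psi> w \<in> ?C \<Longrightarrow> k (w - \<Psi> w) = w"
    and K: "\<And>y. y \<in> ?C \<Longrightarrow> (k has_derivative K y) (at y)"
    "\<And>v. continuous_on ?C (\<lambda>y. K y v)"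
  proof -
    have "(1 - 1/3) * (3/4 * \<rho>) = \<rho>/2" "0 \<le> (1/3::real)" "1/3 < (1::real)" by simp_all
    note inv = inverse_of_identity_minus_contraction[of
        "1/3", OF this(2,3) \<rho>34 \<Psi>0 der\<Psi> bdD ct\<Psi>, unfolded this(1)]
    show thesis
      by (rule inv; (rule that; assumption)?)
  qed
  have X1: "X u 1 = q + (u - \<Psi> u)" for u
    by (simp add: X_def \<Psi>_def)
  show thesis
  proof (rule that)
    show "X u t \<in> ball q \<rho>" if "u \<in> ball 0 (3/4 * \<rho>)" "t \<in> {0..1}" for u t
      unfolding X_def by (rule pos[OF WB[OF that(1)] that(2)])
    show "X u 0 = q" for u by (simp add: X_def)
    show "W u 0 = u" if "u \<in> ball 0 (3/4 * \<rho>)" for u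
      using WI[OF that, of 0] by simp
    show "Ck_on 1 (\<lambda>u. X u 1) (ball 0 (3/4 * \<rho>))"
      unfolding X_def
    proof (rule Ck_on_1I)
      show "((\<lambda>u. q + ?I (W u)) has_derivative D u) (at u)" if "u \<in> ball 0 (3/4 * \<rho>)" for u
        using has_derivative_add[OF has_derivative_const derE[OF that], of q] by simp
    qed (rule ctD)
    show "X 0 1 = q" by (simp add: X_def W0)
    show "k (y - q) \<in> ball 0 (3/4 * \<rho>)" if "y \<in> ball q (\<rho>/2)" for y
      using that by (intro k) (auto simp: dist_norm norm_minus_commute)
    show "X (k (y - q)) 1 = y" if "y \<in> ball q (\<rho>/2)" for y
      using that k(2)[of "y - q"] by (auto simp: X1 dist_norm norm_minus_commute)
    show "k (X u 1 - q) = u" if "u \<in> ball 0 (3/4 * \<rho>)" "X u 1 \<in> ball q (\<rho>/2)" for u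
      using k(3)[OF that(1)] that(2) by (auto simp: X1 dist_norm)
    show "Ck_on 1 (\<lambda>y. k (y - q)) (ball q (\<rho>/2))"
    proof (rule Ck_on_1I)
      fix y assume y: "y \<in> ball q (\<rho>/2)"
      have "((\<lambda>y. y - q) has_derivative (\<lambda>v. v)) (at y)"
        by (auto intro!: derivative_eq_intros)
      from has_derivative_compose[OF this K(1)]
      show "((\<lambda>y. k (y - q)) has_derivative K (y - q)) (at y)"
        using y by (auto simp: dist_norm norm_minus_commute)
    next
      show "continuous_on (ball q (\<rho>/2)) (\<lambda>y. K (y - q) u)" for u
        by (rule continuous_on_compose2[OF K(2)])
          (auto intro!: continuous_intros simp: dist_norm norm_minus_commute)
    qed
  qed (rule derX derW; assumption)+
qed

section \<open>Convexity of balls, uniform radii and uniqueness of solutions\<close>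

lemma mvt_unit_subinterval:
  fixes \<phi> \<phi>' :: "real \<Rightarrow> real"
  assumes "\<And>s. s \<in> {0..1} \<Longrightarrow> (\<phi> has_derivative (\<lambda>k. k * \<phi>' s)) (at s within {0..1})"
    and ab: "0 \<le> a" "a < b" "b \<le> 1"
  obtains z where "z \<in> {a<..<b}" "\<phi> b - \<phi> a = (b - a) * \<phi>' z"
proof -
  have "(\<phi> has_derivative (\<lambda>k. k * \<phi>' s)) (at s within {a..b})" if "a \<le> s" "s \<le> b" for s
    using assms(1)[of s] that ab by (auto intro: has_derivative_subset)
  from mvt_simple[OF ab(2) this] that show thesis by blast
qed

text \<open>The squared distance \<open>h\<close> to \<open>c\<close> has second derivative
  \<open>h2\<close>, nonnegative by Cauchy-Schwarz and \<open>force\<close>. If \<open>h\<close>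
  were larger at \<open>t\<close> than at both ends, its slope \<open>h1\<close> would be positive
  somewhere before \<open>t\<close> and negative somewhere after, although \<open>h1\<close> is
  monotone.\<close>

lemma ball_convex_along_spray:
  fixes x w :: "real \<Rightarrow> 'a::real_inner"
  assumes x: "\<And>t. t \<in> {0..1} \<Longrightarrow> (x has_vector_derivative w t) (at t within {0..1})"
    and w: "\<And>t. t \<in> {0..1} \<Longrightarrow> (w has_vector_derivative w' t) (at t within {0..1})"
    and force: "\<And>t. t \<in> {0..1} \<Longrightarrow> norm (x t - c) * norm (w' t) \<le> (norm (w t))\<^sup>2"
    and ends: "x 0 \<in> ball c r" "x 1 \<in> ball c r" and t: "t \<in> {0..1}"
  shows "x t \<in> ball c r"
proof (rule ccontr)
  define h where "h s = (x s - c) \<bullet> (x s - c)" for s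
  define h1 where "h1 s = 2 * ((x s - c) \<bullet> w s)" for s
  define h2 where "h2 s = 2 * ((x s - c) \<bullet> w' s + w s \<bullet> w s)" for s
  have dh: "(h has_derivative (\<lambda>k. k * h1 s)) (at s within {0..1})" if "s \<in> {0..1}" for s
    using x[OF that] unfolding h_def h1_def has_vector_derivative_def
    by (auto intro!: derivative_eq_intros simp: fun_eq_iff inner_commute)
  have dh1: "(h1 has_derivative (\<lambda>k. k * h2 s)) (at s within {0..1})" if "s \<in> {0..1}" for s
    using x[OF that] w[OF that] unfolding h1_def h2_def has_vector_derivative_def
    by (auto intro!: derivative_eq_intros simp: fun_eq_iff inner_commute algebra_simps)
  have h2: "h2 s \<ge> 0" if "s \<in> {0..1}" for s
  proof -
    have "- ((x s - c) \<bullet> w' s) \<le> norm (x s - c) * norm (w' s)"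
      using Cauchy_Schwarz_ineq2[of "x s - c" "w' s"] by linarith
    with force[OF that] show ?thesis
      by (simp add: h2_def power2_norm_eq_inner)
  qed
  have mono: "h1 a \<le> h1 b" if ab: "0 \<le> a" "a < b" "b \<le> 1" for a b
  proof -
    obtain z where "z \<in> {a<..<b}" "h1 b - h1 a = (b - a) * h2 z"
      using mvt_unit_subinterval[OF dh1 ab] .
    moreover have "(b - a) * h2 z \<ge> 0"
      using h2[of z] ab \<open>z \<in> {a<..<b}\<close> by (intro mult_nonneg_nonneg) auto
    ultimately show ?thesis by linarith
  qed
  have hlt: "x s \<in> ball c r \<longleftrightarrow> h s < r\<^sup>2 " if "r > 0" for s
    using that power_mono_iff[of r "norm (x s - c)" 2]
    unfolding h_def power2_norm_eq_inner[symmetric] mem_ball dist_norm norm_minus_commute[of c]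
    by (simp add: not_le[symmetric])
  have r: "r > 0" using ends(1) by (metis ball_empty empty_iff linorder_not_le)
  assume "x t \<notin> ball c r"
  then have "\<not> h t < r\<^sup>2" using hlt[OF r, of t] by blast
  moreover have "h 0 < r\<^sup>2" "h 1 < r\<^sup>2" using hlt[OF r] ends by blast+
  ultimately have big: "h t > h 0" "h t > h 1" by linarith+
  then have "t \<noteq> 0" "t \<noteq> 1" by auto
  with t have t01: "0 < t" "t < 1" by auto
  obtain a where a: "a \<in> {0<..<t}" "h t - h 0 = (t - 0) * h1 a"
    using mvt_unit_subinterval[OF dh order.refl t01(1) less_imp_le[OF t01(2)]] .
  obtain b where b: "b \<in> {t<..<1}" "h 1 - h t = (1 - t) * h1 b"
    using mvt_unit_subinterval[OF dh less_imp_le[OF t01(1)] t01(2) order.refl] .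
  have "0 < t * h1 a" using a(2) big by simp
  then have "h1 a > 0" using t01 by (simp add: zero_less_mult_iff)
  moreover have "(1 - t) * h1 b < 0" using b(2) big by simp
  then have "h1 b < 0" using t01 by (simp add: mult_less_0_iff)
  moreover have "h1 a \<le> h1 b" using a(1) b(1) by (intro mono) auto
  ultimately show False by simp
qed

text \<open>By homogeneity of degree two, \<open>f\<close> and its derivative in the last two slots
  vanish at velocity 0. Uniform continuity around the compact set of rest points keeps this
  derivative below 1/8 for small velocities. Scaling from unit vectors bounds \<open>f\<close> by
  \<open>\<bar>K\<bar> * (norm w)\<^sup>2\<close>, and near \<open>x0\<close> the factor
  \<open>norm (x - x0)\<close> compensates for \<open>\<bar>K\<bar>\<close>.\<close>

lemma quadratic_family_uniform_bounds:
  fixes f :: "real \<times> 'a::euclidean_space \<times> 'a \<Rightarrow> 'a"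
  assumes f: "Ck_on 1 f (I \<times> S \<times> UNIV)" and I: "open I" and S: "open S" and J: "compact J" "J \<subseteq> I"
    and x0: "x0 \<in> S"
    and hom: "\<And>\<epsilon> x w s. \<epsilon> \<in> I \<Longrightarrow> x \<in> S \<Longrightarrow> f (\<epsilon>, x, s *\<^sub>R w) = s\<^sup>2 *\<^sub>R f (\<epsilon>, x, w)"
  obtains \<rho> where "\<rho> > 0"
    "\<And>q. q \<in> ball x0 (\<rho>/4) \<Longrightarrow> ball q \<rho> \<subseteq> S"
    "\<And>\<epsilon> q x w \<xi> \<eta>. \<epsilon> \<in> J \<Longrightarrow> q \<in> ball x0 (\<rho>/4) \<Longrightarrow> x \<in> ball q \<rho> \<Longrightarrow> w \<in> ball 0 \<rho> \<Longrightarrow>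
       norm (frechet_derivative f (at (\<epsilon>, x, w)) (0, \<xi>, \<eta>)) \<le> 1/8 * (norm \<xi> + norm \<eta>)"
    "\<And>\<epsilon> q x w. \<epsilon> \<in> J \<Longrightarrow> q \<in> ball x0 (\<rho>/4) \<Longrightarrow> x \<in> ball q \<rho> \<Longrightarrow>
       norm (x - x0) * norm (f (\<epsilon>, x, w)) \<le> (norm w)\<^sup>2"
proof -
  have f0: "f (\<epsilon>, x, 0) = 0" if "\<epsilon> \<in> I" "x \<in> S" for \<epsilon> x
    using hom[OF that, of 0 0] by simp
  obtain R where R: "R > 0" "cball x0 R \<subseteq> S"
    using S x0 open_contains_cball by blast
  have "continuous_on (J \<times> cball x0 R \<times> cball 0 1) f"
    by (rule continuous_on_subset[OF Ck_on_1_imp_continuous_on[OF f]]) (use J R in auto)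
  moreover have "compact (J \<times> cball x0 R \<times> cball (0::'a) 1)"
    using J by (intro compact_Times compact_cball)
  ultimately have "bounded (f ` (J \<times> cball x0 R \<times> cball 0 1))"
    by (intro compact_imp_bounded compact_continuous_image)
  then obtain K where K: "\<forall>y\<in>f ` (J \<times> cball x0 R \<times> cball 0 1). norm y \<le> K"
    unfolding bounded_iff by blast
  have Kf: "norm (f (\<epsilon>, x, w)) \<le> \<bar>K\<bar> * (norm w)\<^sup>2" if "\<epsilon> \<in> J" "x \<in> cball x0 R" for \<epsilon> x w
  proof (cases "w = 0")
    case True
    have "f (\<epsilon>, x, 0) = 0" using that J R by (intro f0) auto
    with True show ?thesis by simp
  next
    case False
    have "f (\<epsilon>, x, w) = (norm w)\<^sup>2 *\<^sub>R f (\<epsilon>, x, w /\<^sub>R norm w)"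
    proof -
      have "\<epsilon> \<in> I" "x \<in> S" using that J R by auto
      from hom[OF this, of "norm w" "w /\<^sub>R norm w"] show ?thesis using False by simp
    qed
    moreover have "norm (f (\<epsilon>, x, w /\<^sub>R norm w)) \<le> \<bar>K\<bar>"
    proof -
      have "f (\<epsilon>, x, w /\<^sub>R norm w) \<in> f ` (J \<times> cball x0 R \<times> cball 0 1)"
        using that False by (intro imageI) auto
      then show ?thesis using K by force
    qed
    ultimately show ?thesis
      by (simp add: mult.commute[of "\<bar>K\<bar>"] mult_left_mono)
  qed
  have "compact (J \<times> cball x0 R \<times> {0::'a})" "J \<times> cball x0 R \<times> {0} \<subseteq> I \<times> S \<times> (UNIV::'a set)"
    using J R by (auto intro!: compact_Times compact_cball)
  note unif = Ck_on_1_uniform_derivative[OF f open_Times[OF I open_Times[OF S open_UNIV]] this]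
  have eighth: "(0::real) < 1/8" by simp
  obtain d where d: "d > 0" 
    "\<And>k y u. k \<in> J \<times> cball x0 R \<times> {0} \<Longrightarrow> y \<in> ball k d \<Longrightarrow>
       norm (frechet_derivative f (at y) u - frechet_derivative f (at k) u) \<le> 1/8 * norm u"
    by (rule unif[OF eighth]) (rule that; assumption)
  have zero: "frechet_derivative f (at (\<epsilon>, x, 0)) (0, \<xi>, \<eta>) = 0" if "\<epsilon> \<in> J"
      "x \<in> cball x0 R" for \<epsilon> x \<xi> \<eta>
  proof -
    have inS: "\<epsilon> \<in> I" "x \<in> S" using that J R by auto
    let ?D = "frechet_derivative f (at (\<epsilon>, x, 0))"
    have D: "(f has_derivative ?D) (at (\<epsilon>, x, 0))"
      using inS by (intro Ck_on_1_has_derivative[OF f]) auto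
    interpret linear ?D
      using inS by (intro Ck_on_1_linear_derivative[OF f]) auto
    have 1: "?D (0, \<xi>, 0) = 0"
    proof -
      have "((\<lambda>y. (\<epsilon>, y, 0::'a)) has_derivative (\<lambda>v. (0, v, 0))) (at x)"
        by (auto intro!: derivative_eq_intros)
      from has_derivative_compose[OF this D]
      have "((\<lambda>y. f (\<epsilon>, y, 0)) has_derivative (\<lambda>v. ?D (0, v, 0))) (at x)" .
      moreover have "((\<lambda>y. f (\<epsilon>, y, 0)) has_derivative (\<lambda>v. 0)) (at x)"
        by (rule has_derivative_transform_within_open[OF has_derivative_const S inS(2), of 0])
          (simp add: f0 inS)
      ultimately show ?thesis
        using has_derivative_unique by metis
    qed
    \<comment> \<open>Along the line in direction \<open>\<eta>\<close> the function is a constant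
      times the square of the line parameter, so its derivative at velocity 0 vanishes.\<close>
    have 2: "?D (0, 0, \<eta>) = 0"
    proof -
      have "((\<lambda>s. (\<epsilon>, x, s *\<^sub>R \<eta>)) has_derivative (\<lambda>s. (0, 0, s *\<^sub>R \<eta>))) (at (0::real))"
        by (auto intro!: derivative_eq_intros)
      moreover have "(f has_derivative ?D) (at (\<epsilon>, x, (0::real) *\<^sub>R \<eta>))"
        using D by simp
      ultimately have "((\<lambda>s. f (\<epsilon>, x, s *\<^sub>R \<eta>)) has_derivative (\<lambda>s. ?D (0, 0, s *\<^sub>R \<eta>))) (at 0)"
        by (rule has_derivative_compose)
      moreover have "((\<lambda>s::real. s\<^sup>2 *\<^sub>R f (\<epsilon>, x, \<eta>)) has_derivative (\<lambda>s. 0)) (at 0)"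
        by (auto intro!: derivative_eq_intros)
      ultimately have "(\<lambda>s. ?D (0, 0, s *\<^sub>R \<eta>)) = (\<lambda>s::real. 0)"
        using has_derivative_unique by (simp add: hom[OF inS])
      from fun_cong[OF this, of 1] show ?thesis by simp
    qed
    show ?thesis
      using add[of "(0, \<xi>, 0)" "(0, 0, \<eta>)"] 1 2 by simp
  qed
  \<comment> \<open>\<open>R'\<close> is made for \<open>R' * \<bar>K\<bar> \<le> 1\<close>, with a
    summand 1 in case \<open>K = 0\<close>. Since \<open>\<rho> \<le> R'/2\<close>, a point closer
    than \<open>\<rho>\<close> to some \<open>q\<close> in the ball of radius
    \<open>\<rho>/4\<close> is closer than \<open>5/8 * R'\<close> to \<open>x0\<close>.\<close>
  define R' where "R' = min R (1 / (\<bar>K\<bar> + 1))"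
  define \<rho> where "\<rho> = min (R'/2) d"
  have R': "R' > 0" "R' \<le> R" "R' * \<bar>K\<bar> \<le> 1"
  proof -
    show "R' > 0" "R' \<le> R" using R by (auto simp: R'_def)
    have "R' * \<bar>K\<bar> \<le> (1 / (\<bar>K\<bar> + 1)) * \<bar>K\<bar>"
      by (intro mult_right_mono) (auto simp: R'_def)
    also have "\<dots> \<le> 1" by simp
    finally show "R' * \<bar>K\<bar> \<le> 1" .
  qed
  have \<rho>: "\<rho> > 0" "\<rho> \<le> R'/2" "\<rho> \<le> d" using R' d by (auto simp: \<rho>_def)
  have near: "x \<in> ball x0 R'" if "q \<in> ball x0 (\<rho>/4)" "x \<in> ball q \<rho>" for q x
    using that \<rho> dist_triangle[of x0 x q] by auto
  show thesis
  proof (rule that[OF \<rho>(1)])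
    show "ball q \<rho> \<subseteq> S" if "q \<in> ball x0 (\<rho>/4)" for q
      using near[OF that] R' R by force
    show "norm (frechet_derivative f (at (\<epsilon>, x, w)) (0, \<xi>, \<eta>)) \<le> 1/8 * (norm \<xi> + norm \<eta>)"
      if "\<epsilon> \<in> J" "q \<in> ball x0 (\<rho>/4)" "x \<in> ball q \<rho>" "w \<in> ball 0 \<rho>" for \<epsilon> q x w \<xi> \<eta>
    proof -
      have x: "x \<in> cball x0 R" using near[OF that(2,3)] R' by auto
      have "norm (frechet_derivative f (at (\<epsilon>, x, w)) (0, \<xi>, \<eta>)
          - frechet_derivative f (at (\<epsilon>, x, 0)) (0, \<xi>, \<eta>)) \<le> 1/8 * norm (0::real, \<xi>, \<eta>)"
        using that x \<rho> by (intro d) (auto simp: dist_Pair_Pair)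
      also have "\<dots> \<le> 1/8 * (norm \<xi> + norm \<eta>)"
        using norm_Pair_le[of \<xi> \<eta>] by simp
      finally show ?thesis
        using zero[OF that(1) x] by simp
    qed
    show "norm (x - x0) * norm (f (\<epsilon>, x, w)) \<le> (norm w)\<^sup>2"
      if "\<epsilon> \<in> J" "q \<in> ball x0 (\<rho>/4)" "x \<in> ball q \<rho>" for \<epsilon> q x w
    proof -
      have x: "x \<in> ball x0 R'" using near[OF that(2,3)] .
      then have "norm (x - x0) * norm (f (\<epsilon>, x, w)) \<le> R' * (\<bar>K\<bar> * (norm w)\<^sup>2)"
        using R' that by (intro mult_mono Kf) (auto simp: dist_norm norm_minus_commute)
      also have "\<dots> \<le> 1 * (norm w)\<^sup>2"
        unfolding mult.assoc[symmetric] using R' by (intro mult_right_mono) auto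
      finally show ?thesis by simp
    qed
  qed
qed

text \<open>At times within \<open>d\<close> of \<open>t0\<close>, where \<open>d * L < 1\<close>,
  the largest difference \<open>m\<close> of two solutions satisfies
  \<open>m \<le> L * m * d\<close> and is therefore 0. Derivatives are taken within the convex set
  \<open>I\<close>, so the ends of a closed time interval are covered.\<close>

lemma ode_local_uniqueness:
  fixes f :: "'a::euclidean_space \<Rightarrow> 'a"
  assumes f: "Ck_on 1 f S" and S: "open S" and t0: "t0 \<in> I" and I: "convex I"
    and c: "continuous_on I z1" "continuous_on I z2"
    and z0: "z1 t0 = z2 t0" "z1 t0 \<in> S" and T: "e > 0"
    and z1: "\<And>t. t \<in> I \<Longrightarrow> \<bar>t - t0\<bar> < e \<Longrightarrow> (z1 has_vector_derivative f (z1 t)) (at t within I)"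
    and z2: "\<And>t. t \<in> I \<Longrightarrow> \<bar>t - t0\<bar> < e \<Longrightarrow> (z2 has_vector_derivative f (z2 t)) (at t within I)"
  obtains d where "d > 0" "\<And>t. t \<in> I \<Longrightarrow> \<bar>t - t0\<bar> < d \<Longrightarrow> z1 t = z2 t"
proof -
  obtain r L where r: "r > 0" and L: "L-lipschitz_on (ball (z1 t0) r) f"
    using Ck_on_1_locally_lipschitz[OF f S z0(2)] by blast
  have "\<forall>\<^sub>F t in at t0 within I. dist (z1 t) (z1 t0) < r"
      "\<forall>\<^sub>F t in at t0 within I. dist (z2 t) (z2 t0) < r"
    using c t0 r by (auto simp: continuous_on tendsto_iff)
  then obtain d1 d2 where d1: "d1 > 0" "\<And>t. t \<in> I \<Longrightarrow> t \<noteq> t0 \<Longrightarrow> dist t t0 < d1 \<Longrightarrow>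
      dist (z1 t) (z1 t0) < r"
    and d2: "d2 > 0" "\<And>t. t \<in> I \<Longrightarrow> t \<noteq> t0 \<Longrightarrow> dist t t0 < d2 \<Longrightarrow> dist (z2 t) (z2 t0) < r"
    unfolding eventually_at by blast
  have L0: "L \<ge> 0" using lipschitz_on_nonneg[OF L] .
  define d where "d = min (min d1 d2) (min e (1 / (L + 1)))"
  have d: "d > 0" "d \<le> d1" "d \<le> d2" "d \<le> e" "d * L < 1"
  proof -
    show "d > 0" "d \<le> d1" "d \<le> d2" "d \<le> e" using d1 d2 T L0 by (auto simp: d_def)
    have "d * L \<le> 1 / (L + 1) * L"
      using L0 by (intro mult_right_mono) (auto simp: d_def)
    also have "\<dots> < 1" using L0 by simp
    finally show "d * L < 1" .
  qed
  have inb: "z1 t \<in> ball (z1 t0) r" "z2 t \<in> ball (z1 t0) r" if "t \<in> I" "\<bar>t - t0\<bar> < d" for t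
    using d1(2)[of t] d2(2)[of t] that d r z0 by (cases
        "t = t0"; force simp: dist_real_def dist_commute)+
  have "z1 t = z2 t" if t: "t \<in> I" "\<bar>t - t0\<bar> < d" for t
  proof -
    \<comment> \<open>On the compact segment between the two times the difference attains its
      maximum.\<close>
    define J where "J = closed_segment t0 t"
    have JI: "J \<subseteq> I"
      using closed_segment_subset[OF t0 t(1) I] by (simp add: J_def)
    have Jd: "\<bar>s - t0\<bar> < d" if "s \<in> J" for s
      using that t(2) by (auto simp: J_def closed_segment_eq_real_ivl split: if_splits)
    have "continuous_on J (\<lambda>s. norm (z1 s - z2 s))"
      by (intro continuous_intros continuous_on_subset[OF c(1) JI] continuous_on_subset[OF c(2) JI])
    then obtain s where s: "s \<in> J" "\<And>s'. s' \<in> J \<Longrightarrow> norm (z1 s' - z2 s') \<le> norm (z1 s - z2 s)"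
      using continuous_attains_sup[of J "\<lambda>s. norm (z1 s - z2 s)"] by (auto simp: J_def)
    define m where "m = norm (z1 s - z2 s)"
    have t0J: "t0 \<in> J" by (simp add: J_def)
    have "norm ((z1 s - z2 s) - (z1 t0 - z2 t0)) \<le> (L * m) * norm (s - t0)"
    proof (rule differentiable_bound[where S = J and f = "\<lambda>s. z1 s - z2 s"])
      show "convex J" by (simp add: J_def)
      show "((\<lambda>s. z1 s - z2 s) has_derivative (\<lambda>h. h *\<^sub>R (f (z1 x) - f (z2 x)))) (at x within J)"
        if "x \<in> J" for x
      proof -
        have "x \<in> I" "\<bar>x - t0\<bar> < e" using that JI Jd[OF that] d by auto
        from has_vector_derivative_diff[OF z1[OF this] z2[OF this]]
        show ?thesis
          unfolding has_vector_derivative_def by (rule has_derivative_subset[OF _ JI])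
      qed
      show "onorm (\<lambda>h::real. h *\<^sub>R (f (z1 x) - f (z2 x))) \<le> L * m" if "x \<in> J" for x
      proof (rule onorm_bound)
        have "norm (f (z1 x) - f (z2 x)) \<le> L * norm (z1 x - z2 x)"
          using lipschitz_onD[OF L inb] JI Jd[OF that] that by (auto simp: dist_norm)
        also have "\<dots> \<le> L * m"
          using s(2)[OF that] L0 by (auto simp: m_def intro!: mult_left_mono)
        finally show "norm (h *\<^sub>R (f (z1 x) - f (z2 x))) \<le> L * m * norm h" for h :: real
          by (simp add: mult.commute mult_left_mono)
        show "0 \<le> L * m" using L0 by (simp add: m_def)
      qed
    qed (fact s(1) t0J)+
    then have "m \<le> (L * m) * \<bar>s - t0\<bar>"
      by (simp add: m_def z0)
    also have "\<dots> \<le> (L * m) * d"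
      using Jd[OF s(1)] L0 by (intro mult_left_mono) (auto simp: m_def)
    finally have "m * (1 - d * L) \<le> 0" by (simp add: algebra_simps)
    then have "m \<le> 0" using d(5) by (simp add: mult_le_0_iff)
    moreover have "norm (z1 t - z2 t) \<le> m"
      using s(2)[of t] by (simp add: J_def m_def)
    ultimately show ?thesis
      by (metis norm_le_zero_iff order_trans right_minus_eq)
  qed
  with d(1) show thesis by (rule that)
qed

section \<open>Charts, tangent vectors and metric matrices\<close>

abbreviation transition :: "('m, 'n::finite) chart \<Rightarrow> ('m, 'n) chart \<Rightarrow> real^'n \<Rightarrow> real^'n" where
  "transition c d \<equiv> snd d \<circ> chart_inv c"

abbreviation transition_deriv :: "('m, 'n::finite) chart \<Rightarrow> ('m, 'n) chart \<Rightarrow> real^'n \<Rightarrow> real^'n \<Rightarrow>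
    real^'n" where
  "transition_deriv c d x \<equiv> frechet_derivative (transition c d) (at x)"

context
  fixes A :: "('m::{t2_space,second_countable_topology}, 'n::finite) chart set"
  assumes A: "smooth_atlas A"
begin

lemma chart_homeomorphism:
  "c \<in> A \<Longrightarrow> homeomorphism (fst c) (snd c ` fst c) (snd c) (chart_inv c)"
  and open_chart_domain: "c \<in> A \<Longrightarrow> open (fst c)"
  and open_chart_image: "c \<in> A \<Longrightarrow> open (snd c ` fst c)"
  using A by (auto simp: smooth_atlas_def)

lemma chart_at_exists: "\<exists>c. c \<in> charts_at A p"
proof -
  have "p \<in> (\<Union>c\<in>A. fst c)"
    using A unfolding smooth_atlas_def by simp
  then show ?thesis
    unfolding charts_at_def by blast
qed

lemma chart_inv_chart: "c \<in> A \<Longrightarrow> p \<in> fst c \<Longrightarrow> chart_inv c (snd c p) = p"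
  using chart_homeomorphism by (blast dest: homeomorphism_apply1)

lemma chart_chart_inv: "c \<in> A \<Longrightarrow> x \<in> snd c ` fst c \<Longrightarrow> snd c (chart_inv c x) = x"
  using chart_homeomorphism by (blast dest: homeomorphism_apply2)

lemma chart_inv_mem: "c \<in> A \<Longrightarrow> x \<in> snd c ` fst c \<Longrightarrow> chart_inv c x \<in> fst c"
  by (auto simp: chart_inv_chart)

lemma continuous_on_chart_inv: "c \<in> A \<Longrightarrow> continuous_on (snd c ` fst c) (chart_inv c)"
  using chart_homeomorphism by (auto simp: homeomorphism_def)

lemma open_chart_image_subset:
  assumes "c \<in> A" "open V" "V \<subseteq> fst c"
  shows "open (snd c ` V)"
proof -
  have "openin (top_of_set (snd c ` fst c)) (snd c ` V)"
    using assms by (intro homeomorphism_imp_open_map[OF chart_homeomorphism])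
        (auto simp: openin_open_eq open_chart_domain)
  then show ?thesis
    using open_chart_image[OF assms(1)] openin_open_trans by blast
qed

lemma open_chart_inv_image:
  assumes "c \<in> A" "open V" "V \<subseteq> snd c ` fst c"
  shows "open (chart_inv c ` V)"
proof -
  have "openin (top_of_set (fst c)) (chart_inv c ` V)"
    using assms homeomorphism_symD[OF chart_homeomorphism]
    by (intro homeomorphism_imp_open_map[where g = "snd c" and T = "fst c" and S = "snd c ` fst c"])
       (auto simp: openin_open_eq open_chart_image)
  then show ?thesis
    using open_chart_domain[OF assms(1)] openin_open_trans by blast
qed

lemma open_overlap: "c \<in> A \<Longrightarrow> d \<in> A \<Longrightarrow> open (snd c ` (fst c \<inter> fst d))"
  by (intro open_chart_image_subset) (auto simp: open_chart_domain)

lemma transition_smooth: "c \<in> A \<Longrightarrow> d \<in> A \<Longrightarrow> Ck_on k (transition c d) (snd c ` (fst c \<inter> fst d))"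
  using A by (auto simp: smooth_atlas_def smooth_on_def)

lemma transition_has_derivative:
  assumes "c \<in> A" "d \<in> A" "p \<in> fst c" "p \<in> fst d"
  shows "(transition c d has_derivative transition_deriv c d (snd c p)) (at (snd c p))"
  by (rule Ck_on_1_has_derivative[OF transition_smooth]) (use assms in auto)

lemma linear_transition_deriv:
  assumes "c \<in> A" "d \<in> A" "p \<in> fst c" "p \<in> fst d"
  shows "linear (transition_deriv c d (snd c p))"
  using transition_has_derivative[OF assms] by (rule has_derivative_linear)

text \<open>The cocycle identity of the differentials. The composition law of transition maps holds
  on an open overlap, so the chain rule applies at the point. It is the reason why
  \<open>coord_vec\<close> produces a consistent family, that is, a tangent vector.\<close>

lemma transition_deriv_chain:
  assumes "c \<in> A" "d \<in> A" "e \<in> A" "p \<in> fst c" "p \<in> fst d" "p \<in> fst e"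
  shows "transition_deriv d e (snd d p) (transition_deriv c d (snd c p) u)
      = transition_deriv c e (snd c p) u"
proof -
  have "(transition d e has_derivative transition_deriv d e (snd d p))
      (at (transition c d (snd c p)))"
    using transition_has_derivative[of d e p] assms by (simp add: chart_inv_chart)
  from has_derivative_compose[OF transition_has_derivative[of c d p] this]
  have "((\<lambda>x. transition d e (transition c d x)) has_derivative
     (\<lambda>u. transition_deriv d e (snd d p) (transition_deriv c d (snd c p) u))) (at (snd c p))"
    using assms by simp
  then have "(transition c e has_derivative
     (\<lambda>u. transition_deriv d e (snd d p) (transition_deriv c d (snd c p) u))) (at (snd c p))"
  proof (rule has_derivative_transform_within_open)
    show "open (snd c ` (fst c \<inter> fst d))" using assms by (intro open_overlap)
    show "snd c p \<in> snd c ` (fst c \<inter> fst d)" using assms by auto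
    show "transition d e (transition c d x) = transition c e x" if "x \<in> snd c ` (fst c \<inter> fst d)"
        for x
      using that assms by (auto simp: chart_inv_chart)
  qed
  then show ?thesis
    using frechet_derivative_at by metis
qed

lemma transition_deriv_id:
  assumes "c \<in> A" "p \<in> fst c"
  shows "transition_deriv c c (snd c p) u = u"
proof -
  have "(transition c c has_derivative (\<lambda>u. u)) (at (snd c p))"
    by (rule has_derivative_transform_within_open[OF has_derivative_ident
        open_chart_image[OF assms(1)]])
      (use assms in \<open>auto simp: chart_inv_chart\<close>)
  then show ?thesis
    using frechet_derivative_at by metis
qed

lemma coord_vec_same: "c \<in> charts_at A p \<Longrightarrow> coord_vec A c p u c = u"
  by (simp add: coord_vec_def charts_at_def transition_deriv_id)

lemma coord_vec_in_tangent_space: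
  "c \<in> charts_at A p \<Longrightarrow> coord_vec A c p u \<in> tangent_space A p"
  unfolding tangent_space_def coord_vec_def charts_at_def
  by (intro CollectI conjI ballI allI impI) (simp_all only: mem_Collect_eq if_True if_False
      simp_thms transition_deriv_chain)

lemma coord_vec_of_tangent:
  assumes "v \<in> tangent_space A p" "c \<in> charts_at A p"
  shows "coord_vec A c p (v c) = v"
proof
  fix d
  have "d \<in> charts_at A p \<Longrightarrow> v d = transition_deriv c d (snd c p) (v c)" "d \<notin> charts_at A p \<Longrightarrow>
      v d = 0"
    using assms unfolding tangent_space_def by blast+
  then show "coord_vec A c p (v c) d = v d"
    unfolding coord_vec_def by presburger
qed

lemma coord_vec_change:
  assumes "c \<in> charts_at A p" "d \<in> charts_at A p"
  shows "coord_vec A c p u = coord_vec A d p (transition_deriv c d (snd c p) u)"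
proof
  fix e
  show "coord_vec A c p u e = coord_vec A d p (transition_deriv c d (snd c p) u) e"
    using assms transition_deriv_chain[of c d e p u] by (simp add: coord_vec_def charts_at_def)
qed

lemma coord_vec_linear_combination:
  assumes "c \<in> charts_at A p"
  shows "coord_vec A c p (r *\<^sub>R u + s *\<^sub>R v) = (\<lambda>d. r *\<^sub>R coord_vec A c p u d
      + s *\<^sub>R coord_vec A c p v d)"
proof
  fix d
  show "coord_vec A c p (r *\<^sub>R u + s *\<^sub>R v) d = r *\<^sub>R coord_vec A c p u d
      + s *\<^sub>R coord_vec A c p v d"
  proof (cases "d \<in> charts_at A p")
    case True
    then interpret linear "transition_deriv c d (snd c p)"
      using assms by (intro linear_transition_deriv) (auto simp: charts_at_def)
    show ?thesis using True by (simp add: coord_vec_def add scale)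
  qed (simp add: coord_vec_def)
qed

lemma coord_vec_zero: "c \<in> charts_at A p \<Longrightarrow> coord_vec A c p 0 = (\<lambda>d. 0)"
  using coord_vec_linear_combination[of c p 0 0 0 0] by simp

lemma coord_vec_scaleR: "c \<in> charts_at A p \<Longrightarrow> coord_vec A c p (r *\<^sub>R u)
    = (\<lambda>d. r *\<^sub>R coord_vec A c p u d)"
  using coord_vec_linear_combination[of c p r u 0 0] by simp

end

section \<open>Bilinear forms of metric matrices\<close>

definition mform :: "real^'n^'n \<Rightarrow> real^'n \<Rightarrow> real^'n \<Rightarrow> real" where
  "mform G u v = (\<Sum>i\<in>UNIV. \<Sum>j\<in>UNIV. u $ i * v $ j * G $ i $ j)"

lemma mform_eq_inner: "mform G u v = u \<bullet> (G *v v)"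
  by (simp add: mform_def inner_vec_def matrix_vector_mult_def sum_distrib_left mult_ac)

lemma mform_add_left: "mform G (u + v) w = mform G u w + mform G v w"
  by (simp add: mform_eq_inner inner_add_left)

lemma mform_diff_left: "mform G (u - v) w = mform G u w - mform G v w"
  by (simp add: mform_eq_inner inner_diff_left)

lemma vec_sum_axis: "(u::real^'n) = (\<Sum>i\<in>UNIV. u $ i *\<^sub>R axis i 1)"
  by (simp add: vec_eq_iff axis_def if_distrib cong: if_cong)

context
  fixes A :: "('m::{t2_space,second_countable_topology}, 'n::finite) chart set"
    and h :: "('m, 'n) metric"
  assumes A: "smooth_atlas A" and h: "pseudo_Riemannian A h"
begin

lemma metric_linear_left:
  assumes c: "c \<in> charts_at A p" and w: "w \<in> tangent_space A p"
  shows "linear (\<lambda>u. h p (coord_vec A c p u) w)"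
proof -
  have eq: "h p (coord_vec A c p (r *\<^sub>R u + s *\<^sub>R v)) w = r * h p (coord_vec A c p u) w
      + s * h p (coord_vec A c p v) w"
    for r s u v
    using h coord_vec_in_tangent_space[OF A c] w
    unfolding coord_vec_linear_combination[OF A c] pseudo_Riemannian_def Let_def by blast
  show ?thesis
  proof (rule linearI)
    show "h p (coord_vec A c p (u + v)) w = h p (coord_vec A c p u) w + h p (coord_vec A c p v) w"
        for u v
      using eq[of 1 u 1 v] by simp
    show "h p (coord_vec A c p (r *\<^sub>R u)) w = r *\<^sub>R h p (coord_vec A c p u) w" for r u
      using eq[of r u 0 0] by simp
  qed
qed

lemma metric_sym:
  "v \<in> tangent_space A p \<Longrightarrow> w \<in> tangent_space A p \<Longrightarrow> h p v w = h p w v"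
  using h unfolding pseudo_Riemannian_def Let_def by blast

lemma mform_metric_matrix:
  assumes c: "c \<in> A" "p \<in> fst c"
  shows "mform (metric_matrix A h c (snd c p)) u v = h p (coord_vec A c p u) (coord_vec A c p v)"
proof -
  have c': "c \<in> charts_at A p" using c by (simp add: charts_at_def)
  note T = coord_vec_in_tangent_space[OF A c']
  let ?B = "\<lambda>u v. h p (coord_vec A c p u) (coord_vec A c p v)"
  interpret L: linear "\<lambda>u. ?B u w" for w
    by (rule metric_linear_left[OF c' T])
  \<comment> \<open>Linearity of the metric is given in the first slot; the second slot is expanded
    by passing through symmetry.\<close>
  have right: "?B u v = (\<Sum>j\<in>UNIV. v $ j * ?B u (axis j 1))" for u v
  proof -
    have "?B u v = ?B v u" by (rule metric_sym[OF T T])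
    also have "\<dots> = ?B (\<Sum>j\<in>UNIV. v $ j *\<^sub>R axis j 1) u" by (subst vec_sum_axis[of v]) simp
    also have "\<dots> = (\<Sum>j\<in>UNIV. v $ j * ?B (axis j 1) u)"
      by (simp add: L.sum L.scale)
    also have "\<dots> = (\<Sum>j\<in>UNIV. v $ j * ?B u (axis j 1))"
      by (intro sum.cong refl arg_cong2[where f = "(*)"] metric_sym T)
    finally show ?thesis .
  qed
  have "?B u v = ?B (\<Sum>i\<in>UNIV. u $ i *\<^sub>R axis i 1) v" by (subst vec_sum_axis[of u]) simp
  also have "\<dots> = (\<Sum>i\<in>UNIV. u $ i * ?B (axis i 1) v)"
    by (simp add: L.sum L.scale)
  also have "\<dots> = (\<Sum>i\<in>UNIV. \<Sum>j\<in>UNIV. u $ i * v $ j * ?B (axis i 1) (axis j 1))"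
    by (subst right) (simp add: sum_distrib_left mult_ac)
  also have "\<dots> = mform (metric_matrix A h c (snd c p)) u v"
    by (simp add: mform_def metric_matrix_def Let_def chart_inv_chart[OF A c])
  finally show ?thesis by simp
qed

lemma mform_metric_sym:
  assumes "c \<in> A" "p \<in> fst c"
  shows "mform (metric_matrix A h c (snd c p)) u v = mform (metric_matrix A h c (snd c p)) v u"
  using assms by (simp add: mform_metric_matrix metric_sym coord_vec_in_tangent_space[OF A]
      charts_at_def)

lemma mform_metric_nondegenerate:
  assumes c: "c \<in> A" "p \<in> fst c" and z: "\<And>v. mform (metric_matrix A h c (snd c p)) u v = 0"
  shows "u = 0"
proof -
  have c': "c \<in> charts_at A p" using c by (simp add: charts_at_def)
  note T = coord_vec_in_tangent_space[OF A c']
  have "h p (coord_vec A c p u) w = 0" if "w \<in> tangent_space A p" for w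
    using z[of "w c"] coord_vec_of_tangent[OF A that c'] by (simp add: mform_metric_matrix[OF c])
  then have "coord_vec A c p u = (\<lambda>d. 0)"
    using h T[of u] unfolding pseudo_Riemannian_def Let_def by blast
  then show ?thesis
    using coord_vec_same[OF A c', of u] by simp
qed

lemma mform_metric_transition:
  assumes c: "c \<in> A" "p \<in> fst c" and d: "d \<in> A" "p \<in> fst d"
  shows "mform (metric_matrix A h c (snd c p)) u v
    = mform (metric_matrix A h d (snd d p)) (transition_deriv c d (snd c p) u)
        (transition_deriv c d (snd c p) v)"
  using c d coord_vec_change[OF A, of c p d] by (simp add: mform_metric_matrix charts_at_def)

lemma det_metric_matrix_nonzero:
  assumes c: "c \<in> A" "p \<in> fst c"
  shows "det (metric_matrix A h c (snd c p)) \<noteq> 0"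
proof -
  let ?G = "metric_matrix A h c (snd c p)"
  have "v = 0" if "?G *v v = 0" for v
  proof (rule mform_metric_nondegenerate[OF c])
    show "mform ?G v u = 0" for u
      using that by (subst mform_metric_sym[OF c]) (simp add: mform_eq_inner)
  qed
  then show ?thesis
    by (simp add: invertible_det_nz[symmetric] invertible_left_inverse matrix_left_invertible_ker)
qed

lemma metric_matrix_inv:
  assumes "c \<in> A" "p \<in> fst c"
  shows "metric_matrix A h c (snd c p) ** matrix_inv (metric_matrix A h c (snd c p)) = mat 1"
proof -
  have "\<exists>B. metric_matrix A h c (snd c p) ** B = mat 1 \<and> B ** metric_matrix A h c (snd c p) = mat 1"
    using det_metric_matrix_nonzero[OF assms] by (simp add: invertible_det_nz[symmetric]
        invertible_def)
  from someI_ex[OF this] show ?thesis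
    unfolding matrix_inv_def by blast
qed

end

text \<open>Column \<open>l\<close> of the inverse solves a linear system with right-hand side
  \<open>axis l 1\<close>, so Cramer's rule makes the entries of the inverse rational functions of
  the entries of \<open>G\<close>. This carries differentiability from the metric over to its
  inverse.\<close>

lemma matrix_inv_cramer:
  fixes G :: "real^'n^'n"
  assumes "det G \<noteq> 0"
  shows "matrix_inv G $ k $ l = det (\<chi> i j. if j = k then (if i = l then 1 else 0) else G $ i $ j) /
      det G"
proof -
  have "\<exists>B. G ** B = mat 1 \<and> B ** G = mat 1"
    using assms by (simp add: invertible_det_nz[symmetric] invertible_def)
  from someI_ex[OF this] have "G ** matrix_inv G = mat 1"
    unfolding matrix_inv_def by blast
  then have "G *v (matrix_inv G *v axis l 1) = axis l 1"
    by (simp add: matrix_vector_mul_assoc)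
  then have "matrix_inv G *v axis l 1 = (\<chi> k. det (\<chi> i j. if j = k then axis l 1 $ i else G $ i $ j)
      / det G)"
    using cramer[OF assms] by blast
  then have "(matrix_inv G *v axis l 1) $ k = det (\<chi> i j. if j = k then axis l 1 $ i else G $ i $ j)
      / det G"
    by simp
  moreover have "(matrix_inv G *v axis l 1) $ k = matrix_inv G $ k $ l"
    by (simp add: matrix_vector_mult_basis column_def)
  moreover have "axis l (1::real) $ i = (if i = l then 1 else 0)" for i
    by (simp add: axis_def)
  ultimately show ?thesis by (simp cong: if_cong)
qed

section \<open>The geodesic spray\<close>

text \<open>The acceleration that the geodesic equation prescribes at a point of phase space: the
  vertical part of the geodesic vector field in coordinates.\<close>

definition spray :: "('m, 'n::finite) chart set \<Rightarrow> ('m, 'n) metric \<Rightarrow> ('m, 'n) chart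
    \<Rightarrow> (real^'n) \<times> (real^'n) \<Rightarrow> real^'n" where
  "spray A h c z = (\<chi> k. - (\<Sum>i\<in>UNIV. \<Sum>j\<in>UNIV. christoffel A h c (fst z) k i j * snd z $ i * snd z $
      j))"

text \<open>The derivative of \<open>G\<close> in direction \<open>a\<close>, as a bilinear form in
  the fixed vectors \<open>u\<close> and \<open>v\<close>.\<close>

definition dmetric :: "(real^'n \<Rightarrow> real^'n^'n) \<Rightarrow> real^'n \<Rightarrow> real^'n \<Rightarrow> real^'n \<Rightarrow> real^'n \<Rightarrow> real" where
  "dmetric G x a u v = (\<Sum>i\<in>UNIV. \<Sum>j\<in>UNIV. u $ i * v $ j * frechet_derivative (\<lambda>y. G y $ i $ j)
      (at x) a)"

lemma frechet_derivative_partials: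
  assumes "f differentiable (at x)"
  shows "frechet_derivative f (at x) a = (\<Sum>l\<in>UNIV. a $ l * partial l f x)"
proof -
  interpret linear "frechet_derivative f (at x)"
    using assms by (rule linear_frechet_derivative)
  have "frechet_derivative f (at x) a = frechet_derivative f (at x) (\<Sum>l\<in>UNIV. a $ l *\<^sub>R axis l 1)"
    by (subst vec_sum_axis[of a]) simp
  then show ?thesis
    by (simp add: sum scale partial_def)
qed

lemma sum_rotate3:
  "(\<Sum>i\<in>A. \<Sum>j\<in>B. \<Sum>l\<in>C. f i j l) = (\<Sum>l\<in>C. \<Sum>i\<in>A. \<Sum>j\<in>B. f i j l)"
proof -
  have "(\<Sum>i\<in>A. \<Sum>j\<in>B. \<Sum>l\<in>C. f i j l) = (\<Sum>i\<in>A. \<Sum>l\<in>C. \<Sum>j\<in>B. f i j l)"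
    by (intro sum.cong refl sum.swap)
  also have "\<dots> = (\<Sum>l\<in>C. \<Sum>i\<in>A. \<Sum>j\<in>B. f i j l)"
    by (rule sum.swap)
  finally show ?thesis .
qed

text \<open>The Euler-Lagrange form of the geodesic equation. Lowering the index cancels the inverse
  matrix, and the first two partial derivatives in the Christoffel symbol contribute equally, being
  contracted with the symmetric product \<open>w $ i * w $ j\<close>.\<close>

lemma mform_spray:
  fixes A :: "('m, 'n::finite) chart set" and h c x
  defines "G \<equiv> metric_matrix A h c"
  assumes diff: "\<And>i j. (\<lambda>y. G y $ i $ j) differentiable (at x)"
    and inv: "G x ** matrix_inv (G x) = mat 1"
  shows "mform (G x) e (spray A h c (x, w)) = 1/2 * dmetric G x e w w - dmetric G x w w e"
proof -
  define P where "P i j l = partial i (\<lambda>y. G y $ j $ l) x" for i j l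
  define M where "M = matrix_inv (G x)"
  \<comment> \<open>The Christoffel symbols of the first kind contracted twice with
    \<open>w\<close>; the spray is \<open>- (M *v z)\<close>.\<close>
  define z :: "real^'n" where "z = (\<chi> l. \<Sum>i\<in>UNIV. \<Sum>j\<in>UNIV. 1/2 * (P i j l + P j i l - P l i j) * w $
      i * w $ j)"
  have "spray A h c (x, w) $ k = (- (M *v z)) $ k" for k
  proof -
    have "spray A h c (x, w) $ k
      = - (\<Sum>i\<in>UNIV. \<Sum>j\<in>UNIV. \<Sum>l\<in>UNIV. M $ k $ l * (1/2 * (P i j l + P j i l - P l i j) * w $ i * w $
          j))"
      by (simp add: spray_def christoffel_def G_def[symmetric] Let_def M_def P_def
          sum_distrib_left sum_distrib_right mult_ac)
    also have "\<dots> = - (\<Sum>l\<in>UNIV. \<Sum>i\<in>UNIV. \<Sum>j\<in>UNIV. M $ k $ l *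
        (1/2 * (P i j l + P j i l - P l i j) * w $ i * w $ j))"
      by (subst sum_rotate3) simp
    also have "\<dots> = (- (M *v z)) $ k"
      by (simp add: matrix_vector_mult_def z_def sum_distrib_left)
    finally show ?thesis .
  qed
  then have "spray A h c (x, w) = - (M *v z)"
    by (simp add: vec_eq_iff)
  then have "G x *v spray A h c (x, w) = - z"
    using inv by (simp add: M_def matrix_vector_mul_assoc
        linear_neg[OF matrix_vector_mul_linear])
  then have "mform (G x) e (spray A h c (x, w)) = - (e \<bullet> z)"
    by (simp add: mform_eq_inner)
  also have "e \<bullet> z = (\<Sum>l\<in>UNIV. \<Sum>i\<in>UNIV. \<Sum>j\<in>UNIV. 1/2 * (e $ l * w $ i * w $ j * P i j l)
      + 1/2 * (e $ l * w $ i * w $ j * P j i l) - 1/2 * (e $ l * w $ i * w $ j * P l i j))"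
    by (simp add: inner_vec_def z_def sum_distrib_left algebra_simps)
  also have "\<dots> = 1/2 * (\<Sum>l\<in>UNIV. \<Sum>i\<in>UNIV. \<Sum>j\<in>UNIV. e $ l * w $ i * w $ j * P i j l)
      + 1/2 * (\<Sum>l\<in>UNIV. \<Sum>i\<in>UNIV. \<Sum>j\<in>UNIV. e $ l * w $ i * w $ j * P j i l)
      - 1/2 * (\<Sum>l\<in>UNIV. \<Sum>i\<in>UNIV. \<Sum>j\<in>UNIV. e $ l * w $ i * w $ j * P l i j)"
    by (simp only: sum.distrib sum_subtractf sum_distrib_left)
  also have "(\<Sum>l\<in>UNIV. \<Sum>i\<in>UNIV. \<Sum>j\<in>UNIV. e $ l * w $ i * w $ j * P j i l)
      = (\<Sum>l\<in>UNIV. \<Sum>i\<in>UNIV. \<Sum>j\<in>UNIV. e $ l * w $ i * w $ j * P i j l)"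
  proof (rule sum.cong[OF refl])
    fix l
    have "(\<Sum>i\<in>UNIV. \<Sum>j\<in>UNIV. e $ l * w $ i * w $ j * P j i l)
        = (\<Sum>j\<in>UNIV. \<Sum>i\<in>UNIV. e $ l * w $ i * w $ j * P j i l)" by (rule sum.swap)
    then show "(\<Sum>i\<in>UNIV. \<Sum>j\<in>UNIV. e $ l * w $ i * w $ j * P j i l)
        = (\<Sum>i\<in>UNIV. \<Sum>j\<in>UNIV. e $ l * w $ i * w $ j * P i j l)" by (simp add: mult_ac)
  qed
  also have "(\<Sum>l\<in>UNIV. \<Sum>i\<in>UNIV. \<Sum>j\<in>UNIV. e $ l * w $ i * w $ j * P i j l) = dmetric G x w w e"
  proof -
    have "dmetric G x w w e = (\<Sum>j\<in>UNIV. \<Sum>l\<in>UNIV. \<Sum>i\<in>UNIV. e $ l * w $ i * w $ j * P i j l)"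
      by (simp add: dmetric_def frechet_derivative_partials[OF diff] sum_distrib_left P_def mult_ac)
    also have "\<dots> = (\<Sum>l\<in>UNIV. \<Sum>i\<in>UNIV. \<Sum>j\<in>UNIV. e $ l * w $ i * w $ j * P i j l)"
      by (rule trans[OF sum_rotate3 sum_rotate3])
    finally show ?thesis by simp
  qed
  also have "(\<Sum>l\<in>UNIV. \<Sum>i\<in>UNIV. \<Sum>j\<in>UNIV. e $ l * w $ i * w $ j * P l i j) = dmetric G x e w w"
  proof -
    have "dmetric G x e w w = (\<Sum>i\<in>UNIV. \<Sum>j\<in>UNIV. \<Sum>l\<in>UNIV. e $ l * w $ i * w $ j * P l i j)"
      by (simp add: dmetric_def frechet_derivative_partials[OF diff] sum_distrib_left P_def mult_ac)
    also have "\<dots> = (\<Sum>l\<in>UNIV. \<Sum>i\<in>UNIV. \<Sum>j\<in>UNIV. e $ l * w $ i * w $ j * P l i j)"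
      by (rule sum_rotate3)
    finally show ?thesis by simp
  qed
  finally show ?thesis by simp
qed

lemma has_derivative_mform:
  fixes G :: "'a::real_normed_vector \<Rightarrow> real^'n^'n"
  assumes G: "\<And>i j. ((\<lambda>x. G x $ i $ j) has_derivative G' i j) (at x)"
    and U: "(U has_derivative U') (at x)" and V: "(V has_derivative V') (at x)"
  shows "((\<lambda>x. mform (G x) (U x) (V x)) has_derivative (\<lambda>a. mform (G x) (U' a) (V x)
      + mform (G x) (U x) (V' a)
     + (\<Sum>i\<in>UNIV. \<Sum>j\<in>UNIV. U x $ i * V x $ j * G' i j a))) (at x)"
proof -
  have U': "((\<lambda>x. U x $ i) has_derivative (\<lambda>a. U' a $ i)) (at x)" for i
    using bounded_linear.has_derivative[OF bounded_linear_vec_nth U] .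
  have V': "((\<lambda>x. V x $ i) has_derivative (\<lambda>a. V' a $ i)) (at x)" for i
    using bounded_linear.has_derivative[OF bounded_linear_vec_nth V] .
  have "((\<lambda>x. mform (G x) (U x) (V x)) has_derivative (\<lambda>a. \<Sum>i\<in>UNIV. \<Sum>j\<in>UNIV.
      U x $ i * V x $ j * G' i j a + (U x $ i * V' a $ j + U' a $ i * V x $ j) * G x $ i $ j)) (at
          x)"
    unfolding mform_def by (intro has_derivative_sum has_derivative_mult U' V' G)
  then show ?thesis
    by (rule has_derivative_eq_rhs) (simp add: fun_eq_iff mform_def sum.distrib algebra_simps)
qed

section \<open>The spray under a change of chart\<close>

context
  fixes A :: "('m::{t2_space,second_countable_topology}, 'n::finite) chart set"
    and h :: "('m, 'n) metric"
  assumes A: "smooth_atlas A" and h: "pseudo_Riemannian A h"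
    and C1: "\<And>c i j. c \<in> A \<Longrightarrow> Ck_on 1 (\<lambda>x. metric_matrix A h c x $ i $ j) (snd c ` fst c)"
begin

lemma metric_matrix_entry_has_derivative:
  assumes "c \<in> A" "p \<in> fst c"
  shows "((\<lambda>x. metric_matrix A h c x $ i $ j) has_derivative
     frechet_derivative (\<lambda>x. metric_matrix A h c x $ i $ j) (at (snd c p))) (at (snd c p))"
  using Ck_on_1_has_derivative[OF C1] assms by blast

lemma mform_spray_metric:
  assumes "c \<in> A" "p \<in> fst c"
  shows "mform (metric_matrix A h c (snd c p)) e (spray A h c (snd c p, w))
    = 1/2 * dmetric (metric_matrix A h c) (snd c p) e w w - dmetric (metric_matrix A h c) (snd c p)
        w w e"
  using assms metric_matrix_entry_has_derivative[OF assms]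
  by (intro mform_spray metric_matrix_inv[OF A h]) (auto simp: differentiable_def)

abbreviation second_transition_deriv :: "('m, 'n) chart \<Rightarrow> ('m, 'n) chart \<Rightarrow> real^'n \<Rightarrow> real^'n \<Rightarrow>
    real^'n \<Rightarrow> real^'n" where
  "second_transition_deriv c d x a u \<equiv> frechet_derivative (\<lambda>y. transition_deriv c d y u) (at x) a"

lemma transition_deriv_has_derivative:
  assumes "c \<in> A" "d \<in> A" "p \<in> fst c" "p \<in> fst d"
  shows "((\<lambda>y. transition_deriv c d y u) has_derivative
      (\<lambda>a. second_transition_deriv c d (snd c p) a u)) (at (snd c p))"
  by (rule Ck_on_1_has_derivative[OF Ck_on_2_derivative[OF transition_smooth[OF A]]])
      (use assms in auto)

text \<open>Differentiate \<open>mform_metric_transition\<close> in direction \<open>a\<close> with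
  \<open>u\<close> and \<open>v\<close> constant. The metric contributes through the transition map,
  and each transported vector contributes a second derivative of that map.\<close>

lemma dmetric_transition:
  assumes c: "c \<in> A" "p \<in> fst c" and d: "d \<in> A" "p \<in> fst d"
  shows "dmetric (metric_matrix A h c) (snd c p) a u v
    = dmetric (metric_matrix A h d) (snd d p) (transition_deriv c d (snd c p) a)
        (transition_deriv c d (snd c p) u) (transition_deriv c d (snd c p) v)
      + mform (metric_matrix A h d (snd d p)) (second_transition_deriv c d (snd c p) a u)
          (transition_deriv c d (snd c p) v)
      + mform (metric_matrix A h d (snd d p)) (transition_deriv c d (snd c p) u)
          (second_transition_deriv c d (snd c p) a v)"
    (is "?L a = ?R a")
proof -
  let ?x = "snd c p"
  let ?D = "transition_deriv c d"
  have \<psi>x: "transition c d ?x = snd d p" using c d by (simp add: chart_inv_chart[OF A])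
  have L: "((\<lambda>x. mform (metric_matrix A h c x) u v) has_derivative ?L) (at ?x)"
    using has_derivative_mform[OF metric_matrix_entry_has_derivative[OF c]
        has_derivative_const[of u] has_derivative_const[of v]]
    by (simp add: mform_eq_inner dmetric_def[abs_def])
  have "((\<lambda>x. metric_matrix A h d (transition c d x) $ i $ j) has_derivative
      (\<lambda>a. frechet_derivative (\<lambda>x. metric_matrix A h d x $ i $ j) (at (snd d p)) (?D ?x a))) (at
          ?x)" for i j
    using has_derivative_compose[OF transition_has_derivative[OF A c(1) d(1) c(2) d(2)], of
        "\<lambda>y. metric_matrix A h d y $ i $ j"]
      metric_matrix_entry_has_derivative[OF d, of i j] by (simp only: \<psi>x)
  from has_derivative_mform[OF this transition_deriv_has_derivative[OF c(1) d(1) c(2) d(2), of u]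
      transition_deriv_has_derivative[OF c(1) d(1) c(2) d(2), of v]]
  have "((\<lambda>x. mform (metric_matrix A h d (transition c d x)) (?D x u) (?D x v)) has_derivative ?R)
      (at ?x)"
    unfolding \<psi>x by (rule has_derivative_eq_rhs) (rule ext, simp only: dmetric_def ac_simps)
  then have "((\<lambda>x. mform (metric_matrix A h c x) u v) has_derivative ?R) (at ?x)"
  proof (rule has_derivative_transform_within_open)
    show "open (snd c ` (fst c \<inter> fst d))" by (rule open_overlap[OF A c(1) d(1)])
    show "?x \<in> snd c ` (fst c \<inter> fst d)" using c d by auto
    fix x assume "x \<in> snd c ` (fst c \<inter> fst d)"
    then obtain q where q: "q \<in> fst c" "q \<in> fst d" "x = snd c q" by auto
    show "mform (metric_matrix A h d (transition c d x)) (?D x u) (?D x v)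
        = mform (metric_matrix A h c x) u v"
      using mform_metric_transition[OF A h c(1) q(1) d(1) q(2), of u v] c(1) q
          by (simp add: chart_inv_chart[OF A])
  qed
  from has_derivative_unique[OF L this] show ?thesis by metis
qed

text \<open>The transition law of the Christoffel symbols. Lowering the index by the metric turns it into
  the derivative of \<open>mform_metric_transition\<close>, and no inverse matrix has to be transformed.\<close>

lemma spray_transition:
  assumes c: "c \<in> A" "p \<in> fst c" and d: "d \<in> A" "p \<in> fst d"
  shows "spray A h d (snd d p, transition_deriv c d (snd c p) w)
    = transition_deriv c d (snd c p) (spray A h c (snd c p, w))
        + second_transition_deriv c d (snd c p) w w"
    (is "?s = ?r")
proof -
  let ?D = "transition_deriv c d (snd c p)"
  let ?E = "second_transition_deriv c d (snd c p)"
  let ?m = "mform (metric_matrix A h d (snd d p))"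
  let ?dc = "dmetric (metric_matrix A h c) (snd c p)"
  let ?dd = "dmetric (metric_matrix A h d) (snd d p)"
  note sym = mform_metric_sym[OF A h d]
  have E: "?E a b = ?E b a" for a b
    by (rule symmetric_second_derivative[OF transition_smooth[OF A c(1) d(1)]
        open_overlap[OF A c(1) d(1)]])
      (use c d in auto)
  have "?m (?s - ?r) v = 0" for v
  proof -
    \<comment> \<open>The transition derivative is onto, so every test vector \<open>v\<close> is
      the image \<open>?D e\<close> of a vector that can be inserted in the first chart.\<close>
    define e where "e = transition_deriv d c (snd d p) v"
    have v: "v = ?D e"
      unfolding e_def using c d
      by (simp add: transition_deriv_chain[OF A d(1) c(1) d(1) d(2) c(2) d(2)]
          transition_deriv_id[OF A d])
    have 1: "?m ?s v = 1/2 * ?dd (?D e) (?D w) (?D w) - ?dd (?D w) (?D w) (?D e)"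
      unfolding v by (subst sym) (rule mform_spray_metric[OF d])
    have "?m (?D (spray A h c (snd c p, w))) v = mform (metric_matrix A h c (snd c p))
        (spray A h c (snd c p, w)) e"
      unfolding v by (rule mform_metric_transition[OF A h c d, symmetric])
    also have "\<dots> = 1/2 * ?dc e w w - ?dc w w e"
      by (subst mform_metric_sym[OF A h c]) (rule mform_spray_metric[OF c])
    also have "\<dots> = 1/2 * ?dd (?D e) (?D w) (?D w) - ?dd (?D w) (?D w) (?D e) - ?m (?E w w) v"
    proof -
      \<comment> \<open>By symmetry of \<open>?E\<close> and of the form, the second-derivative
        terms in \<open>1/2 * ?dc e w w\<close> cancel the mixed one in \<open>?dc w w e\<close>,
        and only \<open>?E w w\<close> survives.\<close>
      have "?m (?E e w) (?D w) = ?m (?D w) (?E w e)" "?m (?D w) (?E e w) = ?m (?D w) (?E w e)"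
        by (simp_all only: E[of w e] sym[of "?E w e" "?D w"])
      then show ?thesis
        unfolding v using dmetric_transition[OF c d, of e w w] dmetric_transition[OF c d, of w w e]
            by linarith
    qed
    finally show ?thesis
      using 1 by (simp add: mform_diff_left mform_add_left)
  qed
  from mform_metric_nondegenerate[OF A h d this] show ?thesis by simp
qed

text \<open>\<open>geodesic\<close> demands the equation in every chart, while solutions are
  constructed in the single chart \<open>c\<close>. In a chart \<open>d\<close> the velocity is the
  transition derivative applied to \<open>w\<close>, and the product rule differentiates it to the
  right-hand side of \<open>spray_transition\<close>.\<close>

lemma coordinate_geodesic:
  assumes c: "c \<in> A" and x: "\<And>t. t \<in> {0..1} \<Longrightarrow> x t \<in> snd c ` fst c"
    and dx: "\<And>t. t \<in> {0..1} \<Longrightarrow> (x has_vector_derivative w t) (at t within {0..1})"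
    and dw: "\<And>t. t \<in> {0..1} \<Longrightarrow> (w has_vector_derivative spray A h c (x t, w t)) (at t within {0..1})"
  shows "geodesic_from A h (chart_inv c (x 0)) (coord_vec A c (chart_inv c (x 0)) (w 0))
      (\<lambda>t. chart_inv c (x t))"
proof -
  let ?\<gamma> = "\<lambda>t. chart_inv c (x t)"
  have cont: "continuous_on {0..1} x"
    using dx by (meson has_vector_derivative_continuous continuous_on_eq_continuous_within)
  have fst_c: "?\<gamma> t \<in> fst c" "snd c (?\<gamma> t) = x t" if "t \<in> {0..1}" for t
    using chart_inv_mem[OF A c x[OF that]] chart_chart_inv[OF A c x[OF that]] by auto
  have D1: "((snd d \<circ> ?\<gamma>) has_vector_derivative transition_deriv c d (x t) (w t))
      (at t within {0..1})"
    if t: "t \<in> {0..1}" and d: "d \<in> A" "?\<gamma> t \<in> fst d" for t d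
  proof -
    have "(transition c d has_derivative transition_deriv c d (x t)) (at (x t))"
      using transition_has_derivative[OF A c d(1) fst_c(1)[OF t] d(2)] fst_c(2)[OF t] by simp
    then have "((\<lambda>t. transition c d (x t)) has_vector_derivative transition_deriv c d (x t) (w t))
        (at t within {0..1})"
      using vector_derivative_diff_chain_within[OF dx[OF t], of "transition c d"]
      by (simp add: has_derivative_at_withinI comp_def)
    then show ?thesis by (simp add: comp_def)
  qed
  have D2: "((\<lambda>t. transition_deriv c d (x t) (w t)) has_vector_derivative
      spray A h d (snd d (?\<gamma> t), transition_deriv c d (x t) (w t))) (at t within {0..1})"
    if t: "t \<in> {0..1}" and d: "d \<in> A" "?\<gamma> t \<in> fst d" for t d
  proof -
    let ?E = "\<lambda>a u. second_transition_deriv c d (x t) a u"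
    have dE: "((\<lambda>y. transition_deriv c d y u) has_derivative (\<lambda>a. ?E a u)) (at (x t))" for u
      using transition_deriv_has_derivative[OF c d(1) fst_c(1)[OF t] d(2)] fst_c(2)[OF t] by simp
    have dEx: "((\<lambda>s. transition_deriv c d (x s) u) has_vector_derivative ?E (w t) u)
        (at t within {0..1})" for u
      using vector_derivative_diff_chain_within[OF dx[OF t], of "\<lambda>y. transition_deriv c d y u"] dE
      by (simp add: has_derivative_at_withinI comp_def)
    have lin: "linear (transition_deriv c d (x s))" if "s \<in> {0..1}" "?\<gamma> s \<in> fst d" for s
      using linear_transition_deriv[OF A c d(1) fst_c(1)[OF that(1)] that(2)] fst_c(2)[OF that(1)]
          by simp
    \<comment> \<open>The transition derivative is known to be differentiable on one fixed vector at
      a time, so the product rule for its application to \<open>w s\<close> is carried out after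
      expanding \<open>w s\<close> in the basis.\<close>
    have expand: "L u = (\<Sum>i\<in>UNIV. u $ i *\<^sub>R L (axis i 1))" if "linear L" for L ::
        "real^'n \<Rightarrow> real^'n" and u
      using that vec_sum_axis[of u] by (metis (no_types, lifting) linear_scale linear_sum sum.cong)
    have comp: "((\<lambda>s. w s $ i) has_vector_derivative spray A h c (x t, w t) $ i)
        (at t within {0..1})" for i
      using bounded_linear.has_vector_derivative[OF bounded_linear_vec_nth dw[OF t]] .
    have "((\<lambda>s. \<Sum>i\<in>UNIV. w s $ i *\<^sub>R transition_deriv c d (x s) (axis i 1)) has_vector_derivative
        (\<Sum>i\<in>UNIV. w t $ i *\<^sub>R ?E (w t) (axis i 1)
          + spray A h c (x t, w t) $ i *\<^sub>R transition_deriv c d (x t) (axis i 1))) (at t within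
              {0..1})"
      using comp dEx by (intro has_vector_derivative_sum has_vector_derivative_scaleR)
        (auto simp: has_real_derivative_iff_has_vector_derivative)
    also have "(\<Sum>i\<in>UNIV. w t $ i *\<^sub>R ?E (w t) (axis i 1)
          + spray A h c (x t, w t) $ i *\<^sub>R transition_deriv c d (x t) (axis i 1))
       = ?E (w t) (w t) + transition_deriv c d (x t) (spray A h c (x t, w t))"
    proof -
      \<comment> \<open>Linearity in the direction of differentiation is automatic; symmetry of the
        second derivative transfers it to the other argument.\<close>
      have "linear (?E (w t))"
      proof -
        have sym: "?E a b = ?E b a" for a b
          by (rule symmetric_second_derivative[OF transition_smooth[OF A c d(1)]
              open_overlap[OF A c d(1)]])
            (use fst_c[OF t] d in \<open>auto intro!: image_eqI[of _ _ "?\<gamma> t"]\<close>)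
        have "linear (\<lambda>u. ?E u (w t))" using dE by (rule has_derivative_linear)
        then show ?thesis by (simp add: sym[of "w t"])
      qed
      then show ?thesis
        using expand[of "?E (w t)" "w t"] expand[OF lin[OF t d(2)], of "spray A h c (x t, w t)"]
            by (simp add: sum.distrib)
    qed
    also have "\<dots> = spray A h d (snd d (?\<gamma> t), transition_deriv c d (x t) (w t))"
      using spray_transition[OF c fst_c(1)[OF t] d] fst_c(2)[OF t] by simp
    finally have main: "((\<lambda>s. \<Sum>i\<in>UNIV. w s $ i *\<^sub>R transition_deriv c d (x s) (axis i 1))
        has_vector_derivative
      spray A h d (snd d (?\<gamma> t), transition_deriv c d (x t) (w t))) (at t within {0..1})" .
    have "\<forall>\<^sub>F s in at t within {0..1}. ?\<gamma> s \<in> fst d"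
    proof -
      have "continuous_on {0..1} ?\<gamma>"
        by (rule continuous_on_compose2[OF continuous_on_chart_inv[OF A c] cont]) (use x in auto)
      then have "(?\<gamma> \<longlongrightarrow> ?\<gamma> t) (at t within {0..1})"
        using t by (simp add: continuous_on)
      then show ?thesis
        using open_chart_domain[OF A d(1)] d(2) by (rule topological_tendstoD)
    qed
    then obtain \<delta> where \<delta>: "\<delta> > 0" "\<And>s. s \<in> {0..1} \<Longrightarrow> s \<noteq> t \<Longrightarrow> dist s t < \<delta> \<Longrightarrow> ?\<gamma> s \<in> fst d"
      unfolding eventually_at by blast
    \<comment> \<open>The expansion represents the velocity in chart \<open>d\<close> while the
      curve is in the domain of \<open>d\<close>, where the transition derivative is linear.
      Equality at times near \<open>t\<close> determines the derivative at \<open>t\<close>.\<close>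
    have eq: "(\<Sum>i\<in>UNIV. w s $ i *\<^sub>R transition_deriv c d (x s) (axis i 1))
        = transition_deriv c d (x s) (w s)"
      if s: "s \<in> {0..1}" "dist s t < \<delta>" for s
    proof -
      have "?\<gamma> s \<in> fst d" using \<delta>(2)[OF s(1) _ s(2)] d(2) by (cases "s = t") auto
      then show ?thesis by (rule expand[OF lin[OF s(1)], symmetric])
    qed
    show ?thesis
      by (rule has_vector_derivative_transform_within[OF main \<delta>(1) t eq])
  qed
  have "geodesic A h {0..1} ?\<gamma>"
    unfolding geodesic_def
  proof (intro conjI ballI exI allI impI)
    show "continuous_on {0..1} ?\<gamma>"
      by (rule continuous_on_compose2[OF continuous_on_chart_inv[OF A c] cont]) (use x in auto)
    fix d t assume "d \<in> A" "t \<in> {0..1}" "?\<gamma> t \<in> fst d"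
    note D = D1[OF this(2,1,3)] D2[OF this(2,1,3)]
    show "((snd d \<circ> ?\<gamma>) has_vector_derivative transition_deriv c d (x t) (w t))
        (at t within {0..1})"
      by (rule D(1))
    show "((\<lambda>t. transition_deriv c d (x t) (w t)) has_vector_derivative
       (\<chi> k. - (\<Sum>i\<in>UNIV. \<Sum>j\<in>UNIV. christoffel A h d (snd d (?\<gamma> t)) k i j
          * transition_deriv c d (x t) (w t) $ i * transition_deriv c d (x t) (w t) $ j))) (at t
              within {0..1})"
      using D(2) by (simp add: spray_def)
  qed
  moreover have "velocity A {0..1} ?\<gamma> 0 = coord_vec A c (?\<gamma> 0) (w 0)"
  proof
    fix d
    have "vector_derivative (snd d \<circ> ?\<gamma>) (at 0 within {0..1}) = transition_deriv c d (x 0) (w 0)"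
      if "d \<in> charts_at A (?\<gamma> 0)"
      using that D1[of 0 d] by (intro vector_derivative_within_closed_interval)
          (auto simp: charts_at_def)
    then show "velocity A {0..1} ?\<gamma> 0 d = coord_vec A c (?\<gamma> 0) (w 0) d"
      using fst_c[of 0] by (simp add: velocity_def coord_vec_def)
  qed
  ultimately show ?thesis
    by (simp add: geodesic_from_def)
qed

end

section \<open>Uniqueness and scaling of geodesics\<close>

lemma Ck_on_1_det:
  fixes G :: "'a::euclidean_space \<Rightarrow> real^'n^'n"
  assumes "\<And>i j. Ck_on 1 (\<lambda>x. G x $ i $ j) S"
  shows "Ck_on 1 (\<lambda>x. det (G x)) S"
  unfolding det_def by (intro Ck_on_1_sum Ck_on_1_mult Ck_on_1_const Ck_on_1_prod assms)

lemma Ck_on_1_matrix_inv: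
  fixes G :: "'a::euclidean_space \<Rightarrow> real^'n^'n"
  assumes G: "\<And>i j. Ck_on 1 (\<lambda>x. G x $ i $ j) S" and S: "open S"
    and nz: "\<And>x. x \<in> S \<Longrightarrow> det (G x) \<noteq> 0"
  shows "Ck_on 1 (\<lambda>x. matrix_inv (G x) $ k $ l) S"
proof (rule Ck_on_1_cong[OF S])
  let ?N = "\<lambda>x. det (\<chi> i j. if j = k then (if i = l then 1 else 0) else G x $ i $ j)"
  show "?N x * inverse (det (G x)) = matrix_inv (G x) $ k $ l" if "x \<in> S" for x
    using nz[OF that] by (simp add: matrix_inv_cramer divide_inverse)
  have "Ck_on 1 (\<lambda>x. (\<chi> i j. if j = k then (if i = l then 1 else 0) else G x $ i $ j) $ i $ j) S"
      for i j
    using G Ck_on_1_const by (cases "j = k") auto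
  then show "Ck_on 1 (\<lambda>x. ?N x * inverse (det (G x))) S"
    by (intro Ck_on_1_mult Ck_on_1_inverse Ck_on_1_det G nz)
qed

text \<open>Spatial partial derivatives are full derivatives in the directions
  \<open>(0, axis l 1)\<close>, so the Christoffel symbols use up one of the two orders of
  differentiability and stay C1 jointly in parameter and point. Joint regularity is what compactness
  in the parameter relies on.\<close>

lemma Ck_on_1_spray_family:
  fixes A :: "('m::{t2_space,second_countable_topology}, 'n::finite) chart set"
  assumes A: "smooth_atlas A" and g: "C2_metric_family A a g" and c: "c \<in> A"
  shows "Ck_on 1 (\<lambda>z. spray A (g (fst z)) c (snd z)) ({-a<..<a} \<times> snd c ` fst c \<times> UNIV)"
proof -
  let ?I = "{-a<..<a}" and ?S = "snd c ` fst c"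
  define m where "m i j = (\<lambda>z. metric_matrix A (g (fst z)) c (snd z) $ i $ j)" for i j
  have m2: "Ck_on 2 (m i j) (?I \<times> ?S)" for i j
    using g c by (simp add: C2_metric_family_def m_def split_def)
  have S: "open (?I \<times> ?S)"
    by (intro open_Times open_greaterThanLessThan open_chart_image[OF A c])
  have nz: "det (metric_matrix A (g (fst z)) c (snd z)) \<noteq> 0" if "z \<in> ?I \<times> ?S" for z
  proof -
    obtain \<epsilon> p where z: "z = (\<epsilon>, snd c p)" "\<epsilon> \<in> ?I" "p \<in> fst c" using \<open>z \<in> ?I \<times> ?S\<close> by auto
    have "pseudo_Riemannian A (g \<epsilon>)" using g z by (simp add: C2_metric_family_def)
    then show ?thesis using det_metric_matrix_nonzero[OF A _ c z(3)] z by simp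
  qed
  have inv: "Ck_on 1 (\<lambda>z. matrix_inv (metric_matrix A (g (fst z)) c (snd z)) $ k $ l) (?I \<times> ?S)"
      for k l
    using Ck_on_2_imp_1[OF m2] by (intro Ck_on_1_matrix_inv S nz) (auto simp: m_def)
  define dm where "dm l i j = (\<lambda>z. frechet_derivative (m i j) (at z) (0, axis l 1))" for l i j
  have dm: "Ck_on 1 (dm l i j) (?I \<times> ?S)" for l i j
    unfolding dm_def by (rule Ck_on_2_derivative[OF m2])
  have partial: "partial l (\<lambda>y. metric_matrix A (g (fst z)) c y $ i $ j) (snd z) = dm l i j z"
    if "z \<in> ?I \<times> ?S" for l i j z
  proof -
    have "((\<lambda>y. (fst z, y)) has_derivative (\<lambda>v. (0, v))) (at (snd z))"
      by (auto intro!: derivative_eq_intros)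
    moreover have "(m i j has_derivative frechet_derivative (m i j) (at z)) (at (fst z, snd z))"
      using Ck_on_1_has_derivative[OF Ck_on_2_imp_1[OF m2] that] by simp
    ultimately have "((\<lambda>y. m i j (fst z, y)) has_derivative
        (\<lambda>v. frechet_derivative (m i j) (at z) (0, v))) (at (snd z))"
      by (rule has_derivative_compose)
    from fun_cong[OF frechet_derivative_at[OF this], of "axis l 1"]
    have "partial l (\<lambda>y. m i j (fst z, y)) (snd z) = dm l i j z"
      unfolding partial_def dm_def by (rule sym)
    then show ?thesis unfolding m_def fst_conv snd_conv .
  qed
  have chr: "Ck_on 1 (\<lambda>z. christoffel A (g (fst z)) c (snd z) k i j) (?I \<times> ?S)" for k i j
  proof (rule Ck_on_1_cong[OF S])
    show "1/2 * (\<Sum>l\<in>UNIV. matrix_inv (metric_matrix A (g (fst z)) c (snd z)) $ k $ l *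
        (dm i j l z + dm j i l z - dm l i j z)) = christoffel A (g (fst z)) c (snd z) k i j"
      if "z \<in> ?I \<times> ?S" for z
      unfolding christoffel_def Let_def by (simp only: partial[OF that])
    show "Ck_on 1 (\<lambda>z. 1/2 * (\<Sum>l\<in>UNIV. matrix_inv (metric_matrix A (g (fst z)) c (snd z)) $ k $ l *
        (dm i j l z + dm j i l z - dm l i j z))) (?I \<times> ?S)"
      by (intro Ck_on_1_mult Ck_on_1_const Ck_on_1_sum Ck_on_1_add Ck_on_1_diff inv dm)
  qed
  have "Ck_on 1 (\<lambda>z. christoffel A (g (fst z)) c (fst (snd z)) k i j) (?I \<times> ?S \<times> UNIV)" for k i j
  proof -
    have "Ck_on 1 (\<lambda>z. christoffel A (g (fst (fst z, fst (snd z)))) c (snd (fst z, fst (snd z))) k i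
        j) (?I \<times> ?S \<times> UNIV)"
      by (rule Ck_on_1_compose[OF chr])
        (auto intro!: Ck_on_1_Pair Ck_on_1_fst Ck_on_1_snd Ck_on_1_ident)
    then show ?thesis by simp
  qed
  then show ?thesis
    unfolding spray_def
    by (intro Ck_on_1_vec Ck_on_1_minus Ck_on_1_sum Ck_on_1_mult Ck_on_1_vec_nth Ck_on_1_snd
        Ck_on_1_ident)
qed

lemma spray_scaleR: "spray A h c (x, s *\<^sub>R w) = s\<^sup>2 *\<^sub>R spray A h c (x, w)"
  by (simp add: spray_def vec_eq_iff sum_distrib_left power2_eq_square mult_ac)

lemma Ck_on_1_spray:
  fixes A :: "('m::{t2_space,second_countable_topology}, 'n::finite) chart set"
  assumes A: "smooth_atlas A" and g: "C2_metric_family A a g" and c: "c \<in> A" and \<epsilon>: "\<epsilon> \<in> {-a<..<a}"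
  shows "Ck_on 1 (spray A (g \<epsilon>) c) (snd c ` fst c \<times> UNIV)"
  using Ck_on_1_slice(1)[OF Ck_on_1_spray_family[OF A g c] \<epsilon>] by simp

lemma Ck_on_1_metric_matrix:
  assumes g: "C2_metric_family A a g" and c: "c \<in> A" and \<epsilon>: "\<epsilon> \<in> {-a<..<a}"
  shows "Ck_on 1 (\<lambda>x. metric_matrix A (g \<epsilon>) c x $ i $ j) (snd c ` fst c)"
proof -
  have "Ck_on 2 (\<lambda>(\<epsilon>, x). metric_matrix A (g \<epsilon>) c x $ i $ j) ({-a<..<a} \<times> snd c ` fst c)"
    using g c by (simp add: C2_metric_family_def)
  from Ck_on_1_slice(1)[OF Ck_on_2_imp_1[OF this] \<epsilon>] show ?thesis by simp
qed

lemma geodesicD: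
  assumes "geodesic A h I \<gamma>" "c \<in> A"
  obtains w where "\<And>t. t \<in> I \<Longrightarrow> \<gamma> t \<in> fst c \<Longrightarrow> ((snd c \<circ> \<gamma>) has_vector_derivative w t)
      (at t within I)"
    "\<And>t. t \<in> I \<Longrightarrow> \<gamma> t \<in> fst c \<Longrightarrow> (w has_vector_derivative spray A h c (snd c (\<gamma> t), w t))
        (at t within I)"
proof -
  obtain w where w: "\<forall>t\<in>I. \<gamma> t \<in> fst c \<longrightarrow> ((snd c \<circ> \<gamma>) has_vector_derivative w t) (at t within I) \<and>
      (w has_vector_derivative spray A h c (snd c (\<gamma> t), w t)) (at t within I)"
    using assms unfolding geodesic_def spray_def fst_conv snd_conv by blast
  show thesis by (rule that[of w]) (use w in blast)+
qed

section \<open>Uniqueness of geodesics\<close>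

context
  fixes A :: "('m::{t2_space,second_countable_topology}, 'n::finite) chart set"
    and h :: "('m, 'n) metric"
  assumes A: "smooth_atlas A"
    and spray_C1: "\<And>c. c \<in> A \<Longrightarrow> Ck_on 1 (spray A h c) (snd c ` fst c \<times> UNIV)"
begin

text \<open>In the chart \<open>c\<close> the geodesic equation becomes a first-order system for
  position and velocity, to which \<open>ode_local_uniqueness\<close> applies; injectivity of the
  chart leads back to the manifold.\<close>

lemma geodesic_local_uniqueness:
  assumes g1: "geodesic A h {0..1} \<gamma>1" and g2: "geodesic A h {0..1} \<gamma>2"
    and t0: "t0 \<in> {0..1}" and eq: "\<gamma>1 t0 = \<gamma>2 t0" and c: "c \<in> A" "\<gamma>1 t0 \<in> fst c"
    and v: "vector_derivative (snd c \<circ> \<gamma>1) (at t0 within {0..1})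
        = vector_derivative (snd c \<circ> \<gamma>2) (at t0 within {0..1})"
  shows "\<exists>d>0. \<forall>t\<in>{0..1}. \<bar>t - t0\<bar> < d \<longrightarrow> \<gamma>1 t = \<gamma>2 t"
proof -
  obtain w1 where w1: "\<And>t. t \<in> {0..1} \<Longrightarrow> \<gamma>1 t \<in> fst c \<Longrightarrow>
      ((snd c \<circ> \<gamma>1) has_vector_derivative w1 t) (at t within {0..1})"
    "\<And>t. t \<in> {0..1} \<Longrightarrow> \<gamma>1 t \<in> fst c \<Longrightarrow> (w1 has_vector_derivative spray A h c (snd c (\<gamma>1 t), w1 t))
        (at t within {0..1})"
    using geodesicD[OF g1 c(1)] by metis
  obtain w2 where w2: "\<And>t. t \<in> {0..1} \<Longrightarrow> \<gamma>2 t \<in> fst c \<Longrightarrow>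
      ((snd c \<circ> \<gamma>2) has_vector_derivative w2 t) (at t within {0..1})"
    "\<And>t. t \<in> {0..1} \<Longrightarrow> \<gamma>2 t \<in> fst c \<Longrightarrow> (w2 has_vector_derivative spray A h c (snd c (\<gamma>2 t), w2 t))
        (at t within {0..1})"
    using geodesicD[OF g2 c(1)] by metis
  have near: "\<exists>e>0. \<forall>t\<in>{0..1}. \<bar>t - t0\<bar> < e \<longrightarrow> \<gamma> t \<in> fst c"
    if "continuous_on {0..1} \<gamma>" "\<gamma> t0 \<in> fst c" for \<gamma> :: "real \<Rightarrow> 'm"
  proof -
    have "(\<gamma> \<longlongrightarrow> \<gamma> t0) (at t0 within {0..1})"
      using that t0 by (simp add: continuous_on)
    from topological_tendstoD[OF this open_chart_domain[OF A c(1)] that(2)]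
    obtain e where "e > 0" "\<forall>t\<in>{0..1}. t \<noteq> t0 \<and> dist t t0 < e \<longrightarrow> \<gamma> t \<in> fst c"
      unfolding eventually_at by blast
    then show ?thesis
      using that(2) by (intro exI[of _ e]) (metis dist_real_def)
  qed
  have "continuous_on {0..1} \<gamma>1" "continuous_on {0..1} \<gamma>2" "\<gamma>2 t0 \<in> fst c"
    using g1 g2 eq c by (auto simp: geodesic_def)
  with near c(2) obtain e1 e2 where e1: "e1 > 0" "\<And>t. t \<in> {0..1} \<Longrightarrow> \<bar>t - t0\<bar> < e1 \<Longrightarrow> \<gamma>1 t \<in> fst c"
    and e2: "e2 > 0" "\<And>t. t \<in> {0..1} \<Longrightarrow> \<bar>t - t0\<bar> < e2 \<Longrightarrow> \<gamma>2 t \<in> fst c" by meson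
  define e where "e = min e1 e2"
  \<comment> \<open>A relative neighbourhood of \<open>t0\<close> on which both curves stay in the
    chart. It is convex, and one-sided if \<open>t0\<close> is an end of the unit interval.\<close>
  define J where "J = {0..1} \<inter> ball t0 e"
  have J: "t \<in> {0..1}" "\<gamma>1 t \<in> fst c" "\<gamma>2 t \<in> fst c" if "t \<in> J" for t
    using that e1(2)[of t] e2(2)[of t] by (auto simp: J_def e_def dist_real_def abs_minus_commute)
  have e: "e > 0" "t0 \<in> J" "convex J"
    using e1 e2 t0 by (auto simp: e_def J_def intro!: convex_Int)
  define f where "f z = (snd z, spray A h c z)" for z
  define z1 where "z1 t = ((snd c \<circ> \<gamma>1) t, w1 t)" for t
  define z2 where "z2 t = ((snd c \<circ> \<gamma>2) t, w2 t)" for t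
  have f: "Ck_on 1 f (snd c ` fst c \<times> UNIV)"
    unfolding f_def by (intro Ck_on_1_Pair spray_C1 c Ck_on_1_snd Ck_on_1_ident)
  have d1: "(z1 has_vector_derivative f (z1 t)) (at t within J)" if "t \<in> J" for t
    unfolding z1_def f_def snd_conv
    by (rule has_vector_derivative_within_subset[OF
        has_vector_derivative_Pair[OF w1(1)[OF J(1,2)[OF that]]]])
      (use w1(2)[OF J(1,2)[OF that]] in \<open>auto simp: J_def\<close>)
  have d2: "(z2 has_vector_derivative f (z2 t)) (at t within J)" if "t \<in> J" for t
    unfolding z2_def f_def snd_conv
    by (rule has_vector_derivative_within_subset[OF
        has_vector_derivative_Pair[OF w2(1)[OF J(1,3)[OF that]]]])
      (use w2(2)[OF J(1,3)[OF that]] in \<open>auto simp: J_def\<close>)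
  have "w1 t0 = w2 t0"
    using v vector_derivative_within_closed_interval[OF zero_less_one t0 w1(1)[OF t0 c(2)]]
      vector_derivative_within_closed_interval[OF zero_less_one t0 w2(1)[OF t0]] c(2) eq by simp
  then have z0: "z1 t0 = z2 t0" "z1 t0 \<in> snd c ` fst c \<times> UNIV"
    using eq c by (auto simp: z1_def z2_def)
  have cont: "continuous_on J z1" "continuous_on J z2"
    using d1 d2 by (meson has_vector_derivative_continuous continuous_on_eq_continuous_within)+
  obtain d where d: "d > 0" "\<And>t. t \<in> J \<Longrightarrow> \<bar>t - t0\<bar> < d \<Longrightarrow> z1 t = z2 t"
    using ode_local_uniqueness[OF f _ e(2,3) cont z0 zero_less_one d1 d2]
      open_Times[OF open_chart_image[OF A c(1)] open_UNIV] by blast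
  have "\<gamma>1 t = \<gamma>2 t" if t: "t \<in> {0..1}" "\<bar>t - t0\<bar> < min d e" for t
  proof -
    have tJ: "t \<in> J" using t by (auto simp: J_def dist_real_def)
    then have "snd c (\<gamma>1 t) = snd c (\<gamma>2 t)"
      using d(2)[OF tJ] t by (simp add: z1_def z2_def)
    then show ?thesis
      using chart_inv_chart[OF A c(1)] J[OF tJ] by metis
  qed
  then show ?thesis
    using d(1) e(1) by (intro exI[of _ "min d e"]) auto
qed

text \<open>A connectedness argument. \<open>E\<close> collects the times near which the curves
  agree, not merely at which they agree: this makes it open by construction and lets equality of
  velocities be read off at its points. Closedness passes positions and velocities to a limit and
  restarts local uniqueness there, in a chart around the limit point.\<close>

lemma geodesic_from_unique:
  assumes g1: "geodesic_from A h q v \<gamma>1" and g2: "geodesic_from A h q v \<gamma>2" and t: "t \<in> {0..1}"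
  shows "\<gamma>1 t = \<gamma>2 t"
proof -
  have geo: "geodesic A h {0..1} \<gamma>1" "geodesic A h {0..1} \<gamma>2"
    using g1 g2 by (auto simp: geodesic_from_def)
  have cont: "continuous_on {0..1} \<gamma>1" "continuous_on {0..1} \<gamma>2"
    using geo by (auto simp: geodesic_def)
  define E where "E = {t\<in>{0..1}. \<exists>d>0. \<forall>s\<in>{0..1}. \<bar>s - t\<bar> < d \<longrightarrow> \<gamma>1 s = \<gamma>2 s}"
  have E0: "0 \<in> E"
  proof -
    obtain c where c: "c \<in> A" "q \<in> fst c"
      using chart_at_exists[OF A, of q] by (auto simp: charts_at_def)
    have "velocity A {0..1} \<gamma>1 0 c = velocity A {0..1} \<gamma>2 0 c" "\<gamma>1 0 = q" "\<gamma>2 0 = q"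
      using g1 g2 by (auto simp: geodesic_from_def)
    then show ?thesis
      using geodesic_local_uniqueness[OF geo, of 0 c] c
          by (auto simp: E_def velocity_def charts_at_def)
  qed
  have "openin (top_of_set {0..1}) E"
    unfolding openin_euclidean_subtopology_iff
  proof (intro conjI ballI)
    fix t assume "t \<in> E"
    then obtain d where d: "d > 0" "\<And>s. s \<in> {0..1} \<Longrightarrow> \<bar>s - t\<bar> < d \<Longrightarrow> \<gamma>1 s = \<gamma>2 s"
      unfolding E_def by blast
    have "s \<in> E" if "s \<in> {0..1}" "dist s t < d/2" for s
    proof -
      have "\<gamma>1 r = \<gamma>2 r" if "r \<in> {0..1}" "\<bar>r - s\<bar> < d/2" for r
      proof (rule d(2)[OF that(1)])
        have "\<bar>r - t\<bar> \<le> \<bar>r - s\<bar> + \<bar>s - t\<bar>" by linarith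
        then show "\<bar>r - t\<bar> < d"
          using that(2) \<open>dist s t < d/2\<close> unfolding dist_real_def by linarith
      qed
      then show ?thesis using that(1) d(1) unfolding E_def by (auto intro!: exI[of _ "d/2"])
    qed
    then show "\<exists>e>0. \<forall>x'\<in>{0..1}. dist x' t < e \<longrightarrow> x' \<in> E"
      using d(1) by (intro exI[of _ "d/2"]) auto
  qed (auto simp: E_def)
  moreover have "closed E"
    unfolding closed_sequential_limits
  proof (intro allI impI)
    fix s l assume s: "(\<forall>n. s n \<in> E) \<and> s \<longlonglongrightarrow> l"
    then have s01: "s n \<in> {0..1}" for n by (auto simp: E_def)
    have l: "l \<in> {0..1}"
      using closed_sequentially[of "{0..1::real}" s l] s s01 by auto
    have seq: "\<gamma>1 (s n) = \<gamma>2 (s n)" for n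
      using s unfolding E_def by force
    have lim: "(\<lambda>n. \<gamma>1 (s n)) \<longlonglongrightarrow> \<gamma>1 l" "(\<lambda>n. \<gamma>2 (s n)) \<longlonglongrightarrow> \<gamma>2 l"
      using continuous_on_tendsto_compose[OF cont(1) _ l, of s]
          continuous_on_tendsto_compose[OF cont(2) _ l, of s] s s01
      by auto
    then have eql: "\<gamma>1 l = \<gamma>2 l"
      using LIMSEQ_unique seq by simp
    obtain c where c: "c \<in> A" "\<gamma>1 l \<in> fst c"
      using chart_at_exists[OF A, of "\<gamma>1 l"] by (auto simp: charts_at_def)
    obtain w1 where w1: "\<And>t. t \<in> {0..1} \<Longrightarrow> \<gamma>1 t \<in> fst c \<Longrightarrow>
        ((snd c \<circ> \<gamma>1) has_vector_derivative w1 t) (at t within {0..1})"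
      "\<And>t. t \<in> {0..1} \<Longrightarrow> \<gamma>1 t \<in> fst c \<Longrightarrow> (w1 has_vector_derivative spray A h c (snd c (\<gamma>1 t), w1 t))
          (at t within {0..1})"
      using geodesicD[OF geo(1) c(1)] by metis
    obtain w2 where w2: "\<And>t. t \<in> {0..1} \<Longrightarrow> \<gamma>2 t \<in> fst c \<Longrightarrow>
        ((snd c \<circ> \<gamma>2) has_vector_derivative w2 t) (at t within {0..1})"
      "\<And>t. t \<in> {0..1} \<Longrightarrow> \<gamma>2 t \<in> fst c \<Longrightarrow> (w2 has_vector_derivative spray A h c (snd c (\<gamma>2 t), w2 t))
          (at t within {0..1})"
      using geodesicD[OF geo(2) c(1)] by metis
    have c2: "\<gamma>2 l \<in> fst c" using c(2) eql by simp
    have sl: "s \<longlonglongrightarrow> l" using s by blast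
    \<comment> \<open>Velocities pass to the limit: \<open>w1\<close> and \<open>w2\<close> are
      continuous, being differentiable by the geodesic equation, and they agree at
      \<open>s n\<close> for large \<open>n\<close> because the curves coincide near that
      time.\<close>
    have lim1: "(\<lambda>n. w1 (s n)) \<longlonglongrightarrow> w1 l"
      by (rule continuous_within_tendsto_compose'[OF
          has_vector_derivative_continuous[OF w1(2)[OF l c(2)]] _ sl])
        (rule s01)
    have lim2: "(\<lambda>n. w2 (s n)) \<longlonglongrightarrow> w2 l"
      by (rule continuous_within_tendsto_compose'[OF
          has_vector_derivative_continuous[OF w2(2)[OF l c2]] _ sl])
        (rule s01)
    have "\<forall>\<^sub>F n in sequentially. w1 (s n) = w2 (s n)"
    proof -
      have "\<forall>\<^sub>F n in sequentially. \<gamma>1 (s n) \<in> fst c"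
        using topological_tendstoD[OF lim(1) open_chart_domain[OF A c(1)] c(2)] .
      then show ?thesis
      proof eventually_elim
        case (elim n)
        obtain d where d: "d > 0" "\<And>r. r \<in> {0..1} \<Longrightarrow> \<bar>r - s n\<bar> < d \<Longrightarrow> \<gamma>1 r = \<gamma>2 r"
          using s unfolding E_def by blast
        have "((snd c \<circ> \<gamma>2) has_vector_derivative w1 (s n)) (at (s n) within {0..1})"
          by (rule has_vector_derivative_transform_within[OF w1(1)[OF s01 elim] d(1) s01])
            (use d(2) in \<open>auto simp: dist_real_def\<close>)
        moreover have "((snd c \<circ> \<gamma>2) has_vector_derivative w2 (s n)) (at (s n) within {0..1})"
          using w2(1)[OF s01] elim seq by simp
        ultimately show ?case
          using vector_derivative_within_closed_interval[OF zero_less_one s01] by metis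
      qed
    qed
    then have "w1 l = w2 l"
      by (rule LIMSEQ_unique[OF Lim_transform_eventually[OF lim1] lim2])
    then have "vector_derivative (snd c \<circ> \<gamma>1) (at l within {0..1})
        = vector_derivative (snd c \<circ> \<gamma>2) (at l within {0..1})"
      using vector_derivative_within_closed_interval[OF zero_less_one l w1(1)[OF l c(2)]]
        vector_derivative_within_closed_interval[OF zero_less_one l w2(1)[OF l c2]] by simp
    from geodesic_local_uniqueness[OF geo l eql c this] show "l \<in> E"
      using l by (simp add: E_def)
  qed
  then have "closedin (top_of_set {0..1}) E"
    by (intro closed_subset) (auto simp: E_def)
  ultimately have "E = {0..1}"
    using connected_clopen[of "{0..1::real}"] E0 by auto
  with t show ?thesis by (force simp: E_def)
qed

lemma exp_map_eq:
  assumes "geodesic_from A h q v \<gamma>"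
  shows "exp_map A h q v = \<gamma> 1"
  unfolding exp_map_def
proof (rule the_equality)
  show "\<exists>\<gamma>'. geodesic_from A h q v \<gamma>' \<and> \<gamma>' 1 = \<gamma> 1"
    using assms by blast
  fix y assume "\<exists>\<gamma>'. geodesic_from A h q v \<gamma>' \<and> \<gamma>' 1 = y"
  then obtain \<gamma>' where \<gamma>': "geodesic_from A h q v \<gamma>'" "\<gamma>' 1 = y" by blast
  have "\<gamma>' 1 = \<gamma> 1"
    by (rule geodesic_from_unique[OF \<gamma>'(1) assms]) simp
  with \<gamma>'(2) show "y = \<gamma> 1" by simp
qed

end

text \<open>The spray is homogeneous of degree two in the velocity: slowing a geodesic down by
  \<open>r\<close> multiplies the velocity by \<open>r\<close> and the acceleration by its square.
  Thus the exponential map sends rays to geodesics, on which star-shapedness rests.\<close>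

lemma geodesic_from_scale:
  assumes g: "geodesic_from A h q v \<gamma>" and r: "r \<in> {0..1}"
  shows "geodesic_from A h q (\<lambda>c. r *\<^sub>R v c) (\<lambda>t. \<gamma> (r * t))"
proof -
  have geo: "geodesic A h {0..1} \<gamma>" and \<gamma>0: "\<gamma> 0 = q" and vel: "velocity A {0..1} \<gamma> 0 = v"
    using g by (auto simp: geodesic_from_def)
  have rt: "r * t \<in> {0..1}" if "t \<in> {0..1}" for t
    using r that by (auto intro: mult_le_one)
  have dr: "((\<lambda>t. r * t) has_vector_derivative r) (at t within {0..1})" for t
    unfolding has_real_derivative_iff_has_vector_derivative[symmetric]
    by (auto intro!: derivative_eq_intros)
  have chain: "((\<lambda>t. f (r * t)) has_vector_derivative r *\<^sub>R f') (at t within {0..1})"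
    if "(f has_vector_derivative f') (at (r * t) within {0..1})" for f :: "real \<Rightarrow> real^'n" and f' t
  proof -
    have "(*) r ` {0..1} \<subseteq> {0..1}" using rt by (intro image_subsetI)
    from vector_diff_chain_within[OF dr has_vector_derivative_within_subset[OF that this]]
    show ?thesis by (simp add: comp_def)
  qed
  have "geodesic A h {0..1} (\<lambda>t. \<gamma> (r * t))"
    unfolding geodesic_def
  proof (intro conjI ballI)
    show "continuous_on {0..1} (\<lambda>t. \<gamma> (r * t))"
    proof (rule continuous_on_compose2[of "{0..1}" \<gamma>])
      show "continuous_on {0..1} \<gamma>" using geo by (simp add: geodesic_def)
      show "continuous_on {0..1} (\<lambda>t. r * t)" by (intro continuous_intros)
      show "(\<lambda>t. r * t) ` {0..1} \<subseteq> {0..1}" using rt by (intro image_subsetI)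
    qed
    fix c assume "c \<in> A"
    then obtain w where w: "\<And>t. t \<in> {0..1} \<Longrightarrow> \<gamma> t \<in> fst c \<Longrightarrow>
        ((snd c \<circ> \<gamma>) has_vector_derivative w t) (at t within {0..1})"
      "\<And>t. t \<in> {0..1} \<Longrightarrow> \<gamma> t \<in> fst c \<Longrightarrow> (w has_vector_derivative spray A h c (snd c (\<gamma> t), w t))
          (at t within {0..1})"
      using geodesicD[OF geo] by metis
    have "((snd c \<circ> (\<lambda>t. \<gamma> (r * t))) has_vector_derivative r *\<^sub>R w (r * t)) (at t within {0..1}) \<and>
      ((\<lambda>t. r *\<^sub>R w (r * t)) has_vector_derivative
        spray A h c (snd c (\<gamma> (r * t)), r *\<^sub>R w (r * t))) (at t within {0..1})"
      if t: "t \<in> {0..1}" "\<gamma> (r * t) \<in> fst c" for t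
    proof
      show "((snd c \<circ> (\<lambda>t. \<gamma> (r * t))) has_vector_derivative r *\<^sub>R w (r * t)) (at t within {0..1})"
        using chain[OF w(1)[OF rt[OF t(1)] t(2)]] by (simp add: comp_def)
      have "((\<lambda>t. r *\<^sub>R w (r * t)) has_vector_derivative
          r *\<^sub>R r *\<^sub>R spray A h c (snd c (\<gamma> (r * t)), w (r * t))) (at t within {0..1})"
        using bounded_linear.has_vector_derivative[OF bounded_linear_scaleR_right
            chain[OF w(2)[OF rt[OF t(1)] t(2)]]] .
      then show "((\<lambda>t. r *\<^sub>R w (r * t)) has_vector_derivative
          spray A h c (snd c (\<gamma> (r * t)), r *\<^sub>R w (r * t))) (at t within {0..1})"
        by (simp add: spray_scaleR power2_eq_square)
    qed
    then show "\<exists>w. \<forall>t\<in>{0..1}. \<gamma> (r * t) \<in> fst c \<longrightarrow>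
       ((snd c \<circ> (\<lambda>t. \<gamma> (r * t))) has_vector_derivative w t) (at t within {0..1}) \<and>
       (w has_vector_derivative (\<chi> k. - (\<Sum>i\<in>UNIV. \<Sum>j\<in>UNIV.
          christoffel A h c (snd c (\<gamma> (r * t))) k i j * w t $ i * w t $ j))) (at t within {0..1})"
      unfolding spray_def fst_conv snd_conv by (intro exI[of _ "\<lambda>t. r *\<^sub>R w (r * t)"]) blast
  qed
  moreover have "velocity A {0..1} (\<lambda>t. \<gamma> (r * t)) 0 = (\<lambda>c. r *\<^sub>R v c)"
  proof
    fix c
    show "velocity A {0..1} (\<lambda>t. \<gamma> (r * t)) 0 c = r *\<^sub>R v c"
    proof (cases "c \<in> charts_at A q")
      case True
      then have c: "c \<in> A" "\<gamma> 0 \<in> fst c" using \<gamma>0 by (auto simp: charts_at_def)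
      obtain w where w: "\<And>t. t \<in> {0..1} \<Longrightarrow> \<gamma> t \<in> fst c \<Longrightarrow>
          ((snd c \<circ> \<gamma>) has_vector_derivative w t) (at t within {0..1})"
        using geodesicD[OF geo c(1)] by metis
      have d: "((snd c \<circ> \<gamma>) has_vector_derivative w 0) (at 0 within {0..1})"
        using w[of 0] c by simp
      have "((snd c \<circ> (\<lambda>t. \<gamma> (r * t))) has_vector_derivative r *\<^sub>R w 0) (at 0 within {0..1})"
        using chain[of "snd c \<circ> \<gamma>" "w 0" 0] d by (simp add: comp_def)
      then have "velocity A {0..1} (\<lambda>t. \<gamma> (r * t)) 0 c = r *\<^sub>R w 0"
        using True \<gamma>0 by (simp add: velocity_def vector_derivative_within_closed_interval)
      moreover have "v c = w 0"
        using True \<gamma>0 d unfolding vel[symmetric] by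
            (simp add: velocity_def vector_derivative_within_closed_interval)
      ultimately show ?thesis by simp
    next
      case False
      then show ?thesis unfolding vel[symmetric] using \<gamma>0 by (simp add: velocity_def)
    qed
  qed
  ultimately show ?thesis
    using \<gamma>0 by (simp add: geodesic_from_def)
qed

section \<open>Convex coordinate balls\<close>

text \<open>Reduces a condition on all charts at source and target to one coordinate map
  \<open>E\<close> with inverse \<open>F\<close>. Another chart at \<open>p\<close> changes tangent
  coordinates by a linear map, another chart on the manifold composes with a transition map, and
  both preserve C1.\<close>

lemma C1_diffeo_from_tangentI:
  fixes A :: "('m::{t2_space,second_countable_topology}, 'n::finite) chart set"
  assumes A: "smooth_atlas A" and c: "c \<in> charts_at A p"
    and V: "open V" and B: "open B" "B \<subseteq> snd c ` fst c"
    and E: "Ck_on 1 E V" "E ` V \<subseteq> B" and F: "Ck_on 1 F B"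
    and inv: "\<And>u. u \<in> V \<Longrightarrow> F (E u) = u" "\<And>y. y \<in> B \<Longrightarrow> F y \<in> V" "\<And>y. y \<in> B \<Longrightarrow> E (F y) = y"
    and f: "\<And>u. u \<in> V \<Longrightarrow> f (coord_vec A c p u) = chart_inv c (E u)"
  shows "C1_diffeo_from_tangent A p (coord_vec A c p ` V) (chart_inv c ` B) f"
    "open_in_tangent_space A p (coord_vec A c p ` V)"
proof -
  have cA: "c \<in> A" "p \<in> fst c" using c by (auto simp: charts_at_def)
  let ?e = "coord_vec A c p"
  have e_inj: "?e u = ?e u' \<longleftrightarrow> u = u'" for u u'
    using coord_vec_same[OF A c] by metis
  have e_mem: "?e u \<in> ?e ` V \<longleftrightarrow> u \<in> V" for u
    using e_inj by (auto simp: image_iff)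
  have ci_inj: "y = y'" if "y \<in> B" "y' \<in> B" "chart_inv c y = chart_inv c y'" for y y'
    using chart_chart_inv[OF A cA(1)] that B(2) by (metis subsetD)
  have f_mem: "f (?e u) \<in> chart_inv c ` B" if "u \<in> V" for u
    using f[OF that] E(2) that by auto
  have f_inj: "inj_on f (?e ` V)"
  proof (rule inj_onI)
    fix v v' assume "v \<in> ?e ` V" "v' \<in> ?e ` V" and eq: "f v = f v'"
    then obtain u u' where u: "u \<in> V" "u' \<in> V" "v = ?e u" "v' = ?e u'" by blast
    have "chart_inv c (E u) = chart_inv c (E u')"
      using eq unfolding u(3,4) f[OF u(1)] f[OF u(2)] .
    moreover have "E u \<in> B" "E u' \<in> B"
      using subsetD[OF E(2) imageI] u(1,2) by auto
    ultimately have Eu: "E u = E u'" using ci_inj by blast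
    have "u = F (E u)" using inv(1)[OF u(1)] by (rule sym)
    also have "\<dots> = F (E u')" by (simp only: Eu)
    also have "\<dots> = u'" by (rule inv(1)[OF u(2)])
    finally have "u = u'" .
    then show "v = v'" using u by simp
  qed
  have f_F: "f (?e (F y)) = chart_inv c y" if "y \<in> B" for y
    using f[OF inv(2)[OF that]] inv(3)[OF that] by simp
  have bij: "bij_betw f (?e ` V) (chart_inv c ` B)"
    unfolding bij_betw_def
  proof (intro conjI f_inj equalityI)
    show "f ` ?e ` V \<subseteq> chart_inv c ` B" using f_mem by blast
    show "chart_inv c ` B \<subseteq> f ` ?e ` V"
    proof
      fix m assume "m \<in> chart_inv c ` B"
      then obtain y where "y \<in> B" "m = chart_inv c y" by blast
      then show "m \<in> f ` ?e ` V" using f_F[of y] inv(2)[of y] by (metis imageI)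
    qed
  qed
  have inv_f: "inv_into (?e ` V) f (chart_inv c y) = ?e (F y)" if "y \<in> B" for y
    using inv_into_f_f[OF f_inj, of "?e (F y)"] f_F[OF that] inv(2)[OF that] by simp
  have change: "coord_vec A c' p u = ?e (transition_deriv c' c (snd c' p) u)"
    and lin: "linear (transition_deriv c' c (snd c' p))" if "c' \<in> charts_at A p" for c' u
    using coord_vec_change[OF A that c] linear_transition_deriv[OF A _ cA(1) _ cA(2), of c'] that
    by (auto simp: charts_at_def)
  have pre: "open {u. transition_deriv c' c (snd c' p) u \<in> V}" if "c' \<in> charts_at A p" for c'
  proof -
    have "continuous_on UNIV (transition_deriv c' c (snd c' p))"
      using lin[OF that] by (simp add: linear_continuous_on linear_conv_bounded_linear)
    from open_vimage[OF V this] show ?thesis by (simp only: vimage_def)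
  qed
  show "open_in_tangent_space A p (?e ` V)"
    unfolding open_in_tangent_space_def
    using coord_vec_in_tangent_space[OF A c] change pre by (auto simp: e_mem)
  have "continuous_on {u. coord_vec A c' p u \<in> ?e ` V} (f \<circ> coord_vec A c' p) \<and>
    (\<forall>d\<in>A. Ck_on 1 (snd d \<circ> f \<circ> coord_vec A c' p) {u. coord_vec A c' p u \<in> ?e ` V \<and> f
        (coord_vec A c' p u) \<in> fst d} \<and>
      Ck_on 1 (\<lambda>y. inv_into (?e ` V) f (chart_inv d y) c') (snd d ` (chart_inv c ` B \<inter> fst d)))"
    if c': "c' \<in> charts_at A p" for c'
  proof (intro conjI ballI)
    let ?L = "transition_deriv c' c (snd c' p)"
    let ?V = "{u. ?L u \<in> V}"
    have V': "{u. coord_vec A c' p u \<in> ?e ` V} = ?V"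
      by (simp add: change[OF c'] e_mem)
    have f': "f (coord_vec A c' p u) = chart_inv c (E (?L u))" if "u \<in> ?V" for u
      using f[of "?L u"] that by (simp add: change[OF c'])
    have E': "Ck_on 1 (\<lambda>u. E (?L u)) ?V"
      by (rule Ck_on_1_compose[OF E(1) Ck_on_1_bounded_linear])
        (use lin[OF c'] in \<open>auto simp: linear_conv_bounded_linear\<close>)
    have EB: "E (?L u) \<in> B" if "u \<in> ?V" for u using E(2) that by auto
    have "continuous_on ?V (\<lambda>u. chart_inv c (E (?L u)))"
      by (rule continuous_on_compose2[OF continuous_on_chart_inv[OF A cA(1)]
          Ck_on_1_imp_continuous_on[OF E']])
        (use EB B in blast)
    then have contf: "continuous_on ?V (f \<circ> coord_vec A c' p)"
      by (rule continuous_on_eq) (simp add: f')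
    then show "continuous_on {u. coord_vec A c' p u \<in> ?e ` V} (f \<circ> coord_vec A c' p)"
      by (simp only: V')
    fix d assume d: "d \<in> A"
    let ?W = "{u \<in> ?V. f (coord_vec A c' p u) \<in> fst d}"
    have W: "{u. coord_vec A c' p u \<in> ?e ` V \<and> f (coord_vec A c' p u) \<in> fst d} = ?W"
      using V' by blast
    have "?W = ?V \<inter> (f \<circ> coord_vec A c' p) -` fst d" by auto
    then have openW: "open ?W"
      using continuous_open_preimage[OF contf pre[OF c'] open_chart_domain[OF A d]] by simp
    have Wc: "E (?L u) \<in> snd c ` (fst c \<inter> fst d)" if "u \<in> ?W" for u
    proof -
      have "E (?L u) \<in> snd c ` fst c" using EB B that by blast
      moreover have "chart_inv c (E (?L u)) \<in> fst d" using f'[of u] that by simp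
      ultimately show ?thesis
        using chart_inv_mem[OF A cA(1)] chart_chart_inv[OF A cA(1)]
        by (intro image_eqI[of _ _ "chart_inv c (E (?L u))"]) auto
    qed
    have "Ck_on 1 (\<lambda>u. transition c d (E (?L u))) ?W"
      by (rule Ck_on_1_compose[OF transition_smooth[OF A cA(1) d] Ck_on_mono[OF E']])
          (use Wc in auto)
    then have "Ck_on 1 (snd d \<circ> f \<circ> coord_vec A c' p) ?W"
      using openW by (rule Ck_on_1_cong[rotated 2]) (simp add: f')
    then show "Ck_on 1 (snd d \<circ> f \<circ> coord_vec A c' p) {u. coord_vec A c' p u \<in> ?e ` V \<and> f
        (coord_vec A c' p u) \<in> fst d}"
      by (simp only: W)
    \<comment> \<open>For the inverse map the roles are reversed: \<open>transition d c\<close>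
      leads from the target chart into \<open>B\<close>, and \<open>?M\<close> reads off the
      component of the resulting vector in the chart \<open>c'\<close>.\<close>
    let ?M = "transition_deriv c c' (snd c p)"
    let ?Y = "snd d ` (chart_inv c ` B \<inter> fst d)"
    have UB: "chart_inv c ` B \<subseteq> fst c" using chart_inv_mem[OF A cA(1)] B by blast
    have openY: "open ?Y"
      by (intro open_chart_image_subset[OF A d] open_Int open_chart_inv_image[OF A cA(1)] B
          open_chart_domain[OF A d]) auto
    have Y: "transition d c y \<in> B" "chart_inv d y = chart_inv c (transition d c y)"
        "y \<in> snd d ` (fst d \<inter> fst c)"
      if y: "y \<in> ?Y" for y
    proof -
      obtain b where b: "b \<in> B" "chart_inv c b \<in> fst d" "y = snd d (chart_inv c b)" using y by blast
      have 1: "chart_inv d y = chart_inv c b" using chart_inv_chart[OF A d b(2)] b(3) by simp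
      then have 2: "transition d c y = b" using chart_chart_inv[OF A cA(1)] b(1) B by auto
      show "transition d c y \<in> B" "chart_inv d y = chart_inv c (transition d c y)" using 1 2 b
          by auto
      show "y \<in> snd d ` (fst d \<inter> fst c)" using b UB by auto
    qed
    have "linear ?M"
      using linear_transition_deriv[OF A cA(1) _ cA(2), of c'] c' by (auto simp: charts_at_def)
    then have M: "Ck_on 1 ?M UNIV"
      by (intro Ck_on_1_bounded_linear) (simp add: linear_conv_bounded_linear)
    have "?Y \<subseteq> snd d ` (fst d \<inter> fst c)" by (rule subsetI) (rule Y(3))
    moreover have "transition d c ` ?Y \<subseteq> B" by (rule image_subsetI) (rule Y(1))
    ultimately have FY: "Ck_on 1 (\<lambda>y. F (transition d c y)) ?Y"
      by (intro Ck_on_1_compose[OF F] Ck_on_mono[OF transition_smooth[OF A d cA(1)]])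
    have MF: "Ck_on 1 (\<lambda>y. ?M (F (transition d c y))) ?Y"
      by (rule Ck_on_1_compose[OF M FY subset_UNIV])
    have eq: "?M (F (transition d c y)) = inv_into (?e ` V) f (chart_inv d y) c'" if "y \<in> ?Y" for y
    proof -
      have "inv_into (?e ` V) f (chart_inv d y) = ?e (F (transition d c y))"
        by (subst Y(2)[OF that]) (rule inv_f[OF Y(1)[OF that]])
      moreover have "?e u c' = ?M u" for u using c' by (simp add: coord_vec_def)
      ultimately show ?thesis by metis
    qed
    show "Ck_on 1 (\<lambda>y. inv_into (?e ` V) f (chart_inv d y) c') ?Y"
      by (rule Ck_on_1_cong[OF openY eq MF])
  qed
  with bij show "C1_diffeo_from_tangent A p (?e ` V) (chart_inv c ` B) f"
    unfolding C1_diffeo_from_tangent_def Let_def by blast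
qed

text \<open>The set depends on the chart, on \<open>x0\<close> and on \<open>\<rho>\<close>, but not
  otherwise on the metric, so metrics that share the bounds share the convex ball.\<close>

lemma metric_convex_chart_ball:
  fixes A :: "('m::{t2_space,second_countable_topology}, 'n::finite) chart set"
  assumes A: "smooth_atlas A" and h: "pseudo_Riemannian A h"
    and C1: "\<And>c i j. c \<in> A \<Longrightarrow> Ck_on 1 (\<lambda>x. metric_matrix A h c x $ i $ j) (snd c ` fst c)"
    and spray_C1: "\<And>c. c \<in> A \<Longrightarrow> Ck_on 1 (spray A h c) (snd c ` fst c \<times> UNIV)"
    and c: "c \<in> A" and \<rho>: "\<rho> > 0"
    and sub: "\<And>q. q \<in> ball x0 (\<rho>/4) \<Longrightarrow> ball q \<rho> \<subseteq> snd c ` fst c"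
    and small: "\<And>q x w \<xi> \<eta>. q \<in> ball x0 (\<rho>/4) \<Longrightarrow> x \<in> ball q \<rho> \<Longrightarrow> w \<in> ball 0 \<rho> \<Longrightarrow>
       norm (frechet_derivative (spray A h c) (at (x, w)) (\<xi>, \<eta>)) \<le> 1/8 * (norm \<xi> + norm \<eta>)"
    and force: "\<And>q x w. q \<in> ball x0 (\<rho>/4) \<Longrightarrow> x \<in> ball q \<rho> \<Longrightarrow>
       norm (x - x0) * norm (spray A h c (x, w)) \<le> (norm w)\<^sup>2"
  shows "metric_convex A h (chart_inv c ` ball x0 (\<rho>/4))"
  unfolding metric_convex_def
proof (intro conjI ballI)
  let ?B = "ball x0 (\<rho>/4)"
  have Bsub: "?B \<subseteq> snd c ` fst c"
    using sub \<rho> by (meson centre_in_ball subset_iff)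
  show "open (chart_inv c ` ?B)"
    by (rule open_chart_inv_image[OF A c open_ball Bsub])
  fix p assume "p \<in> chart_inv c ` ?B"
  then obtain q where q: "q \<in> ?B" "p = chart_inv c q" by blast
  have p: "p \<in> fst c" "snd c p = q"
    using chart_inv_mem[OF A c] chart_chart_inv[OF A c] q Bsub by auto
  have cp: "c \<in> charts_at A p" using c p by (simp add: charts_at_def)
  have f: "Ck_on 1 (spray A h c) (ball q \<rho> \<times> ball 0 \<rho>)"
    using sub[OF q(1)] by (intro Ck_on_mono[OF spray_C1[OF c]]) auto
  have zero: "spray A h c (q, 0) = 0"
    by (simp add: spray_def vec_eq_iff)
  obtain X W F where XB: "\<And>u t. u \<in> ball 0 (3/4 * \<rho>) \<Longrightarrow> t \<in> {0..1} \<Longrightarrow> X u t \<in> ball q \<rho>"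
    and X0: "\<And>u. u \<in> ball 0 (3/4 * \<rho>) \<Longrightarrow> X u 0 = q"
    and W0: "\<And>u. u \<in> ball 0 (3/4 * \<rho>) \<Longrightarrow> W u 0 = u"
    and dX: "\<And>u t. u \<in> ball 0 (3/4 * \<rho>) \<Longrightarrow> t \<in> {0..1} \<Longrightarrow>
       (X u has_vector_derivative W u t) (at t within {0..1})"
    and dW: "\<And>u t. u \<in> ball 0 (3/4 * \<rho>) \<Longrightarrow> t \<in> {0..1} \<Longrightarrow>
       (W u has_vector_derivative spray A h c (X u t, W u t)) (at t within {0..1})"
    and E1: "Ck_on 1 (\<lambda>u. X u 1) (ball 0 (3/4 * \<rho>))"
    and E0: "X 0 1 = q"
    and F: "\<And>y. y \<in> ball q (\<rho>/2) \<Longrightarrow> F y \<in> ball 0 (3/4 * \<rho>)"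
       "\<And>y. y \<in> ball q (\<rho>/2) \<Longrightarrow> X (F y) 1 = y"
       "\<And>u. u \<in> ball 0 (3/4 * \<rho>) \<Longrightarrow> X u 1 \<in> ball q (\<rho>/2) \<Longrightarrow> F (X u 1) = u"
       "Ck_on 1 F (ball q (\<rho>/2))"
    by (rule spray_exponential[OF \<rho> f zero small[OF q(1)]]; (rule that)?; assumption)
  let ?C = "ball (0::real^'n) (3/4 * \<rho>)"
  let ?e = "coord_vec A c p"
  \<comment> \<open>The restriction to \<open>?C\<close> selects the velocities for which the
    end-point map is controlled; \<open>F\<close> takes its values there, so no point of the ball is
    lost as an end point.\<close>
  define V where "V = {u \<in> ?C. X u 1 \<in> ?B}"
  \<comment> \<open>Two points of a ball of radius \<rho>/4 are less than \<rho>/2 apart, the radius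
    on which the end-point map is inverted. This fixes the size of the neighbourhood, whichever base
    point \<open>q\<close> in it is taken.\<close>
  have Bq: "?B \<subseteq> ball q (\<rho>/2)"
  proof
    fix y assume "y \<in> ?B"
    then show "y \<in> ball q (\<rho>/2)"
      using q(1) dist_triangle2[of q y x0] by (simp add: dist_commute)
  qed
  have Xc: "X u t \<in> snd c ` fst c" if "u \<in> ?C" "t \<in> {0..1}" for u t
    using XB[OF that] sub[OF q(1)] by blast
  have geo: "geodesic_from A h p (?e u) (\<lambda>t. chart_inv c (X u t))" if "u \<in> ?C" for u
    using coordinate_geodesic[OF A h C1 c Xc[OF that] dX[OF that] dW[OF that]]
    by (simp add: X0[OF that] W0[OF that] q(2))
  have exp: "exp_map A h p (?e u) = chart_inv c (X u 1)" if "u \<in> ?C" for u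
    by (rule exp_map_eq[OF A spray_C1 geo[OF that]])
  \<comment> \<open>Both sides are end points of geodesics with the same initial data, so uniqueness
    identifies them on the manifold; applying the chart recovers the equality in
    coordinates.\<close>
  have scale: "X (t *\<^sub>R u) 1 = X u t" "t *\<^sub>R u \<in> ?C" if u: "u \<in> ?C" and t: "t \<in> {0..1}" for u t
  proof -
    have "\<bar>t\<bar> * norm u \<le> norm u" using t by (intro mult_left_le_one_le) auto
    then show tu: "t *\<^sub>R u \<in> ?C" using u by simp
    have "geodesic_from A h p (?e (t *\<^sub>R u)) (\<lambda>s. chart_inv c (X u (t * s)))"
      using geodesic_from_scale[OF geo[OF u] t] by (simp add: coord_vec_scaleR[OF A cp])
    from exp_map_eq[OF A spray_C1 this]
    have eq: "chart_inv c (X (t *\<^sub>R u) 1) = chart_inv c (X u t)"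
      using exp[OF tu] by simp
    have "X (t *\<^sub>R u) 1 = snd c (chart_inv c (X (t *\<^sub>R u) 1))"
      by (rule chart_chart_inv[OF A c Xc[OF tu], symmetric]) simp
    also have "\<dots> = X u t"
      unfolding eq by (rule chart_chart_inv[OF A c Xc[OF u t]])
    finally show "X (t *\<^sub>R u) 1 = X u t" .
  qed
  have star: "t *\<^sub>R u \<in> V" if u: "u \<in> V" and t: "t \<in> {0..1}" for u t
  proof -
    have uC: "u \<in> ?C" "X u 1 \<in> ?B" using u by (auto simp: V_def)
    \<comment> \<open>A priori the curve is known to stay in \<open>ball q \<rho>\<close>, which is
      where \<open>force\<close> is available; convexity improves this to the smaller ball
      \<open>?B\<close>.\<close>
    have "X u t \<in> ?B"
    proof (rule ball_convex_along_spray[OF dX[OF uC(1)] dW[OF uC(1)]])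
      show "norm (X u s - x0) * norm (spray A h c (X u s, W u s)) \<le> (norm (W u s))\<^sup>2" if
          "s \<in> {0..1}" for s
        by (rule force[OF q(1) XB[OF uC(1) that]])
    qed (use X0[OF uC(1)] q(1) uC t in auto)
    then show ?thesis
      using scale[OF uC(1) t] by (simp add: V_def)
  qed
  have openV: "open V"
  proof -
    have "V = ?C \<inter> (\<lambda>u. X u 1) -` ?B" by (auto simp: V_def)
    then show ?thesis
      using continuous_open_preimage[OF Ck_on_1_imp_continuous_on[OF E1] open_ball open_ball]
          by simp
  qed
  have VC: "V \<subseteq> ?C" by (auto simp: V_def)
  note diffeo = C1_diffeo_from_tangentI[OF A cp openV open_ball Bsub Ck_on_mono[OF E1 VC] _
      Ck_on_mono[OF F(4) Bq], of "exp_map A h p"]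
  have D: "C1_diffeo_from_tangent A p (?e ` V) (chart_inv c ` ?B) (exp_map A h p)"
    "open_in_tangent_space A p (?e ` V)"
    by (rule diffeo; use F Bq exp in \<open>auto simp: V_def\<close>)+
  show "normal_neighborhood A h p (chart_inv c ` ?B)"
    unfolding normal_neighborhood_def
  proof (intro exI[of _ "?e ` V"] conjI D)
    have "0 \<in> V" using E0 q(1) \<rho> by (simp add: V_def)
    then show "(\<lambda>c. 0) \<in> ?e ` V"
      using coord_vec_zero[OF A cp] by (metis imageI)
    show "star_shaped (?e ` V)"
      unfolding star_shaped_def
    proof (intro ballI)
      fix v t assume "v \<in> ?e ` V" and t: "t \<in> {0..1::real}"
      then obtain u where "u \<in> V" "v = ?e u" by blast
      then show "(\<lambda>c. t *\<^sub>R v c) \<in> ?e ` V"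
        using coord_vec_scaleR[OF A cp, of t u] star[OF _ t] by (metis imageI)
    qed
    show "?e ` V \<subseteq> exp_domain A h p"
      unfolding exp_domain_def using coord_vec_in_tangent_space[OF A cp] geo VC by blast
  qed
qed

theorem lemma3p4:
  fixes A :: "('m::{t2_space,second_countable_topology}, 'n::finite) chart set"
    and g :: "real \<Rightarrow> ('m, 'n) metric"
    and a \<epsilon>\<^sub>0 :: real and p\<^sub>0 :: 'm
  assumes "smooth_atlas A"
    and "a > 0"
    and "C2_metric_family A a g"
    and "\<epsilon>\<^sub>0 \<in> {0<..<a}"
  shows "\<exists>U. open U \<and> p\<^sub>0 \<in> U \<and> (\<forall>\<epsilon>\<in>{-\<epsilon>\<^sub>0..\<epsilon>\<^sub>0}. metric_convex A (g \<epsilon>) U)"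
proof -
  note A = assms(1) and g = assms(3)
  obtain c where c: "c \<in> A" "p\<^sub>0 \<in> fst c"
    using chart_at_exists[OF A, of p\<^sub>0] by (auto simp: charts_at_def)
  let ?I = "{-a<..<a}" and ?J = "{-\<epsilon>\<^sub>0..\<epsilon>\<^sub>0}" and ?S = "snd c ` fst c"
  define x0 where "x0 = snd c p\<^sub>0"
  \<comment> \<open>The parameter becomes one more variable, so that a single application of the
    uniform bounds covers all metrics at once.\<close>
  define f where "f = (\<lambda>z. spray A (g (fst z)) c (snd z))"
  have f: "Ck_on 1 f (?I \<times> ?S \<times> UNIV)"
    unfolding f_def by (rule Ck_on_1_spray_family[OF A g c(1)])
  \<comment> \<open>Here \<open>\<epsilon>\<^sub>0 < a\<close> enters: the parameters form a compact
    interval inside the open one.\<close>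
  have JI: "?J \<subseteq> ?I" using assms(4) by auto
  have x0: "x0 \<in> ?S" using c by (simp add: x0_def)
  have hom: "f (\<epsilon>, x, s *\<^sub>R w) = s\<^sup>2 *\<^sub>R f (\<epsilon>, x, w)" for \<epsilon> x w s
    by (simp add: f_def spray_scaleR)
  obtain \<rho> where \<rho>: "\<rho> > 0"
    "\<And>q. q \<in> ball x0 (\<rho>/4) \<Longrightarrow> ball q \<rho> \<subseteq> ?S"
    "\<And>\<epsilon> q x w \<xi> \<eta>. \<epsilon> \<in> ?J \<Longrightarrow> q \<in> ball x0 (\<rho>/4) \<Longrightarrow> x \<in> ball q \<rho> \<Longrightarrow> w \<in> ball 0 \<rho> \<Longrightarrow>
       norm (frechet_derivative f (at (\<epsilon>, x, w)) (0, \<xi>, \<eta>)) \<le> 1/8 * (norm \<xi> + norm \<eta>)"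
    "\<And>\<epsilon> q x w. \<epsilon> \<in> ?J \<Longrightarrow> q \<in> ball x0 (\<rho>/4) \<Longrightarrow> x \<in> ball q \<rho> \<Longrightarrow>
       norm (x - x0) * norm (f (\<epsilon>, x, w)) \<le> (norm w)\<^sup>2"
    by (rule quadratic_family_uniform_bounds[OF f open_greaterThanLessThan
        open_chart_image[OF A c(1)]
        compact_Icc JI x0 hom]; (rule that)?; assumption)
  have "metric_convex A (g \<epsilon>) (chart_inv c ` ball x0 (\<rho>/4))" if \<epsilon>: "\<epsilon> \<in> ?J" for \<epsilon>
  proof -
    have \<epsilon>I: "\<epsilon> \<in> ?I" using \<epsilon> JI by blast
    have h: "pseudo_Riemannian A (g \<epsilon>)" using g \<epsilon>I by (simp add: C2_metric_family_def)
    have slice: "(\<lambda>z. f (\<epsilon>, z)) = spray A (g \<epsilon>) c" by (simp add: f_def)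
    show ?thesis
    proof (rule metric_convex_chart_ball[OF A h Ck_on_1_metric_matrix[OF g _ \<epsilon>I]
          Ck_on_1_spray[OF A g _ \<epsilon>I] c(1) \<rho>(1,2)])
      fix q x w \<xi> \<eta>
      assume q: "q \<in> ball x0 (\<rho>/4)" and x: "x \<in> ball q \<rho>"
      show "norm (x - x0) * norm (spray A (g \<epsilon>) c (x, w)) \<le> (norm w)\<^sup>2"
        using \<rho>(4)[OF \<epsilon> q x, of w] by (simp add: f_def)
      assume w: "w \<in> ball 0 \<rho>"
      have "(x, w) \<in> ?S \<times> UNIV" using \<rho>(2)[OF q] x by auto
      from Ck_on_1_slice(2)[OF f \<epsilon>I this, of "(\<xi>, \<eta>)"]
      show "norm (frechet_derivative (spray A (g \<epsilon>) c) (at (x, w)) (\<xi>, \<eta>))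
          \<le> 1/8 * (norm \<xi> + norm \<eta>)"
        using \<rho>(3)[OF \<epsilon> q x w, of \<xi> \<eta>] unfolding slice by simp
    qed
  qed
  moreover have sub: "ball x0 (\<rho>/4) \<subseteq> ?S"
    using \<rho>(1,2) by (meson centre_in_ball subset_iff)
  moreover have "open (chart_inv c ` ball x0 (\<rho>/4))"
    by (rule open_chart_inv_image[OF A c(1) open_ball sub])
  moreover have "p\<^sub>0 \<in> chart_inv c ` ball x0 (\<rho>/4)"
    using \<rho>(1) chart_inv_chart[OF A c] by (intro image_eqI[of _ _ x0]) (auto simp: x0_def)
  ultimately show ?thesis by blast
qed

end
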